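(* Let $\Omega\subset\mathbb{R}^n$ be open and let $V$ be a closed subspace of $W^{1,2}(\Omega)$ which contains $C^\infty_c(\Omega)$ and satisfies $\eta f\in V$ for all $\eta\in\mathop{\mathrm{Lip}}(\Omega)$ and $f\in V$. Let $a,A_{jk}\in L^\infty$ ($j,k=0,\dots,n$), and suppose there is $\lambda>0$ with $a(x)\geq\lambda$ and $\sum_{j,k=1}^nA_{jk}(x)\zeta_k\overline{\zeta_j}\geq\lambda|\zeta|^2$ for a.e. $x\in\Omega$ and all $\zeta\in\mathbb{C}^n$. Define $\nabla_V:V\subset L^2(\Omega)\to L^2(\Omega,\mathbb{C}^n)$ by $\nabla_Vf=(\partial_jf)_j$ and $\mathop{\mathrm{div}}_V:=-\nabla_V^*$, and define $L$ in $L^2(\Omega)$ by $$Lu=-a\sum_{j,k=1}^n\partial_jA_{jk}\partial_ku-a\sum_{j=1}^n\partial_jA_{j0}u+a\sum_{k=1}^nA_{0k}\partial_ku+aA_{00}u,$$ i.e. $Lu=a\big(A_{00}u+\sum_kA_{0k}\partial_ku-\mathop{\mathrm{div}}_V(\sum_{k=1}^nA_{jk}\partial_ku+A_{j0}u)_j\big)$, with $\mathsf{Dom}(L)=\{u\in V;\,(\sum_{k=1}^nA_{jk}\partial_ku+A_{j0}u)_j\in\mathsf{Dom}(\mathop{\mathrm{div}}_V)\}$. If $f\in V$ and $g\in L^2(\Omega)$ with $\mathop{\mathrm{sppt}}(f)\cup\mathop{\mathrm{sppt}}(g)\subset K\subset\Omega$, then the solution $$F(t)=\cos(t\sqrt{L})f+\int_0^t\cos(s\sqrt{L})g\,ds$$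 of the Cauchy problem $\frac{\partial^2}{\partial t^2}F(t)+LF(t)=0$ for $t>0$, $\lim_{t\to0}F(t)=f$, $\lim_{t\to0}\frac{\partial}{\partial t}F(t)=g$, satisfies $\mathop{\mathrm{sppt}}(F(t))\subset K_{\tilde\alpha t}:=\{x\in\Omega;\,\mathop{\mathrm{dist}}(x,K)\leq\tilde\alpha t\}$ for all $t>0$, for some finite constant $\tilde\alpha$ (independent of $f,g,K,t$).
   Context: $W^{1,2}(\Omega)$ is the Sobolev space of $f\in L^2(\Omega)$ with distributional gradient in $L^2$. $\mathop{\mathrm{Lip}}(\Omega)$ is the space of bounded real-valued Lipschitz functions on $\Omega$ (Euclidean distance). Explicitly, $\mathop{\mathrm{div}}_Vu=\sum_j\partial_ju_j$ on $\mathsf{Dom}(\mathop{\mathrm{div}}_V)=\{u\in L^2(\Omega,\mathbb{C}^n);\,\mathop{\mathrm{div}}u\in L^2(\Omega)\text{ and }(-\nabla f,u)=(f,\mathop{\mathrm{div}}u)\ \forall f\in V\}$. The operator $-L$ generates a strongly continuous cosine operator family on $L^2(\Omega)$, denoted $(\cos(t\sqrt{L}))_{t\geq0}$; the square root sign is purely notational (no operator $\sqrt{L}$ is assumed to exist). Equivalently, it is the leading diagonal component of $\cos(tBD)=\frac12(e^{itBD}+e^{-itBD})$, where on $L^2(\Omega)\oplus L^2(\Omega)\oplus L^2(\Omega,\mathbb{C}^n)$ one sets $D=\begin{pmatrix}0&I&-\mathop{\mathrm{div}}_V\\ I&0&0\\ \nabla_V&0&0\end{pmatrix}$ and $B=\begin{pmatrix}a&0&0\\0&A_{00}&(A_{0k})\\0&(A_{j0})&(A_{jk})\end{pmatrix}$,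 and $(BD)^2$ has $L$ as its $(1,1)$ entry. Supports are taken in the a.e. sense. *)

theory Defs
  imports "HOL-Analysis.Analysis"
begin

text \<open>Functions on \<Omega> are represented by functions 'n \<Rightarrow> complex, where 'n is
  a Euclidean space (so n = DIM('n)); elements of L2 are representatives, and all
  notions below are invariant under equality almost everywhere.  Directions
  j = 1..n are indexed by the basis vectors b in Basis; vector fields in
  L2(\<Omega>,C^n) are functions u :: 'n \<Rightarrow> 'n \<Rightarrow> complex, with u b the b-th component.\<close>

definition sq_int :: "'n::euclidean_space set \<Rightarrow> ('n \<Rightarrow> complex) \<Rightarrow> bool" where
  "sq_int \<Omega> f \<longleftrightarrow> f \<in> borel_measurable (lebesgue_on \<Omega>) \<and>
     integrable (lebesgue_on \<Omega>) (\<lambda>x. (cmod (f x))\<^sup>2)"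

definition aeeq :: "'n::euclidean_space set \<Rightarrow> ('n \<Rightarrow> complex) \<Rightarrow> ('n \<Rightarrow> complex) \<Rightarrow> bool" where
  "aeeq \<Omega> f g \<longleftrightarrow> (AE x in lebesgue_on \<Omega>. f x = g x)"

definition l2inner :: "'n::euclidean_space set \<Rightarrow> ('n \<Rightarrow> complex) \<Rightarrow> ('n \<Rightarrow> complex) \<Rightarrow> complex" where
  "l2inner \<Omega> f g = (\<integral>x. f x * cnj (g x) \<partial>lebesgue_on \<Omega>)"

definition l2norm :: "'n::euclidean_space set \<Rightarrow> ('n \<Rightarrow> complex) \<Rightarrow> real" where
  "l2norm \<Omega> f = sqrt (\<integral>x. (cmod (f x))\<^sup>2 \<partial>lebesgue_on \<Omega>)"

text \<open>Infinitely differentiable functions: there is a family of all iterated partial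
  derivatives D bs (bs a list of directions), each Frechet differentiable everywhere.\<close>
definition smooth_fun :: "('n::euclidean_space \<Rightarrow> complex) \<Rightarrow> bool" where
  "smooth_fun \<phi> \<longleftrightarrow> (\<exists>D :: 'n list \<Rightarrow> 'n \<Rightarrow> complex. D [] = \<phi> \<and>
     (\<forall>bs x. (D bs has_derivative (\<lambda>h. \<Sum>b\<in>Basis. of_real (h \<bullet> b) * D (b # bs) x)) (at x)))"

definition test_fun :: "'n::euclidean_space set \<Rightarrow> ('n \<Rightarrow> complex) \<Rightarrow> bool" where
  "test_fun \<Omega> \<phi> \<longleftrightarrow> smooth_fun \<phi> \<and> compact (closure {x. \<phi> x \<noteq> 0}) \<and>
     closure {x. \<phi> x \<noteq> 0} \<subseteq> \<Omega>"

definition cpartial :: "'n::euclidean_space \<Rightarrow> ('n \<Rightarrow> complex) \<Rightarrow> 'n \<Rightarrow> complex" where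
  "cpartial b \<phi> x = frechet_derivative \<phi> (at x) b"

definition weak_partial :: "'n::euclidean_space set \<Rightarrow> ('n \<Rightarrow> complex) \<Rightarrow> 'n \<Rightarrow> ('n \<Rightarrow> complex) \<Rightarrow> bool" where
  "weak_partial \<Omega> f b g \<longleftrightarrow> (\<forall>\<phi>. test_fun \<Omega> \<phi> \<longrightarrow>
     (\<integral>x. f x * cpartial b \<phi> x \<partial>lebesgue_on \<Omega>) = - (\<integral>x. g x * \<phi> x \<partial>lebesgue_on \<Omega>))"

definition W12 :: "'n::euclidean_space set \<Rightarrow> ('n \<Rightarrow> complex) \<Rightarrow> bool" where
  "W12 \<Omega> f \<longleftrightarrow> sq_int \<Omega> f \<and> (\<forall>b\<in>Basis. \<exists>g. sq_int \<Omega> g \<and> weak_partial \<Omega> f b g)"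

text \<open>Weak partial derivative (a representative of the unique L2 class).\<close>
definition wgrad :: "'n::euclidean_space set \<Rightarrow> ('n \<Rightarrow> complex) \<Rightarrow> 'n \<Rightarrow> 'n \<Rightarrow> complex" where
  "wgrad \<Omega> f b = (SOME g. sq_int \<Omega> g \<and> weak_partial \<Omega> f b g)"

definition W12_norm :: "'n::euclidean_space set \<Rightarrow> ('n \<Rightarrow> complex) \<Rightarrow> real" where
  "W12_norm \<Omega> f = sqrt ((l2norm \<Omega> f)\<^sup>2 + (\<Sum>b\<in>Basis. (l2norm \<Omega> (wgrad \<Omega> f b))\<^sup>2))"

definition Lip_bdd :: "'n::euclidean_space set \<Rightarrow> ('n \<Rightarrow> real) \<Rightarrow> bool" where
  "Lip_bdd \<Omega> \<eta> \<longleftrightarrow> bounded (\<eta> ` \<Omega>) \<and> (\<exists>C. lipschitz_on C \<Omega> \<eta>)"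

definition admissible_V :: "'n::euclidean_space set \<Rightarrow> ('n \<Rightarrow> complex) set \<Rightarrow> bool" where
  "admissible_V \<Omega> V \<longleftrightarrow>
     V \<subseteq> {f. W12 \<Omega> f} \<and>
     (\<lambda>x. 0) \<in> V \<and>
     (\<forall>f\<in>V. \<forall>g\<in>V. \<forall>c. (\<lambda>x. c * f x + g x) \<in> V) \<and>
     (\<forall>f\<in>V. \<forall>g. W12 \<Omega> g \<and> aeeq \<Omega> f g \<longrightarrow> g \<in> V) \<and>
     (\<forall>fs f. (\<forall>k. fs k \<in> V) \<and> W12 \<Omega> f \<and>
        (\<lambda>k. W12_norm \<Omega> (\<lambda>x. fs k x - f x)) \<longlonglongrightarrow> 0 \<longrightarrow> f \<in> V) \<and>
     {\<phi>. test_fun \<Omega> \<phi>} \<subseteq> V \<and>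
     (\<forall>\<eta> f. Lip_bdd \<Omega> \<eta> \<and> f \<in> V \<longrightarrow> (\<lambda>x. of_real (\<eta> x) * f x) \<in> V)"

definition Linfty :: "'n::euclidean_space set \<Rightarrow> ('n \<Rightarrow> 'b::{banach,second_countable_topology}) \<Rightarrow> bool" where
  "Linfty \<Omega> h \<longleftrightarrow> h \<in> borel_measurable (lebesgue_on \<Omega>) \<and>
     (\<exists>M. AE x in lebesgue_on \<Omega>. norm (h x) \<le> M)"

text \<open>Graph of div_V = - (nabla_V)^*: (u, w) with u in L2(\<Omega>,C^n), w in L2(\<Omega>)
  and (-\<nabla>f, u) = (f, w) for all f in V.\<close>
definition div_V :: "'n::euclidean_space set \<Rightarrow> ('n \<Rightarrow> complex) set \<Rightarrow>
    ('n \<Rightarrow> 'n \<Rightarrow> complex) \<Rightarrow> ('n \<Rightarrow> complex) \<Rightarrow> bool" where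
  "div_V \<Omega> V u w \<longleftrightarrow> (\<forall>b\<in>Basis. sq_int \<Omega> (u b)) \<and> sq_int \<Omega> w \<and>
     (\<forall>f\<in>V. - (\<Sum>b\<in>Basis. l2inner \<Omega> (wgrad \<Omega> f b) (u b)) = l2inner \<Omega> f w)"

text \<open>Graph of L: (u, w) with u in Dom(L) and w = Lu (a.e.).
  A00 = A_{00}, A0 k = A_{0k}, Aj0 j = A_{j0}, A j k = A_{jk} for j,k in Basis.\<close>
definition L_op :: "'n::euclidean_space set \<Rightarrow> ('n \<Rightarrow> complex) set \<Rightarrow> ('n \<Rightarrow> real) \<Rightarrow>
    ('n \<Rightarrow> complex) \<Rightarrow> ('n \<Rightarrow> 'n \<Rightarrow> complex) \<Rightarrow> ('n \<Rightarrow> 'n \<Rightarrow> complex) \<Rightarrow>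
    ('n \<Rightarrow> 'n \<Rightarrow> 'n \<Rightarrow> complex) \<Rightarrow> ('n \<Rightarrow> complex) \<Rightarrow> ('n \<Rightarrow> complex) \<Rightarrow> bool" where
  "L_op \<Omega> V a A00 A0 Aj0 A u w \<longleftrightarrow> u \<in> V \<and>
     (\<exists>d. div_V \<Omega> V (\<lambda>j x. (\<Sum>k\<in>Basis. A j k x * wgrad \<Omega> u k x) + Aj0 j x * u x) d \<and>
          aeeq \<Omega> w (\<lambda>x. of_real (a x) *
             (A00 x * u x + (\<Sum>k\<in>Basis. A0 k x * wgrad \<Omega> u k x) - d x)))"

definition cosine_family_gen :: "'n::euclidean_space set \<Rightarrow> (real \<Rightarrow> ('n \<Rightarrow> complex) \<Rightarrow> ('n \<Rightarrow> complex)) \<Rightarrow>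
    (('n \<Rightarrow> complex) \<Rightarrow> ('n \<Rightarrow> complex) \<Rightarrow> bool) \<Rightarrow> bool" where
  "cosine_family_gen \<Omega> C Gen \<longleftrightarrow>
     (\<forall>t f. sq_int \<Omega> f \<longrightarrow> sq_int \<Omega> (C t f)) \<and>
     (\<forall>t f g. sq_int \<Omega> f \<and> sq_int \<Omega> g \<and> aeeq \<Omega> f g \<longrightarrow> aeeq \<Omega> (C t f) (C t g)) \<and>
     (\<forall>t f g c. sq_int \<Omega> f \<and> sq_int \<Omega> g \<longrightarrow>
        aeeq \<Omega> (C t (\<lambda>x. c * f x + g x)) (\<lambda>x. c * C t f x + C t g x)) \<and>
     (\<forall>t. \<exists>M. \<forall>f. sq_int \<Omega> f \<longrightarrow> l2norm \<Omega> (C t f) \<le> M * l2norm \<Omega> f) \<and>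
     (\<forall>f. sq_int \<Omega> f \<longrightarrow> aeeq \<Omega> (C 0 f) f) \<and>
     (\<forall>t s f. sq_int \<Omega> f \<longrightarrow>
        aeeq \<Omega> (\<lambda>x. C (t + s) f x + C (t - s) f x) (\<lambda>x. 2 * C t (C s f) x)) \<and>
     (\<forall>f t. sq_int \<Omega> f \<longrightarrow> ((\<lambda>s. l2norm \<Omega> (\<lambda>x. C s f x - C t f x)) \<longlongrightarrow> 0) (at t)) \<and>
     (\<forall>u w. sq_int \<Omega> u \<and> sq_int \<Omega> w \<longrightarrow>
        (((\<lambda>s. l2norm \<Omega> (\<lambda>x. of_real (2 / s\<^sup>2) * (C s u x - u x) - w x)) \<longlongrightarrow> 0) (at 0)
          \<longleftrightarrow> Gen u w))"

text \<open>h represents the L2-valued integral \<integral>_0^t C(s) g ds (characterised weakly).\<close>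
definition time_integral :: "'n::euclidean_space set \<Rightarrow> (real \<Rightarrow> ('n \<Rightarrow> complex) \<Rightarrow> ('n \<Rightarrow> complex)) \<Rightarrow>
    ('n \<Rightarrow> complex) \<Rightarrow> real \<Rightarrow> ('n \<Rightarrow> complex) \<Rightarrow> bool" where
  "time_integral \<Omega> C g t h \<longleftrightarrow> sq_int \<Omega> h \<and>
     (\<forall>\<phi>. sq_int \<Omega> \<phi> \<longrightarrow> l2inner \<Omega> h \<phi> = integral {0..t} (\<lambda>s. l2inner \<Omega> (C s g) \<phi>))"

definition esssupp :: "'n::euclidean_space set \<Rightarrow> ('n \<Rightarrow> complex) \<Rightarrow> 'n set" where
  "esssupp \<Omega> f = {x \<in> \<Omega>. \<not> (\<exists>U. open U \<and> x \<in> U \<and> (AE y in lebesgue_on (\<Omega> \<inter> U). f y = 0))}"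

text \<open>K_r = {x in \<Omega>. dist(x,K) \<le> r}  (empty when K is empty, as dist(x,{}) = \<infinity>).\<close>
definition nbhd :: "'n::euclidean_space set \<Rightarrow> 'n set \<Rightarrow> real \<Rightarrow> 'n set" where
  "nbhd \<Omega> K r = {x \<in> \<Omega>. K \<noteq> {} \<and> infdist x K \<le> r}"

end

theory Submission
  imports Defs
begin

text \<open>
  Finite propagation speed by a weighted energy estimate.  For \<open>u(t) = \<integral>\<^sub>0\<^sup>t cos(s \<surd>L) g ds\<close> and a
  smooth weight \<open>\<eta>\<close> with \<open>|\<nabla>\<eta>| \<le> \<rho> \<eta>\<close> consider
  \<open>E(t) = \<integral> \<eta> (|u'|\<^sup>2/a + A\<nabla>u\<cdot>\<nabla>u + 2 Re A\<^sub>j\<^sub>0 u \<partial>\<^sub>ju + \<kappa> |u|\<^sup>2)\<close>.  The cross term absorbs the products of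
  \<open>A\<^sub>j\<^sub>0 u\<close> with \<open>\<nabla>u'\<close>, which the energy does not control, and \<open>\<kappa>\<close> makes \<open>E\<close> positive; then
  \<open>E' \<le> (M + \<rho> \<alpha>) E\<close> with \<open>M\<close> and \<open>\<alpha>\<close> independent of \<open>\<rho>\<close>.  With
  \<open>\<eta>(x) = \<Prod>\<^sub>b sech (\<rho> (x - x\<^sub>0)\<^sub>b)\<close>, which decays like \<open>exp(- \<rho> |x - x\<^sub>0|\<^sub>1)\<close>, letting \<open>\<rho>\<close> tend to
  infinity shows that \<open>u(t)\<close> vanishes near \<open>x\<^sub>0\<close> if \<open>g\<close> vanishes on a ball of radius larger than
  \<open>\<alpha> t\<close> around \<open>x\<^sub>0\<close>.  Differentiating in \<open>t\<close> from the left gives the same for \<open>cos(t \<surd>L) f\<close>.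
\<close>

section \<open>The Hilbert space of square integrable functions\<close>

text \<open>The estimate uses \<open>\<eta> u'\<close> as a test function. Since \<open>V\<close> is
  stable under bounded Lipschitz multipliers, this product stays in \<open>V\<close>, and no
  boundary terms arise, whatever boundary condition \<open>V\<close> encodes. The derivative of the
  gradient term closes up because the ellipticity hypothesis makes the form of the
  \<open>A j k\<close> real-valued, hence Hermitian. The obstacle is regularity: for general
  \<open>g\<close> the function \<open>u\<close> is not twice differentiable in time and
  \<open>u'\<close> need not lie in \<open>V\<close>. The estimate is therefore proved for
  regularised solutions, second differences of a repeated time integral of the family, whose
  velocities again lie in the domain of the generator. Its two sides contain only weighted L2 norms
  of \<open>u\<close> and of the initial velocity, so it survives the removal of the regularisation.
  Time derivatives and limits are taken in a Hilbert space of classes on all of the Euclidean space;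
  functions on \<Omega> are extended by zero, and the family by the identity. The speed is the
  coefficient of \<rho> in the pointwise estimate divided by the constant \<open>c0\<close> that
  bounds the energy density from below.\<close>

definition L2 :: "'a measure \<Rightarrow> ('a \<Rightarrow> complex) \<Rightarrow> bool" where
  "L2 M f \<longleftrightarrow> f \<in> borel_measurable M \<and> integrable M (\<lambda>x. (cmod (f x))\<^sup>2)"

lemma L2_measurable [measurable_dest]: "L2 M f \<Longrightarrow> f \<in> borel_measurable M"
  by (simp add: L2_def)

lemma L2_integrable: "L2 M f \<Longrightarrow> integrable M (\<lambda>x. (cmod (f x))\<^sup>2)"
  by (simp add: L2_def)

lemma two_mult_le_squares: "2 * (x * y) \<le> x\<^sup>2 + y\<^sup>2" for x y :: real
  using sum_squares_bound[of x y] by simp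

lemma L2_dominated:
  assumes "f \<in> borel_measurable M" "integrable M g" "AE x in M. (cmod (f x))\<^sup>2 \<le> g x"
  shows "L2 M f"
  unfolding L2_def
proof
  show "integrable M (\<lambda>x. (cmod (f x))\<^sup>2)"
    by (rule Bochner_Integration.integrable_bound[OF assms(2)])
      (use assms in \<open>auto elim!: eventually_mono\<close>)
qed fact

lemma L2_zero: "L2 M (\<lambda>x. 0)"
  by (simp add: L2_def)

lemma L2_bounded_mult:
  assumes "L2 M f" "m \<in> borel_measurable M" "AE x in M. cmod (m x) \<le> B"
  shows "L2 M (\<lambda>x. m x * f x)"
proof (rule L2_dominated)
  show "integrable M (\<lambda>x. B\<^sup>2 * (cmod (f x))\<^sup>2)"
    using L2_integrable[OF assms(1)] by simp
  show "AE x in M. (cmod (m x * f x))\<^sup>2 \<le> B\<^sup>2 * (cmod (f x))\<^sup>2"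
    using assms(3) by eventually_elim (simp add: norm_mult power_mult_distrib mult_right_mono power_mono)
qed (use assms in measurable)

lemma L2_cmult: "L2 M f \<Longrightarrow> L2 M (\<lambda>x. c * f x)"
  by (rule L2_bounded_mult) auto

lemma L2_scaleR: "L2 M f \<Longrightarrow> L2 M (\<lambda>x. c *\<^sub>R f x)"
  unfolding scaleR_conv_of_real by (rule L2_cmult)

lemma L2_add: assumes "L2 M f" "L2 M g" shows "L2 M (\<lambda>x. f x + g x)"
proof (rule L2_dominated)
  show "integrable M (\<lambda>x. 2 * (cmod (f x))\<^sup>2 + 2 * (cmod (g x))\<^sup>2)"
    using assms[THEN L2_integrable] by simp
  have "(cmod (f x + g x))\<^sup>2 \<le> 2 * (cmod (f x))\<^sup>2 + 2 * (cmod (g x))\<^sup>2" for x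
  proof -
    have "(cmod (f x + g x))\<^sup>2 \<le> (cmod (f x) + cmod (g x))\<^sup>2"
      by (simp add: norm_triangle_ineq power_mono)
    then show ?thesis
      using two_mult_le_squares[of "cmod (f x)" "cmod (g x)"] by (simp add: power2_sum)
  qed
  then show "AE x in M. (cmod (f x + g x))\<^sup>2 \<le> 2 * (cmod (f x))\<^sup>2 + 2 * (cmod (g x))\<^sup>2"
    by simp
qed (use assms in measurable)

lemma L2_uminus: "L2 M f \<Longrightarrow> L2 M (\<lambda>x. - f x)"
  using L2_cmult[of M f "-1"] by simp

lemma L2_diff: "L2 M f \<Longrightarrow> L2 M g \<Longrightarrow> L2 M (\<lambda>x. f x - g x)"
  using L2_add[of M f "\<lambda>x. - g x"] L2_uminus[of M g] by simp

lemma L2_mult_integrable: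
  assumes "L2 M f" "L2 M g" shows "integrable M (\<lambda>x. f x * g x)"
proof (rule Bochner_Integration.integrable_bound)
  show "integrable M (\<lambda>x. (cmod (f x))\<^sup>2 + (cmod (g x))\<^sup>2)"
    using assms[THEN L2_integrable] by simp
  have "cmod (f x) * cmod (g x) \<le> (cmod (f x))\<^sup>2 + (cmod (g x))\<^sup>2" for x
    using two_mult_le_squares[of "cmod (f x)" "cmod (g x)"]
      mult_nonneg_nonneg[OF norm_ge_zero[of "f x"] norm_ge_zero[of "g x"]] by linarith
  then show "AE x in M. norm (f x * g x) \<le> norm ((cmod (f x))\<^sup>2 + (cmod (g x))\<^sup>2)"
    by (simp add: norm_mult)
qed (use assms in measurable)

lemma borel_measurable_cnj [measurable]:
  "f \<in> borel_measurable M \<Longrightarrow> (\<lambda>x. cnj (f x)) \<in> borel_measurable M"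
  by (rule borel_measurable_continuous_on[OF continuous_on_cnj[OF continuous_on_id]])

lemma L2_cnj: "L2 M f \<Longrightarrow> L2 M (\<lambda>x. cnj (f x))"
  unfolding L2_def by (auto intro: borel_measurable_cnj)

lemma inner_complex_Re: "x \<bullet> y = Re (x * cnj y)" for x y :: complex
  by (simp add: inner_complex_def)

lemma L2_inner_integrable:
  assumes "L2 M f" "L2 M g" shows "integrable M (\<lambda>x. f x \<bullet> g x)"
  unfolding inner_complex_Re
  by (intro integrable_Re L2_mult_integrable assms L2_cnj)

\<comment> \<open>A partial quotient, because only square integrable functions represent a class.
  The measure lives on the whole space since a type cannot depend on \<Omega>; functions on \<Omega>
  enter through extension by zero in \<open>cls_on\<close>.\<close>
quotient_type (overloaded) 'n l2 = "'n::euclidean_space \<Rightarrow> complex" /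
  partial: "\<lambda>f g. L2 lebesgue f \<and> L2 lebesgue g \<and> (AE x in lebesgue. f x = g x)"
proof (rule part_equivpI)
  show "\<exists>f::'n \<Rightarrow> complex. L2 lebesgue f \<and> L2 lebesgue f \<and> (AE x in lebesgue. f x = f x)"
    using L2_zero by auto
  show "symp (\<lambda>f g::'n \<Rightarrow> complex. L2 lebesgue f \<and> L2 lebesgue g \<and> (AE x in lebesgue. f x = g x))"
    by (rule sympI) (auto elim: eventually_mono)
  show "transp (\<lambda>f g::'n \<Rightarrow> complex. L2 lebesgue f \<and> L2 lebesgue g \<and> (AE x in lebesgue. f x = g x))"
    by (rule transpI) auto
qed

definition cls :: "('n::euclidean_space \<Rightarrow> complex) \<Rightarrow> 'n l2" where
  "cls f = abs_l2 f"

text \<open>A fixed representative lets coefficients, weights and weak derivatives act on a class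
  pointwise. Its algebraic laws hold only almost everywhere.\<close>

definition rep :: "'n::euclidean_space l2 \<Rightarrow> 'n \<Rightarrow> complex" where
  "rep \<xi> = (SOME f. L2 lebesgue f \<and> cls f = \<xi>)"

lemma cls_eq_iff: "L2 lebesgue f \<Longrightarrow> L2 lebesgue g \<Longrightarrow> cls f = cls g \<longleftrightarrow> (AE x in lebesgue. f x = g x)"
  unfolding cls_def using Quotient_rel[OF Quotient_l2, of f g] by simp

lemma L2_rep [simp, intro]: "L2 lebesgue (rep \<xi>)" and cls_rep [simp]: "cls (rep \<xi>) = \<xi>"
proof -
  have "\<exists>f. L2 lebesgue f \<and> cls f = \<xi>"
    unfolding cls_def by (induction \<xi> rule: l2.abs_induct) auto
  then have "L2 lebesgue (rep \<xi>) \<and> cls (rep \<xi>) = \<xi>"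
    unfolding rep_def by (rule someI_ex)
  then show "L2 lebesgue (rep \<xi>)" "cls (rep \<xi>) = \<xi>" by auto
qed

lemma rep_measurable [measurable]: "rep \<xi> \<in> borel_measurable lebesgue"
  using L2_rep L2_measurable by blast

lemma rep_cls: "L2 lebesgue f \<Longrightarrow> AE x in lebesgue. rep (cls f) x = f x"
  using cls_eq_iff[of "rep (cls f)" f] by simp

lemma l2_eqI: "(AE x in lebesgue. rep \<xi> x = rep \<zeta> x) \<Longrightarrow> \<xi> = \<zeta>"
  using cls_eq_iff[of "rep \<xi>" "rep \<zeta>"] by simp

text \<open>Only the real structure is kept: the inner product of complex numbers is
  \<open>Re (x * cnj y)\<close>, so the product here is the real part of the complex L2 product.
  Energies and their time derivatives involve such real parts only.\<close>

instantiation l2 :: (euclidean_space) real_inner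
begin

definition zero_l2 :: "'a l2" where "zero_l2 = cls (\<lambda>x. 0)"
definition plus_l2 :: "'a l2 \<Rightarrow> 'a l2 \<Rightarrow> 'a l2" where
  "plus_l2 \<xi> \<zeta> = cls (\<lambda>x. rep \<xi> x + rep \<zeta> x)"
definition uminus_l2 :: "'a l2 \<Rightarrow> 'a l2" where
  "uminus_l2 \<xi> = cls (\<lambda>x. - rep \<xi> x)"
definition minus_l2 :: "'a l2 \<Rightarrow> 'a l2 \<Rightarrow> 'a l2" where
  "minus_l2 \<xi> \<zeta> = cls (\<lambda>x. rep \<xi> x - rep \<zeta> x)"
definition scaleR_l2 :: "real \<Rightarrow> 'a l2 \<Rightarrow> 'a l2" where
  "scaleR_l2 c \<xi> = cls (\<lambda>x. c *\<^sub>R rep \<xi> x)"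
definition inner_l2 :: "'a l2 \<Rightarrow> 'a l2 \<Rightarrow> real" where
  "inner_l2 \<xi> \<zeta> = (\<integral>x. rep \<xi> x \<bullet> rep \<zeta> x \<partial>lebesgue)"
definition norm_l2 :: "'a l2 \<Rightarrow> real" where "norm_l2 \<xi> = sqrt (\<xi> \<bullet> \<xi>)"
definition sgn_l2 :: "'a l2 \<Rightarrow> 'a l2" where "sgn_l2 \<xi> = scaleR (inverse (norm \<xi>)) \<xi>"
definition dist_l2 :: "'a l2 \<Rightarrow> 'a l2 \<Rightarrow> real" where "dist_l2 \<xi> \<zeta> = norm (\<xi> - \<zeta>)"
definition uniformity_l2 :: "('a l2 \<times> 'a l2) filter" where
  "uniformity_l2 = (INF e\<in>{0<..}. principal {(x, y). dist x y < e})"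
definition open_l2 :: "'a l2 set \<Rightarrow> bool" where
  "open_l2 U = (\<forall>x\<in>U. \<forall>\<^sub>F (x', y) in uniformity. x' = x \<longrightarrow> y \<in> U)"

lemma rep_zero: "AE x in lebesgue. rep (0::'a l2) x = 0"
  unfolding zero_l2_def by (rule rep_cls[OF L2_zero])
lemma rep_plus: "AE x in lebesgue. rep (\<xi> + \<zeta> :: 'a l2) x = rep \<xi> x + rep \<zeta> x"
  unfolding plus_l2_def by (intro rep_cls L2_add L2_rep)
lemma rep_uminus: "AE x in lebesgue. rep (- \<xi> :: 'a l2) x = - rep \<xi> x"
  unfolding uminus_l2_def by (intro rep_cls L2_uminus L2_rep)
lemma rep_minus: "AE x in lebesgue. rep (\<xi> - \<zeta> :: 'a l2) x = rep \<xi> x - rep \<zeta> x"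
  unfolding minus_l2_def by (intro rep_cls L2_diff L2_rep)
lemma rep_scaleR: "AE x in lebesgue. rep (c *\<^sub>R \<xi> :: 'a l2) x = c *\<^sub>R rep \<xi> x"
  unfolding scaleR_l2_def by (intro rep_cls L2_scaleR L2_rep)

instance
proof
  fix a b c :: "'a l2" and r s :: real
  show "a + b + c = a + (b + c)"
    by (rule l2_eqI) (use rep_plus[of "a + b" c] rep_plus[of a b] rep_plus[of a "b + c"] rep_plus[of b c] in \<open>eventually_elim, simp\<close>)
  show "a + b = b + a" by (simp add: plus_l2_def add.commute)
  show "0 + a = a"
    by (rule l2_eqI) (use rep_plus[of 0 a] rep_zero in \<open>eventually_elim, simp\<close>)
  show "- a + a = 0"
    by (rule l2_eqI) (use rep_plus[of "-a" a] rep_zero rep_uminus[of a] in \<open>eventually_elim, simp\<close>)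
  show "a - b = a + - b"
    by (rule l2_eqI) (use rep_plus[of a "-b"] rep_minus[of a b] rep_uminus[of b] in \<open>eventually_elim, simp\<close>)
  show "r *\<^sub>R (a + b) = r *\<^sub>R a + r *\<^sub>R b"
    by (rule l2_eqI) (use rep_plus[of a b] rep_scaleR[of r "a + b"] rep_scaleR[of r a] rep_scaleR[of r b]
      rep_plus[of "r *\<^sub>R a" "r *\<^sub>R b"] in \<open>eventually_elim, simp add: scaleR_right_distrib\<close>)
  show "(r + s) *\<^sub>R a = r *\<^sub>R a + s *\<^sub>R a"
    by (rule l2_eqI) (use rep_scaleR[of r a] rep_scaleR[of s a] rep_scaleR[of "r + s" a]
      rep_plus[of "r *\<^sub>R a" "s *\<^sub>R a"] in \<open>eventually_elim, simp add: scaleR_left_distrib\<close>)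
  show "r *\<^sub>R s *\<^sub>R a = (r * s) *\<^sub>R a"
    by (rule l2_eqI) (use rep_scaleR[of r "s *\<^sub>R a"] rep_scaleR[of s a] rep_scaleR[of "r * s" a] in \<open>eventually_elim, simp\<close>)
  show "1 *\<^sub>R a = a"
    by (rule l2_eqI) (use rep_scaleR[of 1 a] in \<open>eventually_elim, simp\<close>)
  show "dist a b = norm (a - b)" by (rule dist_l2_def)
  show "sgn a = scaleR (inverse (norm a)) a" by (rule sgn_l2_def)
  show "uniformity = (INF e\<in>{0<..}. principal {(x, y). dist (x::'a l2) y < e})" by (rule uniformity_l2_def)
  show "open U = (\<forall>x\<in>U. \<forall>\<^sub>F (x', y) in uniformity. x' = x \<longrightarrow> y \<in> U)" for U :: "'a l2 set" by (rule open_l2_def)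
  show "a \<bullet> b = b \<bullet> a" by (simp add: inner_l2_def inner_commute)
  have "(\<integral>x. rep (a + b) x \<bullet> rep c x \<partial>lebesgue) = (\<integral>x. rep a x \<bullet> rep c x + rep b x \<bullet> rep c x \<partial>lebesgue)"
    by (rule integral_cong_AE) (use rep_plus[of a b] in \<open>auto elim!: eventually_mono simp: inner_add_left\<close>)
  also have "\<dots> = (\<integral>x. rep a x \<bullet> rep c x \<partial>lebesgue) + (\<integral>x. rep b x \<bullet> rep c x \<partial>lebesgue)"
    by (intro Bochner_Integration.integral_add L2_inner_integrable L2_rep)
  finally show "(a + b) \<bullet> c = a \<bullet> c + b \<bullet> c"
    by (simp only: inner_l2_def)
  have "(\<integral>x. rep (r *\<^sub>R a) x \<bullet> rep b x \<partial>lebesgue) = (\<integral>x. r * (rep a x \<bullet> rep b x) \<partial>lebesgue)"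
    by (rule integral_cong_AE) (use rep_scaleR[of r a] in \<open>auto elim!: eventually_mono\<close>)
  then show "(r *\<^sub>R a) \<bullet> b = r * (a \<bullet> b)"
    by (simp only: inner_l2_def integral_mult_right_zero)
  show "0 \<le> a \<bullet> a" by (simp add: inner_l2_def)
  show "a \<bullet> a = 0 \<longleftrightarrow> a = 0"
  proof
    assume "a \<bullet> a = 0"
    then have "AE x in lebesgue. rep a x \<bullet> rep a x = 0"
      unfolding inner_l2_def
      by (subst (asm) integral_nonneg_eq_0_iff_AE) (auto intro: L2_inner_integrable)
    then have "AE x in lebesgue. rep a x = rep 0 x"
      using rep_zero by eventually_elim simp
    then show "a = 0" by (rule l2_eqI)
  next
    assume "a = 0"
    then have "AE x in lebesgue. rep a x \<bullet> rep a x = 0"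
      using rep_zero by (auto elim!: eventually_mono)
    then show "a \<bullet> a = 0" unfolding inner_l2_def by (rule integral_eq_zero_AE)
  qed
  show "norm a = sqrt (a \<bullet> a)" by (rule norm_l2_def)
qed

end

lemma norm_l2_power2: "(norm \<xi>)\<^sup>2 = (\<integral>x. (cmod (rep \<xi> x))\<^sup>2 \<partial>lebesgue)" for \<xi> :: "'n::euclidean_space l2"
  unfolding power2_norm_eq_inner inner_l2_def by simp

lemma norm_cls: "L2 lebesgue f \<Longrightarrow> (norm (cls f))\<^sup>2 = (\<integral>x. (cmod (f x))\<^sup>2 \<partial>lebesgue)"
  unfolding norm_l2_power2
  by (rule integral_cong_AE) (use rep_cls[of f] L2_measurable[of _ f] in \<open>auto elim!: eventually_mono\<close>)

section \<open>Completeness of L2 (Riesz-Fischer)\<close>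

lemma nn_integral_norm_l2: "(\<integral>\<^sup>+x. ennreal ((cmod (rep \<xi> x))\<^sup>2) \<partial>lebesgue) = ennreal ((norm \<xi>)\<^sup>2)"
  for \<xi> :: "'n::euclidean_space l2"
  unfolding norm_l2_power2 by (rule nn_integral_eq_integral) (auto intro: L2_integrable)

lemma nn_integral_norm_l2_diff:
  "(\<integral>\<^sup>+x. ennreal ((cmod (rep \<xi> x - rep \<zeta> x))\<^sup>2) \<partial>lebesgue) = ennreal ((norm (\<xi> - \<zeta>))\<^sup>2)"
  for \<xi> \<zeta> :: "'n::euclidean_space l2"
  unfolding nn_integral_norm_l2[symmetric]
  by (rule nn_integral_cong_AE) (use rep_minus[of \<xi> \<zeta>] in \<open>auto elim!: eventually_mono\<close>)

text \<open>The factor \<open>4 ^ n\<close> in \<open>d\<close> is a compromise: the integrals of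
  \<open>d n\<close> are still bounded by the summable \<open>(1/4) ^ n\<close>, and wherever the
  sum of the \<open>d n\<close> is finite the increments are of order \<open>(1/2) ^ n\<close>,
  hence summable.\<close>

lemma fast_Cauchy_l2_AE_convergent:
  fixes X :: "nat \<Rightarrow> 'n::euclidean_space l2"
  assumes "\<And>n. norm (X (Suc n) - X n) \<le> (1/4) ^ n"
  shows "AE y in lebesgue. convergent (\<lambda>n. rep (X n) y)"
proof -
  define d where "d n y = 4 ^ n * (cmod (rep (X (Suc n)) y - rep (X n) y))\<^sup>2" for n y
  have "(\<integral>\<^sup>+y. (\<Sum>n. ennreal (d n y)) \<partial>lebesgue) = (\<Sum>n. \<integral>\<^sup>+y. ennreal (d n y) \<partial>lebesgue)"
    unfolding d_def by (intro nn_integral_suminf) measurable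
  also have "\<dots> \<le> (\<Sum>n. ennreal ((1/4) ^ n))"
  proof (intro suminf_le summableI)
    fix n
    have "(\<integral>\<^sup>+y. ennreal (d n y) \<partial>lebesgue) = ennreal (4 ^ n) * ennreal ((norm (X (Suc n) - X n))\<^sup>2)"
      unfolding d_def nn_integral_norm_l2_diff[symmetric]
      by (subst nn_integral_cmult[symmetric]) (auto simp: ennreal_mult)
    also have "\<dots> = ennreal (4 ^ n * (norm (X (Suc n) - X n))\<^sup>2)"
      by (simp add: ennreal_mult)
    also have "\<dots> \<le> ennreal (4 ^ n * ((1/4) ^ n)\<^sup>2)"
      by (intro ennreal_leI mult_left_mono power_mono assms) auto
    also have "4 ^ n * ((1/4) ^ n)\<^sup>2 = ((1/4)::real) ^ n"
      by (simp add: power2_eq_square power_one_over)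
    finally show "(\<integral>\<^sup>+y. ennreal (d n y) \<partial>lebesgue) \<le> ennreal ((1/4) ^ n)" .
  qed
  also have "\<dots> = ennreal (\<Sum>n. (1/4) ^ n)"
    by (intro suminf_ennreal2) (auto intro: summable_geometric)
  also have "\<dots> < \<infinity>" by simp
  finally have "AE y in lebesgue. (\<Sum>n. ennreal (d n y)) \<noteq> \<infinity>"
    by (intro nn_integral_noteq_infinite) (auto simp: d_def)
  then show ?thesis
  proof eventually_elim
    fix y assume fin: "(\<Sum>n. ennreal (d n y)) \<noteq> \<infinity>"
    then obtain S where S: "(\<Sum>n. ennreal (d n y)) = ennreal S" "S \<ge> 0"
      by (cases "\<Sum>n. ennreal (d n y)") auto
    have "ennreal (d n y) \<le> ennreal S" for n
      using sum_le_suminf[OF summableI, of "{n}" "\<lambda>n. ennreal (d n y)"] S by simp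
    then have dS: "d n y \<le> S" for n using S(2) by (simp add: ennreal_le_iff)
    have le: "norm (rep (X (Suc n)) y - rep (X n) y) \<le> sqrt S * (1/2) ^ n" for n
    proof -
      have "(2 ^ n * cmod (rep (X (Suc n)) y - rep (X n) y))\<^sup>2 \<le> S"
        using dS[of n] by (simp add: d_def power_mult_distrib power_mult[symmetric] mult.commute[of n] power_mult)
      then have "2 ^ n * cmod (rep (X (Suc n)) y - rep (X n) y) \<le> sqrt S"
        by (rule real_le_rsqrt)
      then show ?thesis by (simp add: power_one_over field_simps)
    qed
    have "summable (\<lambda>n. sqrt S * (1/2) ^ n)"
      by (intro summable_mult summable_geometric) simp
    then have "summable (\<lambda>n. rep (X (Suc n)) y - rep (X n) y)"
      by (rule summable_comparison_test') (rule le)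
    then have "convergent (\<lambda>n. \<Sum>k<n. rep (X (Suc k)) y - rep (X k) y)"
      by (simp add: summable_iff_convergent)
    then have "convergent (\<lambda>n. rep (X n) y - rep (X 0) y)"
      by (simp only: sum_lessThan_telescope[of "\<lambda>k. rep (X k) y"])
    then have "convergent (\<lambda>n. (rep (X n) y - rep (X 0) y) + rep (X 0) y)"
      by (rule convergent_add[OF _ convergent_const])
    then show "convergent (\<lambda>n. rep (X n) y)" by simp
  qed
qed

text \<open>Fatou's lemma in \<open>m\<close> turns a bound on \<open>norm (X m - X n)\<close> for
  all large \<open>m\<close> into the same bound for the distance of \<open>X n\<close> to the
  pointwise limit. This yields first that the limit is square integrable and then convergence in
  norm.\<close>

lemma fast_Cauchy_l2_convergent:
  fixes X :: "nat \<Rightarrow> 'n::euclidean_space l2"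
  assumes fast: "\<And>n. norm (X (Suc n) - X n) \<le> (1/4) ^ n" and "Cauchy X"
  shows "convergent X"
proof -
  define f where "f y = lim (\<lambda>n. rep (X n) y)" for y
  have [measurable]: "f \<in> borel_measurable lebesgue" unfolding f_def by measurable
  have conv: "AE y in lebesgue. (\<lambda>n. rep (X n) y) \<longlonglongrightarrow> f y"
    using fast_Cauchy_l2_AE_convergent[OF fast] unfolding f_def
    by eventually_elim (rule convergent_LIMSEQ_iff[THEN iffD1])
  have bound: "(\<integral>\<^sup>+y. ennreal ((cmod (f y - rep (X n) y))\<^sup>2) \<partial>lebesgue) \<le> ennreal (e\<^sup>2)"
    if e: "\<And>m. m \<ge> N \<Longrightarrow> norm (X m - X n) \<le> e" for N n e
  proof -
    have "(\<integral>\<^sup>+y. ennreal ((cmod (f y - rep (X n) y))\<^sup>2) \<partial>lebesgue)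
        = (\<integral>\<^sup>+y. liminf (\<lambda>m. ennreal ((cmod (rep (X m) y - rep (X n) y))\<^sup>2)) \<partial>lebesgue)"
    proof (rule nn_integral_cong_AE, use conv in eventually_elim)
      fix y assume "(\<lambda>n. rep (X n) y) \<longlonglongrightarrow> f y"
      then have "(\<lambda>m. ennreal ((cmod (rep (X m) y - rep (X n) y))\<^sup>2)) \<longlonglongrightarrow> ennreal ((cmod (f y - rep (X n) y))\<^sup>2)"
        by (intro tendsto_intros)
      then show "ennreal ((cmod (f y - rep (X n) y))\<^sup>2) = liminf (\<lambda>m. ennreal ((cmod (rep (X m) y - rep (X n) y))\<^sup>2))"
        by (rule lim_imp_Liminf[OF sequentially_bot, symmetric])
    qed
    also have "\<dots> \<le> liminf (\<lambda>m. \<integral>\<^sup>+y. ennreal ((cmod (rep (X m) y - rep (X n) y))\<^sup>2) \<partial>lebesgue)"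
      by (rule nn_integral_liminf) measurable
    also have "\<dots> = liminf (\<lambda>m. ennreal ((norm (X m - X n))\<^sup>2))"
      unfolding nn_integral_norm_l2_diff ..
    also have "\<dots> \<le> liminf (\<lambda>m. ennreal (e\<^sup>2))"
      by (rule Liminf_mono, rule eventually_sequentiallyI[of N]) (auto intro!: ennreal_leI power_mono e)
    also have "\<dots> = ennreal (e\<^sup>2)" by (simp add: Liminf_const)
    finally show ?thesis .
  qed
  have L2f: "L2 lebesgue (\<lambda>y. f y - rep (X n) y)" for n
  proof -
    obtain N where "\<And>m n. m \<ge> N \<Longrightarrow> n \<ge> N \<Longrightarrow> norm (X m - X n) < 1"
      using CauchyD[OF \<open>Cauchy X\<close> zero_less_one] by blast
    then have "norm (X m - X N) < 1" if "m \<ge> N" for m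
      using that by simp
    then have "norm (X m - X n) \<le> 1 + norm (X N - X n)" if "m \<ge> N" for m
      using norm_triangle_ineq[of "X m - X N" "X N - X n"] that by fastforce
    from bound[OF this] have "(\<integral>\<^sup>+y. ennreal ((cmod (f y - rep (X n) y))\<^sup>2) \<partial>lebesgue) < \<infinity>"
      by (rule le_less_trans) auto
    then show ?thesis
      unfolding L2_def by (auto intro!: integrableI_bounded)
  qed
  have "L2 lebesgue (\<lambda>y. (f y - rep (X 0) y) + rep (X 0) y)"
    by (intro L2_add L2f L2_rep)
  then have f: "L2 lebesgue f" by simp
  have "X \<longlonglongrightarrow> cls f"
  proof (rule LIMSEQ_I)
    fix r :: real assume "r > 0"
    then obtain N where N: "\<And>m n. m \<ge> N \<Longrightarrow> n \<ge> N \<Longrightarrow> norm (X m - X n) < r / 2"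
      using CauchyD[OF \<open>Cauchy X\<close>, of "r / 2"] by auto
    have "norm (X n - cls f) < r" if "n \<ge> N" for n
    proof -
      have "(\<integral>\<^sup>+y. ennreal ((cmod (f y - rep (X n) y))\<^sup>2) \<partial>lebesgue) \<le> ennreal ((r / 2)\<^sup>2)"
        by (rule bound[of N]) (use N that in \<open>auto intro: less_imp_le\<close>)
      also have "(\<integral>\<^sup>+y. ennreal ((cmod (f y - rep (X n) y))\<^sup>2) \<partial>lebesgue) = ennreal ((norm (cls f - X n))\<^sup>2)"
        unfolding nn_integral_norm_l2_diff[symmetric]
        by (rule nn_integral_cong_AE) (use rep_cls[OF f] in \<open>auto elim!: eventually_mono\<close>)
      finally have "(norm (cls f - X n))\<^sup>2 \<le> (r / 2)\<^sup>2"
        by (simp add: ennreal_le_iff)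
      then have "norm (cls f - X n) \<le> r / 2"
        using \<open>r > 0\<close> by (simp add: power2_le_iff_abs_le)
      then show ?thesis using \<open>r > 0\<close> by (simp add: norm_minus_commute)
    qed
    then show "\<exists>N. \<forall>n\<ge>N. norm (X n - cls f) < r" by blast
  qed
  then show ?thesis by (rule convergentI)
qed

instance l2 :: (euclidean_space) complete_space
proof
  fix X :: "nat \<Rightarrow> 'a l2" assume X: "Cauchy X"
  have "\<exists>N. \<forall>m\<ge>N. \<forall>n\<ge>N. norm (X m - X n) < (1/4) ^ k" for k :: nat
    using CauchyD[OF X, of "(1/4) ^ k"] by simp
  then obtain N where N: "\<And>k m n. m \<ge> N k \<Longrightarrow> n \<ge> N k \<Longrightarrow> norm (X m - X n) < (1/4) ^ k"
    by metis
  \<comment> \<open>Each index exceeds its predecessor and the threshold \<open>N (Suc k)\<close>: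
    the first makes the subsequence strictly increasing, the second makes it fast enough for the
    preceding lemma.\<close>
  define r where "r = rec_nat (N 0) (\<lambda>k p. max (Suc p) (N (Suc k)))"
  have r_Suc: "r (Suc k) = max (Suc (r k)) (N (Suc k))" for k by (simp add: r_def)
  have rN: "r k \<ge> N k" for k by (cases k) (auto simp: r_def)
  have "strict_mono r" unfolding strict_mono_Suc_iff r_Suc by (auto simp: less_max_iff_disj)
  have fast: "norm ((X \<circ> r) (Suc k) - (X \<circ> r) k) \<le> (1/4) ^ k" for k
  proof -
    have "r (Suc k) \<ge> N k" using rN[of k] by (simp add: r_Suc)
    then show ?thesis using N[of k "r (Suc k)" "r k"] rN[of k] by simp
  qed
  have "convergent (X \<circ> r)"
    using fast_Cauchy_l2_convergent[OF fast] Cauchy_subseq_Cauchy[OF X \<open>strict_mono r\<close>] by blast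
  then obtain l where "(X \<circ> r) \<longlonglongrightarrow> l" by (auto simp: convergent_def)
  then have "X \<longlonglongrightarrow> l" by (rule Cauchy_converges_subseq[OF X \<open>strict_mono r\<close>])
  then show "convergent X" by (rule convergentI)
qed

instance l2 :: (euclidean_space) banach ..

section \<open>Functions on \<Omega> inside the Hilbert space\<close>

lemma sq_int_L2: "sq_int \<Omega> f \<longleftrightarrow> L2 (lebesgue_on \<Omega>) f"
  by (simp add: sq_int_def L2_def)

definition cls_on :: "'n::euclidean_space set \<Rightarrow> ('n \<Rightarrow> complex) \<Rightarrow> 'n l2" where
  "cls_on \<Omega> f = cls (\<lambda>x. if x \<in> \<Omega> then f x else 0)"

definition pair :: "'n::euclidean_space set \<Rightarrow> ('n \<Rightarrow> complex) \<Rightarrow> 'n l2 \<Rightarrow> 'n l2 \<Rightarrow> real" where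
  "pair \<Omega> m \<xi> \<zeta> = (\<integral>x. (m x * rep \<xi> x) \<bullet> rep \<zeta> x \<partial>lebesgue_on \<Omega>)"

context
  fixes \<Omega> :: "'n::euclidean_space set"
  assumes \<Omega> [measurable]: "\<Omega> \<in> sets lebesgue"
begin

lemma AE_lebesgue_on: "AE x in lebesgue. P x \<Longrightarrow> AE x in lebesgue_on \<Omega>. P x"
  using \<Omega> by (auto simp: AE_restrict_space_iff elim: eventually_mono)

lemma L2_lebesgue_on_iff: "L2 (lebesgue_on \<Omega>) f \<longleftrightarrow> L2 lebesgue (\<lambda>x. if x \<in> \<Omega> then f x else 0)"
proof -
  have "(\<lambda>x. (cmod (indicator \<Omega> x *\<^sub>R f x))\<^sup>2) = (\<lambda>x. indicator \<Omega> x *\<^sub>R (cmod (f x))\<^sup>2)"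
    "(\<lambda>x. if x \<in> \<Omega> then f x else 0) = (\<lambda>x. indicator \<Omega> x *\<^sub>R f x)"
    by (auto simp: indicator_def)
  moreover have "\<Omega> \<inter> space lebesgue \<in> sets lebesgue" using \<Omega> by simp
  ultimately show ?thesis
    by (simp only: L2_def integrable_restrict_space borel_measurable_restrict_space_iff)
qed

lemma L2_restrict: "L2 lebesgue f \<Longrightarrow> L2 (lebesgue_on \<Omega>) f"
  unfolding L2_lebesgue_on_iff
  by (rule L2_dominated[OF _ L2_integrable[of lebesgue f]]) (auto intro: measurable_If_set L2_measurable)

lemma L2_lebesgue_on_rep [simp, intro]: "L2 (lebesgue_on \<Omega>) (rep \<xi>)"
  by (rule L2_restrict[OF L2_rep])

lemma rep_cls_on:
  assumes "L2 (lebesgue_on \<Omega>) f"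
  shows "AE x in lebesgue_on \<Omega>. rep (cls_on \<Omega> f) x = f x"
proof -
  have "AE x in lebesgue. x \<in> \<Omega> \<longrightarrow> rep (cls_on \<Omega> f) x = f x"
    using rep_cls[OF assms[unfolded L2_lebesgue_on_iff]] unfolding cls_on_def
    by (rule eventually_mono) simp
  then show ?thesis using \<Omega> by (simp add: AE_restrict_space_iff)
qed

lemma integral_lebesgue_on_if:
  fixes F :: "'n \<Rightarrow> complex \<Rightarrow> 'b::{banach,second_countable_topology}"
  assumes "\<And>x. F x 0 = 0"
  shows "(\<integral>x. F x (if x \<in> \<Omega> then f x else 0) \<partial>lebesgue) = (\<integral>x. F x (f x) \<partial>lebesgue_on \<Omega>)"
  using \<Omega> by (subst integral_restrict_space) (auto simp: indicator_def assms intro!: Bochner_Integration.integral_cong)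

lemma norm_cls_on:
  assumes "L2 (lebesgue_on \<Omega>) f"
  shows "norm (cls_on \<Omega> f) = l2norm \<Omega> f"
proof -
  have "(norm (cls_on \<Omega> f))\<^sup>2 = (\<integral>x. (cmod (f x))\<^sup>2 \<partial>lebesgue_on \<Omega>)"
    using norm_cls[OF assms[unfolded L2_lebesgue_on_iff]] integral_lebesgue_on_if[of "\<lambda>x z. (cmod z)\<^sup>2" f]
    by (simp add: cls_on_def)
  then show ?thesis
    unfolding l2norm_def by (metis norm_ge_zero real_sqrt_unique)
qed

lemma inner_cls_on:
  assumes "L2 (lebesgue_on \<Omega>) f"
  shows "cls_on \<Omega> f \<bullet> \<xi> = (\<integral>x. f x \<bullet> rep \<xi> x \<partial>lebesgue_on \<Omega>)"
proof -
  have "cls_on \<Omega> f \<bullet> \<xi> = (\<integral>x. (if x \<in> \<Omega> then f x else 0) \<bullet> rep \<xi> x \<partial>lebesgue)"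
    unfolding inner_l2_def
  proof (rule integral_cong_AE)
    show "AE x in lebesgue. rep (cls_on \<Omega> f) x \<bullet> rep \<xi> x = (if x \<in> \<Omega> then f x else 0) \<bullet> rep \<xi> x"
      using rep_cls[OF assms[unfolded L2_lebesgue_on_iff]] unfolding cls_on_def
      by (rule eventually_mono) simp
    show "(\<lambda>x. (if x \<in> \<Omega> then f x else 0) \<bullet> rep \<xi> x) \<in> borel_measurable lebesgue"
      using assms[unfolded L2_lebesgue_on_iff, THEN L2_measurable] by measurable
  qed measurable
  also have "\<dots> = (\<integral>x. f x \<bullet> rep \<xi> x \<partial>lebesgue_on \<Omega>)"
    by (rule integral_lebesgue_on_if) simp
  finally show ?thesis .
qed

lemma cls_on_cong:
  assumes "AE x in lebesgue_on \<Omega>. f x = g x" "L2 (lebesgue_on \<Omega>) f" "L2 (lebesgue_on \<Omega>) g"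
  shows "cls_on \<Omega> f = cls_on \<Omega> g"
proof -
  have "AE x in lebesgue. (if x \<in> \<Omega> then f x else 0) = (if x \<in> \<Omega> then g x else 0)"
    using assms(1) \<Omega> by (auto simp: AE_restrict_space_iff elim: eventually_mono)
  then show ?thesis
    unfolding cls_on_def using assms(2,3) by (simp add: cls_eq_iff L2_lebesgue_on_iff)
qed

lemma l2norm_rep_le: "l2norm \<Omega> (rep \<xi>) \<le> norm \<xi>"
proof -
  have "(\<integral>x. (cmod (rep \<xi> x))\<^sup>2 \<partial>lebesgue_on \<Omega>) = (\<integral>x. indicator \<Omega> x * (cmod (rep \<xi> x))\<^sup>2 \<partial>lebesgue)"
    using \<Omega> by (simp add: integral_restrict_space)
  also have "\<dots> \<le> (\<integral>x. (cmod (rep \<xi> x))\<^sup>2 \<partial>lebesgue)"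
  proof (rule integral_mono)
    show "integrable lebesgue (\<lambda>x. indicator \<Omega> x * (cmod (rep \<xi> x))\<^sup>2)"
      using L2_integrable[OF L2_lebesgue_on_rep, of \<xi>] \<Omega> by (simp add: integrable_restrict_space)
  qed (auto simp: indicator_def intro: L2_integrable)
  finally show ?thesis
    unfolding norm_l2_power2[symmetric] l2norm_def by (simp add: real_le_lsqrt)
qed

lemma cls_on_lincomb:
  assumes f: "L2 (lebesgue_on \<Omega>) f" and g: "L2 (lebesgue_on \<Omega>) g"
  shows "cls_on \<Omega> (\<lambda>x. c *\<^sub>R f x + g x) = c *\<^sub>R cls_on \<Omega> f + cls_on \<Omega> g"
proof (rule l2_eqI)
  have fg: "L2 (lebesgue_on \<Omega>) (\<lambda>x. c *\<^sub>R f x + g x)" by (intro L2_add L2_scaleR f g)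
  note L = f[unfolded L2_lebesgue_on_iff] g[unfolded L2_lebesgue_on_iff] fg[unfolded L2_lebesgue_on_iff]
  show "AE x in lebesgue. rep (cls_on \<Omega> (\<lambda>x. c *\<^sub>R f x + g x)) x = rep (c *\<^sub>R cls_on \<Omega> f + cls_on \<Omega> g) x"
    using rep_cls[OF L(1)] rep_cls[OF L(2)] rep_cls[OF L(3)] rep_plus[of "c *\<^sub>R cls_on \<Omega> f" "cls_on \<Omega> g"]
      rep_scaleR[of c "cls_on \<Omega> f"]
    unfolding cls_on_def by eventually_elim (simp split: if_splits)
qed

lemma Linfty_mult_L2:
  assumes "Linfty \<Omega> m" "L2 (lebesgue_on \<Omega>) f"
  shows "L2 (lebesgue_on \<Omega>) (\<lambda>x. m x * f x)"
  using assms L2_bounded_mult unfolding Linfty_def by blast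

lemma pair_integrable:
  assumes "Linfty \<Omega> m"
  shows "integrable (lebesgue_on \<Omega>) (\<lambda>x. (m x * rep \<xi> x) \<bullet> rep \<zeta> x)"
  by (intro L2_inner_integrable Linfty_mult_L2 assms L2_lebesgue_on_rep)

text \<open>The form is the inner product composed with a bounded operator, multiplication by
  \<open>m\<close> followed by extension by zero. Every term of the energy is such a form, so this
  is what permits differentiating energies in time and passing to limits in them.\<close>

lemma bounded_bilinear_pair:
  assumes m: "Linfty \<Omega> m"
  shows "bounded_bilinear (pair \<Omega> m)"
proof -
  have mL: "L2 (lebesgue_on \<Omega>) (\<lambda>x. m x * rep \<xi> x)" for \<xi>
    by (intro Linfty_mult_L2 m L2_lebesgue_on_rep)
  obtain B where B: "AE x in lebesgue_on \<Omega>. cmod (m x) \<le> B" using m by (auto simp: Linfty_def)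
  have "bounded_linear (\<lambda>\<xi>. cls_on \<Omega> (\<lambda>x. m x * rep \<xi> x))"
  proof (rule bounded_linear_intro)
    have lin: "cls_on \<Omega> (\<lambda>x. m x * rep (c *\<^sub>R \<xi> + \<zeta>) x)
        = c *\<^sub>R cls_on \<Omega> (\<lambda>x. m x * rep \<xi> x) + cls_on \<Omega> (\<lambda>x. m x * rep \<zeta> x)" for c \<xi> \<zeta>
    proof -
      have "AE x in lebesgue. m x * rep (c *\<^sub>R \<xi> + \<zeta>) x = c *\<^sub>R (m x * rep \<xi> x) + m x * rep \<zeta> x"
        using rep_plus[of "c *\<^sub>R \<xi>" \<zeta>] rep_scaleR[of c \<xi>]
        by eventually_elim (simp add: algebra_simps)
      from AE_lebesgue_on[OF this] show ?thesis
        by (subst cls_on_lincomb[symmetric, OF mL mL])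
          (intro cls_on_cong mL L2_add L2_scaleR)
    qed
    show "cls_on \<Omega> (\<lambda>x. m x * rep (\<xi> + \<zeta>) x)
        = cls_on \<Omega> (\<lambda>x. m x * rep \<xi> x) + cls_on \<Omega> (\<lambda>x. m x * rep \<zeta> x)" for \<xi> \<zeta>
      using lin[of 1 \<xi> \<zeta>] by simp
    have "cls_on \<Omega> (\<lambda>x. m x * rep 0 x) = 0"
      using lin[of "-1" 0 0] by simp
    then show "cls_on \<Omega> (\<lambda>x. m x * rep (r *\<^sub>R \<xi>) x) = r *\<^sub>R cls_on \<Omega> (\<lambda>x. m x * rep \<xi> x)" for r \<xi>
      using lin[of r \<xi> 0] by simp
    show "norm (cls_on \<Omega> (\<lambda>x. m x * rep \<xi> x)) \<le> norm \<xi> * \<bar>B\<bar>" for \<xi>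
    proof -
      have "(\<integral>x. (cmod (m x * rep \<xi> x))\<^sup>2 \<partial>lebesgue_on \<Omega>) \<le> (\<integral>x. B\<^sup>2 * (cmod (rep \<xi> x))\<^sup>2 \<partial>lebesgue_on \<Omega>)"
      proof (rule integral_mono_AE)
        show "AE x in lebesgue_on \<Omega>. (cmod (m x * rep \<xi> x))\<^sup>2 \<le> B\<^sup>2 * (cmod (rep \<xi> x))\<^sup>2"
          using B by eventually_elim (simp add: norm_mult power_mult_distrib mult_right_mono power_mono)
      qed (auto intro: L2_integrable mL)
      then have "l2norm \<Omega> (\<lambda>x. m x * rep \<xi> x) \<le> sqrt (B\<^sup>2 * (\<integral>x. (cmod (rep \<xi> x))\<^sup>2 \<partial>lebesgue_on \<Omega>))"
        unfolding l2norm_def by simp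
      also have "\<dots> = \<bar>B\<bar> * l2norm \<Omega> (rep \<xi>)"
        by (simp add: real_sqrt_mult l2norm_def)
      also have "\<dots> \<le> \<bar>B\<bar> * norm \<xi>"
        by (intro mult_left_mono l2norm_rep_le) simp
      finally show ?thesis by (simp add: norm_cls_on[OF mL] mult.commute)
    qed
  qed
  then have "bounded_bilinear (\<lambda>\<xi> \<zeta>. cls_on \<Omega> (\<lambda>x. m x * rep \<xi> x) \<bullet> \<zeta>)"
    by (rule bounded_bilinear.comp1[OF bounded_bilinear_inner])
  moreover have "(\<lambda>\<xi> \<zeta>. cls_on \<Omega> (\<lambda>x. m x * rep \<xi> x) \<bullet> \<zeta>) = pair \<Omega> m"
    by (intro ext) (simp add: inner_cls_on[OF mL] pair_def)
  ultimately show ?thesis by simp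
qed

end

section \<open>Smooth functions and weak derivatives\<close>

definition has_partials :: "('n::euclidean_space \<Rightarrow> complex) \<Rightarrow> ('n \<Rightarrow> 'n \<Rightarrow> complex) \<Rightarrow> bool" where
  "has_partials f g \<longleftrightarrow> (\<forall>x. (f has_derivative (\<lambda>h. \<Sum>b\<in>Basis. of_real (h \<bullet> b) * g b x)) (at x))"

text \<open>A coinductive reading: a set of functions closed under partial derivatives replaces the
  family indexed by lists. Smoothness proofs then only have to exhibit such a set.\<close>

lemma smooth_fun_iff:
  "smooth_fun f \<longleftrightarrow> (\<exists>X. f \<in> X \<and> (\<forall>g\<in>X. \<exists>g'. has_partials g g' \<and> (\<forall>b. g' b \<in> X)))"
proof
  assume "smooth_fun f"
  then obtain D where D: "D [] = f"
    "\<And>bs x. (D bs has_derivative (\<lambda>h. \<Sum>b\<in>Basis. of_real (h \<bullet> b) * D (b # bs) x)) (at x)"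
    unfolding smooth_fun_def by blast
  have "f \<in> range D" using D(1) by blast
  moreover have "\<exists>g'. has_partials (D bs) g' \<and> (\<forall>b. g' b \<in> range D)" for bs
    by (rule exI[of _ "\<lambda>b. D (b # bs)"]) (auto simp: has_partials_def D(2))
  ultimately show "\<exists>X. f \<in> X \<and> (\<forall>g\<in>X. \<exists>g'. has_partials g g' \<and> (\<forall>b. g' b \<in> X))"
    by (intro exI[of _ "range D"]) auto
next
  assume "\<exists>X. f \<in> X \<and> (\<forall>g\<in>X. \<exists>g'. has_partials g g' \<and> (\<forall>b. g' b \<in> X))"
  then obtain X nx where X: "f \<in> X" "\<And>g. g \<in> X \<Longrightarrow> has_partials g (nx g)" "\<And>g b. g \<in> X \<Longrightarrow> nx g b \<in> X"
    by metis
  define D where "D = rec_list f (\<lambda>b bs d. nx d b)"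
  have D: "D [] = f" "D (b # bs) = nx (D bs) b" for b bs by (simp_all add: D_def)
  have "D bs \<in> X" for bs by (induction bs) (auto simp: D X)
  then have "\<forall>bs x. (D bs has_derivative (\<lambda>h. \<Sum>b\<in>Basis. of_real (h \<bullet> b) * D (b # bs) x)) (at x)"
    using X(2) by (auto simp: has_partials_def D)
  then show "smooth_fun f" unfolding smooth_fun_def using D(1) by blast
qed

inductive_set alg :: "('n::euclidean_space \<Rightarrow> complex) set \<Rightarrow> ('n \<Rightarrow> complex) set" for X where
  alg_base: "f \<in> X \<Longrightarrow> f \<in> alg X"
| alg_const: "(\<lambda>x. c) \<in> alg X"
| alg_add: "f \<in> alg X \<Longrightarrow> g \<in> alg X \<Longrightarrow> (\<lambda>x. f x + g x) \<in> alg X"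
| alg_mult: "f \<in> alg X \<Longrightarrow> g \<in> alg X \<Longrightarrow> (\<lambda>x. f x * g x) \<in> alg X"

lemma alg_prod: "finite I \<Longrightarrow> (\<And>i. i \<in> I \<Longrightarrow> f i \<in> alg X) \<Longrightarrow> (\<lambda>x. \<Prod>i\<in>I. f i x) \<in> alg X"
  by (induction I rule: finite_induct) (auto intro: alg_const alg_mult)

lemma has_partials_const: "has_partials (\<lambda>x. c) (\<lambda>b x. 0)"
  by (simp add: has_partials_def)

lemma has_partials_add:
  "has_partials f f' \<Longrightarrow> has_partials g g' \<Longrightarrow> has_partials (\<lambda>x. f x + g x) (\<lambda>b x. f' b x + g' b x)"
  unfolding has_partials_def
  by (auto intro!: derivative_eq_intros simp: sum.distrib distrib_left)

lemma has_partials_mult: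
  assumes "has_partials f f'" "has_partials g g'"
  shows "has_partials (\<lambda>x. f x * g x) (\<lambda>b x. f x * g' b x + f' b x * g x)"
  unfolding has_partials_def
proof
  fix x
  have "((\<lambda>x. f x * g x) has_derivative
      (\<lambda>h. f x * (\<Sum>b\<in>Basis. of_real (h \<bullet> b) * g' b x) + (\<Sum>b\<in>Basis. of_real (h \<bullet> b) * f' b x) * g x)) (at x)"
    using assms unfolding has_partials_def by (intro has_derivative_mult) auto
  moreover have "(\<lambda>h. f x * (\<Sum>b\<in>Basis. of_real (h \<bullet> b) * g' b x) + (\<Sum>b\<in>Basis. of_real (h \<bullet> b) * f' b x) * g x)
      = (\<lambda>h. \<Sum>b\<in>Basis. of_real (h \<bullet> b) * (f x * g' b x + f' b x * g x))"
    by (simp add: sum_distrib_left sum_distrib_right sum.distrib distrib_left mult_ac)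
  ultimately show "((\<lambda>x. f x * g x) has_derivative (\<lambda>h. \<Sum>b\<in>Basis. of_real (h \<bullet> b) * (f x * g' b x + f' b x * g x))) (at x)"
    by simp
qed

text \<open>By the sum and product rules the generated algebra is closed under partial derivatives
  as soon as the derivatives of the generators lie in it, so it is a witness for
  \<open>smooth_fun_iff\<close>.\<close>

lemma smooth_fun_alg:
  assumes X: "\<And>g. g \<in> X \<Longrightarrow> \<exists>g'. has_partials g g' \<and> (\<forall>b. g' b \<in> alg X)" and "f \<in> alg X"
  shows "smooth_fun f"
  unfolding smooth_fun_iff
proof (intro exI[of _ "alg X"] conjI ballI)
  fix g assume "g \<in> alg X"
  then show "\<exists>g'. has_partials g g' \<and> (\<forall>b. g' b \<in> alg X)"
  proof induction
    case (alg_base f)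
    then show ?case by (rule X)
  next
    case (alg_const c)
    show ?case by (intro exI conjI allI, rule has_partials_const, rule alg.alg_const)
  next
    case (alg_add f g)
    then obtain f' g' where "has_partials f f'" "\<forall>b. f' b \<in> alg X" "has_partials g g'" "\<forall>b. g' b \<in> alg X" by blast
    then show ?case
      by (intro exI[of _ "\<lambda>b x. f' b x + g' b x"] conjI allI has_partials_add alg.alg_add) auto
  next
    case (alg_mult f g)
    then obtain f' g' where "has_partials f f'" "\<forall>b. f' b \<in> alg X" "has_partials g g'" "\<forall>b. g' b \<in> alg X" by blast
    with alg_mult(1,2) show ?case
      by (intro exI[of _ "\<lambda>b x. f x * g' b x + f' b x * g x"] conjI allI has_partials_mult alg.alg_add alg.alg_mult) auto
  qed
qed fact

lemma smooth_fun_mult: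
  assumes "smooth_fun f" "smooth_fun g"
  shows "smooth_fun (\<lambda>x. f x * g x)"
proof -
  obtain X where X: "f \<in> X" "\<And>g. g \<in> X \<Longrightarrow> \<exists>g'. has_partials g g' \<and> (\<forall>b. g' b \<in> X)"
    using assms(1) unfolding smooth_fun_iff by blast
  obtain Y where Y: "g \<in> Y" "\<And>g. g \<in> Y \<Longrightarrow> \<exists>g'. has_partials g g' \<and> (\<forall>b. g' b \<in> Y)"
    using assms(2) unfolding smooth_fun_iff by blast
  show ?thesis
  proof (rule smooth_fun_alg[of "X \<union> Y"])
    show "\<exists>g'. has_partials g g' \<and> (\<forall>b. g' b \<in> alg (X \<union> Y))" if "g \<in> X \<union> Y" for g
      using that X(2)[of g] Y(2)[of g] by (meson UnE UnI1 UnI2 alg.alg_base)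
    show "(\<lambda>x. f x * g x) \<in> alg (X \<union> Y)"
      using X(1) Y(1) by (intro alg.alg_mult alg.alg_base) auto
  qed
qed

text \<open>Functions of a single affine coordinate carry derivative rules of one variable over to
  the Euclidean space. The bumps and the weight are products of such functions.\<close>

lemma has_partials_ridge:
  assumes "\<And>y. (\<phi> has_real_derivative \<phi>' y) (at y)"
  shows "has_partials (\<lambda>x. of_real (\<phi> (x \<bullet> e + s))) (\<lambda>b x. of_real (b \<bullet> e) * of_real (\<phi>' (x \<bullet> e + s)))"
  unfolding has_partials_def
proof
  fix x :: 'a
  have "((\<lambda>x. x \<bullet> e + s) has_derivative (\<lambda>h. h \<bullet> e)) (at x)"
    by (auto intro!: derivative_eq_intros)
  from has_derivative_compose[OF this assms[unfolded has_field_derivative_def]]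
  have "((\<lambda>x. complex_of_real (\<phi> (x \<bullet> e + s))) has_derivative (\<lambda>h. of_real (\<phi>' (x \<bullet> e + s) * (h \<bullet> e)))) (at x)"
    by (rule has_derivative_of_real)
  moreover have "(\<lambda>h. complex_of_real (\<phi>' (x \<bullet> e + s) * (h \<bullet> e)))
      = (\<lambda>h. \<Sum>b\<in>Basis. of_real (h \<bullet> b) * (of_real (b \<bullet> e) * of_real (\<phi>' (x \<bullet> e + s))))"
  proof
    fix h :: 'a
    have "h \<bullet> e = (\<Sum>b\<in>Basis. (h \<bullet> b) * (b \<bullet> e))"
      by (subst euclidean_inner) (simp add: inner_commute)
    then show "complex_of_real (\<phi>' (x \<bullet> e + s) * (h \<bullet> e))
      = (\<Sum>b\<in>Basis. of_real (h \<bullet> b) * (of_real (b \<bullet> e) * of_real (\<phi>' (x \<bullet> e + s))))"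
      by (simp add: sum_distrib_left mult_ac)
  qed
  ultimately show "((\<lambda>x. complex_of_real (\<phi> (x \<bullet> e + s))) has_derivative
      (\<lambda>h. \<Sum>b\<in>Basis. of_real (h \<bullet> b) * (of_real (b \<bullet> e) * of_real (\<phi>' (x \<bullet> e + s))))) (at x)"
    by simp
qed

section \<open>Smooth bumps and the smooth weight\<close>

definition bump :: "nat \<Rightarrow> real \<Rightarrow> real" where
  "bump k y = (if y > 0 then inverse y ^ k * exp (- inverse y) else 0)"

text \<open>Differentiation stays within the family \<open>bump k\<close>, which settles smoothness
  of all orders at once. At \<open>0\<close> the right difference quotient is
  \<open>inverse h ^ Suc k / exp (inverse h)\<close>, and the exponential beats every power.\<close>

lemma bump_deriv: "(bump k has_real_derivative (- real k) * bump (Suc k) y + bump (Suc (Suc k)) y) (at y)"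
proof -
  consider "y > 0" | "y < 0" | "y = 0" by linarith
  then show ?thesis
  proof cases
    case 1
    have "((\<lambda>y. inverse y ^ k * exp (- inverse y)) has_real_derivative
        (- real k) * bump (Suc k) y + bump (Suc (Suc k)) y) (at y)"
    proof (cases k)
      case 0
      then show ?thesis using 1
        by (auto intro!: derivative_eq_intros simp: bump_def power2_eq_square field_simps)
    next
      case (Suc j)
      then show ?thesis using 1
        by (auto intro!: derivative_eq_intros simp: bump_def field_simps) (metis One_nat_def power_eq_if)
    qed
    then show ?thesis
      by (rule has_field_derivative_transform_within_open[where S = "{0<..}"]) (use 1 in \<open>auto simp: bump_def\<close>)
  next
    case 2
    have "((\<lambda>y. 0) has_real_derivative 0) (at y)" by simp
    then have "(bump k has_real_derivative 0) (at y)"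
      by (rule has_field_derivative_transform_within_open[where S = "{..<0}"]) (use 2 in \<open>auto simp: bump_def\<close>)
    then show ?thesis using 2 by (simp add: bump_def)
  next
    case 3
    have "((\<lambda>h. (bump k (0 + h) - bump k 0) / h) \<longlongrightarrow> 0) (at_right 0)"
    proof (rule Lim_transform_eventually)
      have "((\<lambda>h. inverse h ^ Suc k / exp (inverse h)) \<longlongrightarrow> (0::real)) (at_right 0)"
        using filterlim_compose[OF tendsto_power_div_exp_0 filterlim_inverse_at_top_right] .
      then show "((\<lambda>h. inverse h ^ Suc k / exp (inverse h)) \<longlongrightarrow> (0::real)) (at_right 0)" .
      show "\<forall>\<^sub>F h in at_right 0. inverse h ^ Suc k / exp (inverse h) = (bump k (0 + h) - bump k 0) / h"
        by (auto simp: eventually_at_filter bump_def exp_minus field_simps)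
    qed
    moreover have "((\<lambda>h. (bump k (0 + h) - bump k 0) / h) \<longlongrightarrow> 0) (at_left 0)"
      by (rule tendsto_eventually) (auto simp: eventually_at_filter bump_def)
    ultimately have "((\<lambda>h. (bump k (0 + h) - bump k 0) / h) \<longlongrightarrow> 0) (at 0)"
      by (simp add: filterlim_split_at)
    then show ?thesis unfolding 3 by (simp add: DERIV_def) (simp add: bump_def)
  qed
qed

definition ridges :: "(real \<Rightarrow> real) set \<Rightarrow> ('n::euclidean_space \<Rightarrow> complex) set" where
  "ridges \<Phi> = {\<lambda>x. of_real (\<phi> (x \<bullet> e + s)) | \<phi> e s. \<phi> \<in> \<Phi>}"

lemma ridgesI: "\<phi> \<in> \<Phi> \<Longrightarrow> (\<lambda>x. of_real (\<phi> (x \<bullet> e + s))) \<in> alg (ridges \<Phi>)"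
  unfolding ridges_def by (rule alg.alg_base) blast

lemma smooth_fun_box_bump:
  fixes a c :: "'n::euclidean_space"
  shows "smooth_fun (\<lambda>x::'n. \<Prod>b\<in>Basis. complex_of_real (bump 0 (m * (x \<bullet> b - a \<bullet> b))) * complex_of_real (bump 0 (m * (c \<bullet> b - x \<bullet> b))))"
proof (rule smooth_fun_alg[of "ridges (range bump)"])
  fix g :: "'n \<Rightarrow> complex" assume "g \<in> ridges (range bump)"
  then obtain k e s where g: "g = (\<lambda>x. of_real (bump k (x \<bullet> e + s)))" by (auto simp: ridges_def)
  show "\<exists>g'. has_partials g g' \<and> (\<forall>b. g' b \<in> alg (ridges (range bump)))"
  proof (intro exI conjI allI)
    show "has_partials g (\<lambda>b x. of_real (b \<bullet> e) * of_real ((- real k) * bump (Suc k) (x \<bullet> e + s) + bump (Suc (Suc k)) (x \<bullet> e + s)))"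
      unfolding g by (rule has_partials_ridge[OF bump_deriv])
    show "(\<lambda>x. complex_of_real (b \<bullet> e) * of_real ((- real k) * bump (Suc k) (x \<bullet> e + s) + bump (Suc (Suc k)) (x \<bullet> e + s)))
        \<in> alg (ridges (range bump))" for b
      unfolding of_real_add of_real_mult
      by (intro alg.alg_mult alg.alg_const alg.alg_add ridgesI) auto
  qed
next
  have *: "(\<lambda>x. complex_of_real (bump 0 (m * (x \<bullet> b - a \<bullet> b)))) = (\<lambda>x. of_real (bump 0 (x \<bullet> (m *\<^sub>R b) + - (m * (a \<bullet> b)))))"
    "(\<lambda>x. complex_of_real (bump 0 (m * (c \<bullet> b - x \<bullet> b)))) = (\<lambda>x. of_real (bump 0 (x \<bullet> ((- m) *\<^sub>R b) + m * (c \<bullet> b))))" for b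
    by (auto simp: algebra_simps)
  show "(\<lambda>x::'n. \<Prod>b\<in>Basis. complex_of_real (bump 0 (m * (x \<bullet> b - a \<bullet> b))) * complex_of_real (bump 0 (m * (c \<bullet> b - x \<bullet> b))))
      \<in> alg (ridges (range bump))"
    unfolding * by (intro alg_prod finite_Basis alg.alg_mult; unfold *; intro ridgesI rangeI)
qed

text \<open>The hyperbolic secant instead of an exponential of
  \<open>- \<rho> * \<bar>y\<bar>\<close> keeps the weight smooth across \<open>x0\<close>.
  Smoothness matters because the product rule for weak derivatives moves the weight onto the test
  function, which must remain a test function.\<close>

definition weight :: "real \<Rightarrow> 'n::euclidean_space \<Rightarrow> 'n \<Rightarrow> real" where
  "weight \<rho> x0 x = (\<Prod>b\<in>Basis. 1 / cosh (\<rho> * (x \<bullet> b - x0 \<bullet> b)))"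

lemma sech_deriv: "((\<lambda>y::real. 1 / cosh y) has_real_derivative (- tanh y * (1 / cosh y))) (at y)"
  by (auto intro!: derivative_eq_intros simp: tanh_def power2_eq_square field_simps)

lemma tanh_deriv: "(tanh has_real_derivative (1 + - tanh y * tanh y)) (at y)" for y :: real
  using has_field_derivative_tanh[OF _ DERIV_ident, of y] by (simp add: power2_eq_square)

text \<open>The derivative of sech is \<open>- tanh * sech\<close> and that of tanh is
  \<open>1 - tanh * tanh\<close>, so polynomials in the two are closed under
  differentiation.\<close>

lemma smooth_fun_weight: "smooth_fun (\<lambda>x::'n::euclidean_space. complex_of_real (weight \<rho> x0 x))"
proof (rule smooth_fun_alg[of "ridges {tanh, \<lambda>y. 1 / cosh y}"])
  let ?\<Phi> = "{tanh, \<lambda>y::real. 1 / cosh y}"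
  fix g :: "'n \<Rightarrow> complex" assume "g \<in> ridges ?\<Phi>"
  then obtain e s where "g = (\<lambda>x. of_real (tanh (x \<bullet> e + s))) \<or> g = (\<lambda>x. of_real (1 / cosh (x \<bullet> e + s)))"
    unfolding ridges_def by blast
  then show "\<exists>g'. has_partials g g' \<and> (\<forall>b. g' b \<in> alg (ridges ?\<Phi>))"
  proof
    assume g: "g = (\<lambda>x. of_real (tanh (x \<bullet> e + s)))"
    show ?thesis
    proof (intro exI conjI allI)
      show "has_partials g (\<lambda>b x. of_real (b \<bullet> e) * of_real (1 + - tanh (x \<bullet> e + s) * tanh (x \<bullet> e + s)))"
        unfolding g by (rule has_partials_ridge[OF tanh_deriv])
      show "(\<lambda>x. complex_of_real (b \<bullet> e) * of_real (1 + - tanh (x \<bullet> e + s) * tanh (x \<bullet> e + s))) \<in> alg (ridges ?\<Phi>)" for b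
        unfolding of_real_add of_real_mult mult_minus1[symmetric, of "tanh _"]
        by (intro alg.alg_mult alg.alg_const alg.alg_add ridgesI) auto
    qed
  next
    assume g: "g = (\<lambda>x. of_real (1 / cosh (x \<bullet> e + s)))"
    show ?thesis
    proof (intro exI conjI allI)
      show "has_partials g (\<lambda>b x. of_real (b \<bullet> e) * of_real (- tanh (x \<bullet> e + s) * (1 / cosh (x \<bullet> e + s))))"
        unfolding g by (rule has_partials_ridge[OF sech_deriv])
      show "(\<lambda>x. complex_of_real (b \<bullet> e) * of_real (- tanh (x \<bullet> e + s) * (1 / cosh (x \<bullet> e + s)))) \<in> alg (ridges ?\<Phi>)" for b
        unfolding of_real_add of_real_mult mult_minus1[symmetric, of "tanh _"]
        by (intro alg.alg_mult alg.alg_const alg.alg_add ridgesI) auto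
    qed
  qed
next
  have *: "(\<lambda>x. complex_of_real (1 / cosh (\<rho> * (x \<bullet> b - x0 \<bullet> b)))) =
      (\<lambda>x. of_real (1 / cosh (x \<bullet> (\<rho> *\<^sub>R b) + - (\<rho> * (x0 \<bullet> b)))))" for b
    by (auto simp: algebra_simps)
  show "(\<lambda>x. complex_of_real (weight \<rho> x0 x)) \<in> alg (ridges {tanh, \<lambda>y. 1 / cosh y})"
    unfolding weight_def of_real_prod
    by (intro alg_prod finite_Basis) (simp only: *, rule ridgesI[where \<phi> = "\<lambda>y. 1 / cosh y"], simp)
qed

section \<open>Test functions and the product rule for weak derivatives\<close>

lemma compact_support_L2:
  fixes f :: "'n::euclidean_space \<Rightarrow> complex"
  assumes "continuous_on UNIV f" "compact S" "\<And>x. x \<notin> S \<Longrightarrow> f x = 0"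
  shows "L2 lebesgue f"
proof -
  have "bounded (f ` S)"
    using compact_imp_bounded[OF compact_continuous_image[OF continuous_on_subset[OF assms(1)] assms(2)]] by simp
  then obtain B where B: "\<And>x. x \<in> S \<Longrightarrow> cmod (f x) \<le> B" by (auto simp: bounded_iff)
  show ?thesis
  proof (rule L2_dominated)
    show "f \<in> borel_measurable lebesgue"
      using borel_measurable_continuous_onI[OF assms(1)] by (intro measurable_completion) simp
    have "integrable lebesgue (indicator S :: 'n \<Rightarrow> real)"
      using lmeasurable_compact[OF assms(2)] by (simp add: lmeasurable_iff_integrable)
    then show "integrable lebesgue (\<lambda>x. B\<^sup>2 * indicator S x)" by (rule integrable_mult_right)
    show "AE x in lebesgue. (cmod (f x))\<^sup>2 \<le> B\<^sup>2 * indicator S x"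
    proof (intro always_eventually allI)
      fix x show "(cmod (f x))\<^sup>2 \<le> B\<^sup>2 * indicator S x"
        by (cases "x \<in> S") (use B assms(3) in \<open>auto simp: power_mono\<close>)
    qed
  qed
qed

lemma has_partials_imp_continuous: "has_partials f f' \<Longrightarrow> continuous_on UNIV f"
  unfolding has_partials_def
  by (meson continuous_at_imp_continuous_on has_derivative_continuous)

lemma cpartial_eq: "has_partials f f' \<Longrightarrow> b \<in> Basis \<Longrightarrow> cpartial b f = f' b"
proof
  fix x assume f: "has_partials f f'" and b: "b \<in> Basis"
  have "frechet_derivative f (at x) = (\<lambda>h. \<Sum>b\<in>Basis. of_real (h \<bullet> b) * f' b x)"
    using f unfolding has_partials_def by (metis frechet_derivative_at)
  then have "cpartial b f x = (\<Sum>b'\<in>Basis. of_real (b \<bullet> b') * f' b' x)"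
    by (simp add: cpartial_def)
  also have "\<dots> = (\<Sum>b'\<in>Basis. if b' = b then f' b' x else 0)"
    using b by (intro sum.cong) (auto simp: inner_Basis)
  also have "\<dots> = f' b x" using b by simp
  finally show "cpartial b f x = f' b x" .
qed

lemma has_partials_zero_outside:
  assumes f: "has_partials f f'" and b: "b \<in> Basis" and x: "x \<notin> closure {x. f x \<noteq> 0}"
  shows "f' b x = 0"
proof -
  have "((\<lambda>x. 0::complex) has_derivative (\<lambda>h. 0)) (at x)" by simp
  then have "(f has_derivative (\<lambda>h. 0)) (at x)"
    by (rule has_derivative_transform_within_open[where s = "- closure {x. f x \<noteq> 0}"])
      (use x closure_subset[of "{x. f x \<noteq> 0}"] in auto)
  then have "frechet_derivative f (at x) = (\<lambda>h. 0)" by (metis frechet_derivative_at)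
  then show ?thesis using cpartial_eq[OF f b] by (metis cpartial_def)
qed

lemma test_fun_partials:
  assumes "test_fun \<Omega> \<phi>"
  obtains \<phi>' where "has_partials \<phi> \<phi>'" "\<And>b. smooth_fun (\<phi>' b)"
proof -
  obtain X where X: "\<phi> \<in> X" "\<And>g. g \<in> X \<Longrightarrow> \<exists>g'. has_partials g g' \<and> (\<forall>b. g' b \<in> X)"
    using assms unfolding test_fun_def smooth_fun_iff by blast
  then obtain \<phi>' where \<phi>': "has_partials \<phi> \<phi>'" "\<And>b. \<phi>' b \<in> X" by blast
  show ?thesis
    by (rule that[OF \<phi>'(1)]) (use X(2) \<phi>'(2) in \<open>auto simp: smooth_fun_iff\<close>)
qed

lemma smooth_fun_continuous: "smooth_fun f \<Longrightarrow> continuous_on UNIV f"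
  unfolding smooth_fun_iff using has_partials_imp_continuous by blast

lemma test_fun_L2_mult:
  assumes "test_fun \<Omega> \<phi>" "continuous_on UNIV m"
  shows "L2 lebesgue (\<lambda>x. m x * \<phi> x)"
proof (rule compact_support_L2[where S = "closure {x. \<phi> x \<noteq> 0}"])
  show "continuous_on UNIV (\<lambda>x. m x * \<phi> x)"
    using assms smooth_fun_continuous unfolding test_fun_def by (intro continuous_intros) auto
  show "compact (closure {x. \<phi> x \<noteq> 0})" using assms by (simp add: test_fun_def)
qed (use closure_subset[of "{x. \<phi> x \<noteq> 0}"] in auto)

lemma test_fun_cpartial_L2_mult:
  assumes "test_fun \<Omega> \<phi>" "continuous_on UNIV m" "b \<in> Basis"
  shows "L2 lebesgue (\<lambda>x. m x * cpartial b \<phi> x)"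
proof -
  obtain \<phi>' where \<phi>': "has_partials \<phi> \<phi>'" "\<And>b. smooth_fun (\<phi>' b)" using assms(1) test_fun_partials by blast
  show ?thesis
    unfolding cpartial_eq[OF \<phi>'(1) assms(3)]
  proof (rule compact_support_L2[where S = "closure {x. \<phi> x \<noteq> 0}"])
    show "continuous_on UNIV (\<lambda>x. m x * \<phi>' b x)"
      using assms(2) smooth_fun_continuous[OF \<phi>'(2)] by (intro continuous_intros)
    show "compact (closure {x. \<phi> x \<noteq> 0})" using assms by (simp add: test_fun_def)
  qed (use has_partials_zero_outside[OF \<phi>'(1) assms(3)] in auto)
qed

lemma test_fun_L2:
  assumes "\<Omega> \<in> sets lebesgue" "test_fun \<Omega> \<phi>" shows "L2 (lebesgue_on \<Omega>) \<phi>"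
  using L2_restrict[OF assms(1) test_fun_L2_mult[OF assms(2), of "\<lambda>x. 1"]] by simp

lemma test_fun_cpartial_L2:
  assumes "\<Omega> \<in> sets lebesgue" "test_fun \<Omega> \<phi>" "b \<in> Basis" shows "L2 (lebesgue_on \<Omega>) (cpartial b \<phi>)"
  using L2_restrict[OF assms(1) test_fun_cpartial_L2_mult[OF assms(2) _ assms(3), of "\<lambda>x. 1"]] by simp

text \<open>The product \<open>\<eta> * \<phi>\<close> is again a test function. The weak derivative
  of \<open>f\<close> tested with it, together with the classical product rule, gives the claim
  after moving the term with \<open>\<eta>'\<close> to the other side.\<close>

lemma weak_partial_mult:
  fixes \<eta> :: "'n::euclidean_space \<Rightarrow> complex"
  assumes \<Omega>: "\<Omega> \<in> sets lebesgue" and b: "b \<in> Basis"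
    and f: "L2 (lebesgue_on \<Omega>) f" and g: "L2 (lebesgue_on \<Omega>) g" and w: "weak_partial \<Omega> f b g"
    and \<eta>: "smooth_fun \<eta>" "has_partials \<eta> \<eta>'" "continuous_on UNIV (\<eta>' b)"
  shows "weak_partial \<Omega> (\<lambda>x. \<eta> x * f x) b (\<lambda>x. \<eta> x * g x + \<eta>' b x * f x)"
  unfolding weak_partial_def
proof (intro allI impI)
  fix \<phi> assume \<phi>: "test_fun \<Omega> \<phi>"
  obtain \<phi>' where \<phi>': "has_partials \<phi> \<phi>'" using \<phi> test_fun_partials by blast
  have sub: "closure {x. \<eta> x * \<phi> x \<noteq> 0} \<subseteq> closure {x. \<phi> x \<noteq> 0}" by (intro closure_mono) auto
  then have "compact (closure {x. \<eta> x * \<phi> x \<noteq> 0})"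
    using \<phi> unfolding test_fun_def compact_closure by (auto elim: bounded_subset)
  with sub have "test_fun \<Omega> (\<lambda>x. \<eta> x * \<phi> x)"
    using \<phi> \<eta>(1) smooth_fun_mult unfolding test_fun_def by blast
  then have "(\<integral>x. f x * cpartial b (\<lambda>x. \<eta> x * \<phi> x) x \<partial>lebesgue_on \<Omega>) = - (\<integral>x. g x * (\<eta> x * \<phi> x) \<partial>lebesgue_on \<Omega>)"
    using w unfolding weak_partial_def by blast
  moreover have "f x * cpartial b (\<lambda>x. \<eta> x * \<phi> x) x = f x * (\<eta> x * cpartial b \<phi> x) + f x * (\<eta>' b x * \<phi> x)" for x
    by (simp add: cpartial_eq[OF has_partials_mult[OF \<eta>(2) \<phi>'] b] cpartial_eq[OF \<phi>' b] distrib_left)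
  ultimately have eq: "(\<integral>x. f x * (\<eta> x * cpartial b \<phi> x) + f x * (\<eta>' b x * \<phi> x) \<partial>lebesgue_on \<Omega>) = - (\<integral>x. g x * (\<eta> x * \<phi> x) \<partial>lebesgue_on \<Omega>)"
    by simp
  note cont = smooth_fun_continuous[OF \<eta>(1)]
  have i1: "integrable (lebesgue_on \<Omega>) (\<lambda>x. f x * (\<eta> x * cpartial b \<phi> x))"
    by (intro L2_mult_integrable f L2_restrict[OF \<Omega>] test_fun_cpartial_L2_mult[OF \<phi> cont b])
  have i2: "integrable (lebesgue_on \<Omega>) (\<lambda>x. f x * (\<eta>' b x * \<phi> x))"
    by (intro L2_mult_integrable f L2_restrict[OF \<Omega>] test_fun_L2_mult[OF \<phi> \<eta>(3)])
  have i3: "integrable (lebesgue_on \<Omega>) (\<lambda>x. g x * (\<eta> x * \<phi> x))"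
    by (intro L2_mult_integrable g L2_restrict[OF \<Omega>] test_fun_L2_mult[OF \<phi> cont])
  have "(\<integral>x. \<eta> x * f x * cpartial b \<phi> x \<partial>lebesgue_on \<Omega>) = (\<integral>x. f x * (\<eta> x * cpartial b \<phi> x) \<partial>lebesgue_on \<Omega>)"
    by (simp add: mult_ac)
  also have "\<dots> = - (\<integral>x. g x * (\<eta> x * \<phi> x) \<partial>lebesgue_on \<Omega>) - (\<integral>x. f x * (\<eta>' b x * \<phi> x) \<partial>lebesgue_on \<Omega>)"
    using eq by (simp only: Bochner_Integration.integral_add[OF i1 i2]) (simp add: eq_diff_eq)
  also have "\<dots> = - (\<integral>x. g x * (\<eta> x * \<phi> x) + f x * (\<eta>' b x * \<phi> x) \<partial>lebesgue_on \<Omega>)"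
    by (simp only: Bochner_Integration.integral_add[OF i3 i2]) simp
  also have "\<dots> = - (\<integral>x. (\<eta> x * g x + \<eta>' b x * f x) * \<phi> x \<partial>lebesgue_on \<Omega>)"
    by (simp add: algebra_simps)
  finally show "(\<integral>x. \<eta> x * f x * cpartial b \<phi> x \<partial>lebesgue_on \<Omega>)
      = - (\<integral>x. (\<eta> x * g x + \<eta>' b x * f x) * \<phi> x \<partial>lebesgue_on \<Omega>)" .
qed

lemma weak_partial_lincomb:
  assumes \<Omega>: "\<Omega> \<in> sets lebesgue" and b: "b \<in> Basis"
    and "L2 (lebesgue_on \<Omega>) f" "L2 (lebesgue_on \<Omega>) f'" "weak_partial \<Omega> f b f'"
    and "L2 (lebesgue_on \<Omega>) g" "L2 (lebesgue_on \<Omega>) g'" "weak_partial \<Omega> g b g'"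
  shows "weak_partial \<Omega> (\<lambda>x. c * f x + g x) b (\<lambda>x. c * f' x + g' x)"
  unfolding weak_partial_def
proof (intro allI impI)
  fix \<phi> assume \<phi>: "test_fun \<Omega> \<phi>"
  note L = test_fun_L2[OF \<Omega> \<phi>] test_fun_cpartial_L2[OF \<Omega> \<phi> b]
  have i: "integrable (lebesgue_on \<Omega>) (\<lambda>x. f x * cpartial b \<phi> x)" "integrable (lebesgue_on \<Omega>) (\<lambda>x. g x * cpartial b \<phi> x)"
    "integrable (lebesgue_on \<Omega>) (\<lambda>x. f' x * \<phi> x)" "integrable (lebesgue_on \<Omega>) (\<lambda>x. g' x * \<phi> x)"
    by (intro L2_mult_integrable L assms)+
  have "(\<integral>x. (c * f x + g x) * cpartial b \<phi> x \<partial>lebesgue_on \<Omega>)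
      = (\<integral>x. c * (f x * cpartial b \<phi> x) + g x * cpartial b \<phi> x \<partial>lebesgue_on \<Omega>)"
    by (simp add: algebra_simps)
  also have "\<dots> = c * (\<integral>x. f x * cpartial b \<phi> x \<partial>lebesgue_on \<Omega>) + (\<integral>x. g x * cpartial b \<phi> x \<partial>lebesgue_on \<Omega>)"
    using i by simp
  also have "\<dots> = - (c * (\<integral>x. f' x * \<phi> x \<partial>lebesgue_on \<Omega>) + (\<integral>x. g' x * \<phi> x \<partial>lebesgue_on \<Omega>))"
    using assms(5,8) \<phi> by (simp add: weak_partial_def)
  also have "c * (\<integral>x. f' x * \<phi> x \<partial>lebesgue_on \<Omega>) + (\<integral>x. g' x * \<phi> x \<partial>lebesgue_on \<Omega>)
      = (\<integral>x. c * (f' x * \<phi> x) + g' x * \<phi> x \<partial>lebesgue_on \<Omega>)"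
    using i by simp
  also have "\<dots> = (\<integral>x. (c * f' x + g' x) * \<phi> x \<partial>lebesgue_on \<Omega>)"
    by (simp add: algebra_simps)
  finally show "(\<integral>x. (c * f x + g x) * cpartial b \<phi> x \<partial>lebesgue_on \<Omega>) = - (\<integral>x. (c * f' x + g' x) * \<phi> x \<partial>lebesgue_on \<Omega>)" .
qed

section \<open>The fundamental lemma and uniqueness of weak derivatives\<close>

lemma bump_0_bounds: "0 \<le> bump 0 y" "bump 0 y \<le> 1"
  by (auto simp: bump_def)

lemma bump_0_limit: "(\<lambda>m. bump 0 (real m * y)) \<longlonglongrightarrow> (if y > 0 then 1 else 0)"
proof (cases "y > 0")
  case True
  have "(\<lambda>m. exp (- (inverse (real m) * inverse y))) \<longlonglongrightarrow> exp (- (0 * inverse y))"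
    by (intro tendsto_intros lim_inverse_n)
  moreover have "\<forall>\<^sub>F m in sequentially. exp (- (inverse (real m) * inverse y)) = bump 0 (real m * y)"
    using eventually_gt_at_top[of 0] by eventually_elim (use True in \<open>simp add: bump_def\<close>)
  ultimately show ?thesis using True by (simp add: tendsto_cong)
next
  case False
  then have "bump 0 (real m * y) = 0" for m
    by (auto simp: bump_def zero_less_mult_iff)
  then show ?thesis using False by simp
qed

text \<open>A smooth approximation of the indicator of an open box: for \<open>y > 0\<close> the
  factor \<open>exp (- 1 / (m * y))\<close> tends to \<open>1\<close> as \<open>m\<close> grows. The
  support stays in the closed box for every \<open>m\<close>, which is why the limit passes through
  test functions of \<Omega>.\<close>

definition box_bump :: "'n::euclidean_space \<Rightarrow> 'n \<Rightarrow> nat \<Rightarrow> 'n \<Rightarrow> complex" where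
  "box_bump a c m x = (\<Prod>b\<in>Basis. complex_of_real (bump 0 (real m * (x \<bullet> b - a \<bullet> b))) * complex_of_real (bump 0 (real m * (c \<bullet> b - x \<bullet> b))))"

lemma box_bump_outside: "x \<notin> box a c \<Longrightarrow> box_bump a c m x = 0"
  unfolding box_bump_def mem_box
  by (auto simp: bump_def zero_less_mult_iff not_less intro!: bexI)

lemma cmod_box_bump_le: "cmod (box_bump a c m x) \<le> 1"
  unfolding box_bump_def prod_norm[symmetric]
  by (intro prod_le_1) (auto simp: norm_mult bump_0_bounds intro!: mult_le_one)

lemma box_bump_limit: "(\<lambda>m. box_bump a c m x) \<longlonglongrightarrow> indicator (box a c) x"
proof (cases "x \<in> box a c")
  case True
  then have *: "0 < x \<bullet> b - a \<bullet> b" "0 < c \<bullet> b - x \<bullet> b" if "b \<in> Basis" for b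
    using that by (auto simp: mem_box)
  have "(\<lambda>m. box_bump a c m x) \<longlonglongrightarrow> (\<Prod>b\<in>(Basis::'a set). complex_of_real 1 * complex_of_real 1)"
    unfolding box_bump_def
  proof (intro tendsto_prod tendsto_mult tendsto_of_real)
    fix b :: 'a assume b: "b \<in> Basis"
    show "(\<lambda>m. bump 0 (real m * (x \<bullet> b - a \<bullet> b))) \<longlonglongrightarrow> 1"
      using bump_0_limit[of "x \<bullet> b - a \<bullet> b"] *(1)[OF b] by simp
    show "(\<lambda>m. bump 0 (real m * (c \<bullet> b - x \<bullet> b))) \<longlonglongrightarrow> 1"
      using bump_0_limit[of "c \<bullet> b - x \<bullet> b"] *(2)[OF b] by simp
  qed
  then show ?thesis using True by simp
next
  case False
  then show ?thesis by (simp add: box_bump_outside)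
qed

lemma test_fun_box_bump:
  assumes "cbox a c \<subseteq> \<Omega>" shows "test_fun \<Omega> (box_bump a c m)"
proof -
  have "{x. box_bump a c m x \<noteq> 0} \<subseteq> box a c" using box_bump_outside by blast
  then have sub: "{x. box_bump a c m x \<noteq> 0} \<subseteq> cbox a c" using box_subset_cbox by blast
  then have "closure {x. box_bump a c m x \<noteq> 0} \<subseteq> cbox a c" by (intro closure_minimal) auto
  moreover have "bounded {x. box_bump a c m x \<noteq> 0}" using bounded_subset[OF bounded_cbox sub] .
  moreover have "smooth_fun (box_bump a c m)"
    using smooth_fun_box_bump[of "real m" a c] unfolding box_bump_def[abs_def] .
  ultimately show ?thesis using assms by (auto simp: test_fun_def)
qed

lemma L2_indicator_box: "L2 lebesgue (indicator (box p q) :: 'n::euclidean_space \<Rightarrow> complex)"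
proof -
  have "integrable lebesgue (indicator (box p q) :: 'n \<Rightarrow> real)"
    using lmeasurable_box[of p q] by (simp add: lmeasurable_iff_integrable)
  then have "integrable lebesgue (\<lambda>x::'n. (cmod (indicator (box p q) x))\<^sup>2)"
    by (rule Bochner_Integration.integrable_cong[THEN iffD1, rotated 2]) (auto simp: indicator_def)
  moreover have "(indicator (box p q) :: 'n \<Rightarrow> complex) \<in> borel_measurable lebesgue"
    by (rule borel_measurable_indicator) simp
  ultimately show ?thesis unfolding L2_def by blast
qed

lemma integral_box_eq_0:
  fixes g :: "'n::euclidean_space \<Rightarrow> complex"
  assumes \<Omega>: "\<Omega> \<in> sets lebesgue" and g: "L2 (lebesgue_on \<Omega>) g"
    and test: "\<And>\<phi>. test_fun \<Omega> \<phi> \<Longrightarrow> (\<integral>x. g x * \<phi> x \<partial>lebesgue_on \<Omega>) = 0"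
    and ac: "cbox a c \<subseteq> \<Omega>"
  shows "(\<integral>x. g x * indicator (box a c) x \<partial>lebesgue_on \<Omega>) = 0"
proof -
  have [measurable]: "g \<in> borel_measurable (lebesgue_on \<Omega>)" using g by (rule L2_measurable)
  have [measurable]: "\<phi> \<in> borel_measurable (lebesgue_on \<Omega>)" if "test_fun \<Omega> \<phi>" for \<phi>
    by (rule L2_measurable[OF test_fun_L2[OF \<Omega> that]])
  have "(\<lambda>m. \<integral>x. g x * box_bump a c m x \<partial>lebesgue_on \<Omega>) \<longlonglongrightarrow> (\<integral>x. g x * indicator (box a c) x \<partial>lebesgue_on \<Omega>)"
  proof (rule integral_dominated_convergence[where w = "\<lambda>x. cmod (g x * indicator (box a c) x)"])
    show "integrable (lebesgue_on \<Omega>) (\<lambda>x. cmod (g x * indicator (box a c) x))"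
      by (intro integrable_norm L2_mult_integrable g L2_restrict[OF \<Omega>] L2_indicator_box)
    show "(\<lambda>x. g x * indicator (box a c) x) \<in> borel_measurable (lebesgue_on \<Omega>)"
      using L2_measurable[OF L2_restrict[OF \<Omega> L2_indicator_box]] by measurable
    show "(\<lambda>x. g x * box_bump a c m x) \<in> borel_measurable (lebesgue_on \<Omega>)" for m
      using test_fun_box_bump[OF ac, of m] by measurable
    show "AE x in lebesgue_on \<Omega>. (\<lambda>m. g x * box_bump a c m x) \<longlonglongrightarrow> g x * indicator (box a c) x"
      by (intro always_eventually allI tendsto_intros box_bump_limit)
    show "AE x in lebesgue_on \<Omega>. norm (g x * box_bump a c m x) \<le> cmod (g x * indicator (box a c) x)" for m
    proof (intro always_eventually allI)
      fix x show "norm (g x * box_bump a c m x) \<le> cmod (g x * indicator (box a c) x)"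
        by (cases "x \<in> box a c")
          (auto simp: norm_mult box_bump_outside cmod_box_bump_le mult_left_le)
    qed
  qed
  moreover have "(\<integral>x. g x * box_bump a c m x \<partial>lebesgue_on \<Omega>) = 0" for m
    by (rule test[OF test_fun_box_bump[OF ac]])
  ultimately show ?thesis by (simp add: LIMSEQ_const_iff)
qed

text \<open>Open boxes form an intersection-stable generator of the Borel sets. Sets over which the
  integral of \<open>G\<close> vanishes are closed under countable disjoint unions and, by
  \<open>total\<close>, under complements.\<close>

lemma integral_borel_eq_0:
  fixes G :: "'n::euclidean_space \<Rightarrow> real"
  assumes int: "integrable lebesgue G" and boxes: "\<And>p q. (\<integral>x. indicator (box p q) x *\<^sub>R G x \<partial>lebesgue) = 0"
    and total: "(\<integral>x. G x \<partial>lebesgue) = 0" and A: "A \<in> sets borel"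
  shows "(\<integral>x. indicator A x *\<^sub>R G x \<partial>lebesgue) = 0"
proof -
  have leb: "B \<in> sets lebesgue" if "B \<in> sigma_sets UNIV (range (\<lambda>(a, b). box a b :: 'n set))" for B
    using that unfolding borel_eq_box[symmetric] by (metis borel_eq_box sets_completionI_sets sets_lborel sets_measure_of subset_UNIV Pow_UNIV)
  have "Int_stable (range (\<lambda>(a, b). box a b :: 'n set))"
    by (auto simp: Int_stable_def box_Int_box)
  moreover have "range (\<lambda>(a, b). box a b :: 'n set) \<subseteq> Pow UNIV" by auto
  moreover have "A \<in> sigma_sets UNIV (range (\<lambda>(a, b). box a b))"
    using A unfolding borel_eq_box by simp
  ultimately show ?thesis
  proof (induction rule: sigma_sets_induct_disjoint)
    case (basic A)
    then show ?case using boxes by auto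
  next
    case empty
    then show ?case by simp
  next
    case (compl A)
    have i: "integrable lebesgue (\<lambda>x. indicator A x *\<^sub>R G x)"
      using leb[OF compl(1)] int by (rule integrable_mult_indicator)
    have "(\<integral>x. indicator (UNIV - A) x *\<^sub>R G x \<partial>lebesgue) = (\<integral>x. G x - indicator A x *\<^sub>R G x \<partial>lebesgue)"
      by (rule Bochner_Integration.integral_cong) (auto simp: indicator_def)
    also have "\<dots> = 0" using int i total compl(2) by simp
    finally show ?case .
  next
    case (union F)
    have F: "F i \<in> sets lebesgue" for i using union(2) leb by blast
    have "set_integrable lebesgue (\<Union>i. F i) G"
      unfolding set_integrable_def using F int by (intro integrable_mult_indicator) auto
    from lebesgue_integral_countable_add[OF F _ this] union(1)
    have "(LINT x:(\<Union>i. F i)|lebesgue. G x) = (\<Sum>i. LINT x:(F i)|lebesgue. G x)"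
      by (auto simp: disjoint_family_on_def)
    then show ?case using union(3) by (simp add: set_lebesgue_integral_def)
  qed
qed

lemma AE_le_0_if_box_integrals_0:
  fixes G :: "'n::euclidean_space \<Rightarrow> real"
  assumes int: "integrable lebesgue G" and boxes: "\<And>p q. (\<integral>x. indicator (box p q) x *\<^sub>R G x \<partial>lebesgue) = 0"
    and total: "(\<integral>x. G x \<partial>lebesgue) = 0"
  shows "AE x in lebesgue. G x \<le> 0"
proof -
  have [measurable]: "G \<in> borel_measurable lebesgue" using int by simp
  define A where "A = {x. G x > 0}"
  have "{x \<in> space lebesgue. G x > 0} \<in> sets lebesgue" by measurable
  then have A: "A \<in> sets lebesgue" by (simp add: A_def)
  \<comment> \<open>A Lebesgue measurable set is a Borel set up to a null set, which reduces the
    integral over \<open>A\<close> to the Borel case.\<close>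
  then obtain B N N' where B: "A = B \<union> N" "N \<subseteq> N'" "N' \<in> null_sets lborel" "B \<in> sets lborel"
    by (rule sets_completionE)
  have "N' \<in> null_sets lebesgue" using B(3) by (rule null_sets_completionI)
  then have "AE x in lebesgue. indicator A x *\<^sub>R G x = indicator B x *\<^sub>R G x"
    by (rule AE_I'[of N']) (use B(1,2) in \<open>auto simp: indicator_def\<close>)
  moreover have "B \<in> sets lebesgue" using B(4) by simp
  note borel_measurable_integrable[OF integrable_mult_indicator[OF A int]]
    borel_measurable_integrable[OF integrable_mult_indicator[OF this int]]
  ultimately have "(\<integral>x. indicator A x *\<^sub>R G x \<partial>lebesgue) = (\<integral>x. indicator B x *\<^sub>R G x \<partial>lebesgue)"
    by (intro integral_cong_AE)
  also have "\<dots> = 0" using integral_borel_eq_0[OF int boxes total] B(4) by simp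
  finally have "AE x in lebesgue. indicator A x *\<^sub>R G x = 0"
    using integrable_mult_indicator[OF A int]
    by (subst (asm) integral_nonneg_eq_0_iff_AE) (auto simp: A_def indicator_def)
  then show ?thesis by eventually_elim (auto simp: A_def indicator_def split: if_splits)
qed

text \<open>On a closed box inside \<Omega> test functions detect every smaller box, so all real
  parts \<open>Re (k * g x)\<close> are nonpositive there almost everywhere. The multipliers
  \<open>1\<close>, \<open>-1\<close>, \<i> and \<open>- \<i>\<close> then force \<open>g\<close> to
  vanish, and countably many boxes cover \<Omega>.\<close>

lemma fundamental_lemma:
  fixes g :: "'n::euclidean_space \<Rightarrow> complex"
  assumes "open \<Omega>" and g: "L2 (lebesgue_on \<Omega>) g"
    and test: "\<And>\<phi>. test_fun \<Omega> \<phi> \<Longrightarrow> (\<integral>x. g x * \<phi> x \<partial>lebesgue_on \<Omega>) = 0"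
  shows "AE x in lebesgue_on \<Omega>. g x = 0"
proof -
  have \<Omega>: "\<Omega> \<in> sets lebesgue" using \<open>open \<Omega>\<close> by simp
  have le0: "AE x in lebesgue. x \<in> box a c \<longrightarrow> Re (k * g x) \<le> 0" if ac: "cbox a c \<subseteq> \<Omega>" for a c k
  proof -
    define G where "G x = indicator (box a c) x *\<^sub>R Re (k * g x)" for x
    have box0: "integrable lebesgue (\<lambda>x. indicator B x *\<^sub>R Re (k * g x)) \<and> (\<integral>x. indicator B x *\<^sub>R Re (k * g x) \<partial>lebesgue) = 0"
      if B: "B = box p q" "B \<subseteq> box a c" for B p q
    proof (cases "B = {}")
      case False
      \<comment> \<open>Only a nonempty open box has \<open>cbox p q\<close> as its closure; for an
        empty one \<open>cbox p q\<close> may be a degenerate box outside \<Omega>, hence the case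
        distinction.\<close>
      have "closure (box p q) \<subseteq> cbox a c"
        using B box_subset_cbox[of a c] by (intro closure_minimal) auto
      then have cb: "cbox p q \<subseteq> \<Omega>"
        using False B(1) ac by (simp add: closure_box)
      have i: "integrable (lebesgue_on \<Omega>) (\<lambda>x. g x * indicator B x)"
        unfolding B(1) by (intro L2_mult_integrable g L2_restrict[OF \<Omega>] L2_indicator_box)
      have "B \<subseteq> \<Omega>" using B(2) box_subset_cbox[of a c] ac by blast
      have eq: "indicator \<Omega> x *\<^sub>R Re (k * (g x * indicator B x)) = indicator B x *\<^sub>R Re (k * g x)" for x
        using \<open>B \<subseteq> \<Omega>\<close> by (auto simp: indicator_def)
      have "integrable (lebesgue_on \<Omega>) (\<lambda>x. Re (k * (g x * indicator B x)))"
        using i by (intro integrable_Re integrable_mult_right)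
      moreover have "(\<integral>x. Re (k * (g x * indicator B x)) \<partial>lebesgue_on \<Omega>) = Re (k * (\<integral>x. g x * indicator B x \<partial>lebesgue_on \<Omega>))"
        using i by (subst integral_Re) simp_all
      moreover have "(\<integral>x. g x * indicator B x \<partial>lebesgue_on \<Omega>) = 0"
        unfolding B(1) by (rule integral_box_eq_0[OF \<Omega> g test cb])
      ultimately show ?thesis
        using \<Omega> by (simp add: integrable_restrict_space integral_restrict_space eq[simplified])
    qed simp
    have "AE x in lebesgue. G x \<le> 0"
    proof (rule AE_le_0_if_box_integrals_0)
      show "integrable lebesgue G" "(\<integral>x. G x \<partial>lebesgue) = 0"
        using box0[of "box a c" a c] unfolding G_def by auto
      show "(\<integral>x. indicator (box p q) x *\<^sub>R G x \<partial>lebesgue) = 0" for p q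
      proof -
        obtain p' q' where pq: "box a c \<inter> box p q = box p' q'" using box_Int_box by blast
        have "(\<integral>x. indicator (box p q) x *\<^sub>R G x \<partial>lebesgue) = (\<integral>x. indicator (box p' q') x *\<^sub>R Re (k * g x) \<partial>lebesgue)"
          unfolding pq[symmetric] G_def by (rule Bochner_Integration.integral_cong) (auto simp: indicator_def)
        then show ?thesis using box0[of "box p' q'" p' q'] pq by auto
      qed
    qed
    then show ?thesis by eventually_elim (auto simp: G_def indicator_def)
  qed
  obtain \<D> where \<D>: "countable \<D>" "\<D> \<subseteq> Pow \<Omega>" "\<And>X. X \<in> \<D> \<Longrightarrow> \<exists>a b. X = cbox a b" "\<Union>\<D> = \<Omega>"
    using open_countable_Union_open_cbox[OF \<open>open \<Omega>\<close>] by metis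
  have "AE x in lebesgue. x \<in> X \<longrightarrow> g x = 0" if X\<D>: "X \<in> \<D>" for X
  proof -
    obtain a c where X: "X = cbox a c" using \<D>(3)[OF X\<D>] by blast
    then have ac: "cbox a c \<subseteq> \<Omega>" using \<D>(2) X\<D> by blast
    \<comment> \<open>The covering boxes are closed while \<open>le0\<close> concerns open ones; the
      faces form a null set.\<close>
    have "cbox a c - box a c \<in> null_sets lebesgue"
      using negligible_frontier_interval[of a c] by (simp add: negligible_iff_null_sets)
    then have "AE x in lebesgue. x \<notin> cbox a c - box a c" by (rule AE_not_in)
    with le0[OF ac, of 1] le0[OF ac, of "-1"] le0[OF ac, of \<i>] le0[OF ac, of "- \<i>"]
    show ?thesis unfolding X by eventually_elim (auto simp: complex_eq_iff)
  qed
  then have "AE x in lebesgue. \<forall>X\<in>\<D>. x \<in> X \<longrightarrow> g x = 0"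
    unfolding AE_ball_countable[OF \<D>(1)] by blast
  then have "AE x in lebesgue. x \<in> \<Omega> \<longrightarrow> g x = 0"
    by eventually_elim (use \<D>(4) in auto)
  then show ?thesis using \<Omega> by (simp add: AE_restrict_space_iff)
qed

lemma weak_partial_unique:
  assumes "open \<Omega>" "b \<in> Basis" "L2 (lebesgue_on \<Omega>) g" "weak_partial \<Omega> f b g"
    "L2 (lebesgue_on \<Omega>) g'" "weak_partial \<Omega> f b g'"
  shows "AE x in lebesgue_on \<Omega>. g x = g' x"
proof -
  have \<Omega>: "\<Omega> \<in> sets lebesgue" using \<open>open \<Omega>\<close> by simp
  have "AE x in lebesgue_on \<Omega>. g x - g' x = 0"
  proof (rule fundamental_lemma[OF \<open>open \<Omega>\<close> L2_diff[OF assms(3,5)]])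
    fix \<phi> assume \<phi>: "test_fun \<Omega> \<phi>"
    note L = test_fun_L2[OF \<Omega> \<phi>]
    have "(\<integral>x. (g x - g' x) * \<phi> x \<partial>lebesgue_on \<Omega>) = (\<integral>x. g x * \<phi> x - g' x * \<phi> x \<partial>lebesgue_on \<Omega>)"
      by (simp add: algebra_simps)
    also have "\<dots> = (\<integral>x. g x * \<phi> x \<partial>lebesgue_on \<Omega>) - (\<integral>x. g' x * \<phi> x \<partial>lebesgue_on \<Omega>)"
      by (intro Bochner_Integration.integral_diff L2_mult_integrable L assms)
    also have "\<dots> = 0"
      using assms(4,6) \<phi> unfolding weak_partial_def by (metis cancel_comm_monoid_add_class.diff_cancel neg_equal_iff_equal)
    finally show "(\<integral>x. (g x - g' x) * \<phi> x \<partial>lebesgue_on \<Omega>) = 0" .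
  qed
  then show ?thesis by simp
qed

lemma wgrad_props:
  assumes "W12 \<Omega> f" "b \<in> Basis"
  shows "L2 (lebesgue_on \<Omega>) (wgrad \<Omega> f b)" "weak_partial \<Omega> f b (wgrad \<Omega> f b)"
proof -
  have "\<exists>g. sq_int \<Omega> g \<and> weak_partial \<Omega> f b g" using assms by (auto simp: W12_def)
  then have "sq_int \<Omega> (wgrad \<Omega> f b) \<and> weak_partial \<Omega> f b (wgrad \<Omega> f b)"
    unfolding wgrad_def by (rule someI_ex)
  then show "L2 (lebesgue_on \<Omega>) (wgrad \<Omega> f b)" "weak_partial \<Omega> f b (wgrad \<Omega> f b)"
    by (auto simp: sq_int_L2)
qed

text \<open>Uniqueness makes the choice in \<open>wgrad\<close> harmless: gradients can be computed
  by exhibiting any square integrable weak derivative.\<close>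

lemma wgrad_eqI:
  assumes "open \<Omega>" "W12 \<Omega> f" "b \<in> Basis" "L2 (lebesgue_on \<Omega>) g" "weak_partial \<Omega> f b g"
  shows "AE x in lebesgue_on \<Omega>. wgrad \<Omega> f b x = g x"
  using weak_partial_unique[OF assms(1,3) wgrad_props[OF assms(2,3)] assms(4,5)] .

lemma weak_partial_cong:
  assumes "AE x in lebesgue_on \<Omega>. f x = f' x" "L2 (lebesgue_on \<Omega>) f" "L2 (lebesgue_on \<Omega>) f'"
    "\<Omega> \<in> sets lebesgue" "b \<in> Basis" "weak_partial \<Omega> f b g"
  shows "weak_partial \<Omega> f' b g"
  unfolding weak_partial_def
proof (intro allI impI)
  fix \<phi> assume \<phi>: "test_fun \<Omega> \<phi>"
  have [measurable]: "cpartial b \<phi> \<in> borel_measurable (lebesgue_on \<Omega>)"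
    by (rule L2_measurable[OF test_fun_cpartial_L2[OF assms(4) \<phi> assms(5)]])
  have [measurable]: "f \<in> borel_measurable (lebesgue_on \<Omega>)" "f' \<in> borel_measurable (lebesgue_on \<Omega>)"
    using assms(2,3) by (simp_all add: L2_measurable)
  have "(\<integral>x. f' x * cpartial b \<phi> x \<partial>lebesgue_on \<Omega>) = (\<integral>x. f x * cpartial b \<phi> x \<partial>lebesgue_on \<Omega>)"
    by (rule integral_cong_AE) (use assms(1) in \<open>auto elim: eventually_mono\<close>)
  then show "(\<integral>x. f' x * cpartial b \<phi> x \<partial>lebesgue_on \<Omega>) = - (\<integral>x. g x * \<phi> x \<partial>lebesgue_on \<Omega>)"
    using assms(6) \<phi> by (simp add: weak_partial_def)
qed

section \<open>Bounds for the weight and its gradient\<close>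

lemma weight_pos: "weight \<rho> x0 x > 0"
  unfolding weight_def by (intro prod_pos) auto

lemma weight_le_1: "weight \<rho> x0 x \<le> 1"
  unfolding weight_def by (intro prod_le_1) (auto simp: cosh_real_ge_1)

definition dweight :: "real \<Rightarrow> 'n::euclidean_space \<Rightarrow> 'n \<Rightarrow> 'n \<Rightarrow> real" where
  "dweight \<rho> x0 b x = - \<rho> * tanh (\<rho> * (x \<bullet> b - x0 \<bullet> b)) * weight \<rho> x0 x"

lemma weight_has_derivative:
  "(weight \<rho> x0 has_derivative (\<lambda>h. \<Sum>b\<in>Basis. (h \<bullet> b) * dweight \<rho> x0 b x)) (at x)"
proof -
  let ?s = "\<lambda>b x. 1 / cosh (\<rho> * (x \<bullet> b - x0 \<bullet> b))"
  let ?t = "\<lambda>b x. tanh (\<rho> * (x \<bullet> b - x0 \<bullet> b))"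
  have "((\<lambda>x. \<rho> * (x \<bullet> b - x0 \<bullet> b)) has_derivative (\<lambda>h. \<rho> * (h \<bullet> b))) (at x)" for b
    by (auto intro!: derivative_eq_intros)
  from has_derivative_compose[OF this sech_deriv[unfolded has_field_derivative_def]]
  have "(?s b has_derivative (\<lambda>h. - ?t b x * ?s b x * (\<rho> * (h \<bullet> b)))) (at x)" for b .
  then have "((\<lambda>x. \<Prod>b\<in>Basis. ?s b x) has_derivative
      (\<lambda>h. \<Sum>b\<in>Basis. - ?t b x * ?s b x * (\<rho> * (h \<bullet> b)) * (\<Prod>b'\<in>Basis - {b}. ?s b' x))) (at x)"
    by (intro has_derivative_prod)
  moreover have "- ?t b x * ?s b x * (\<rho> * (h \<bullet> b)) * (\<Prod>b'\<in>Basis - {b}. ?s b' x) = (h \<bullet> b) * dweight \<rho> x0 b x"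
    if "b \<in> Basis" for b h
    unfolding dweight_def weight_def prod.remove[OF finite_Basis that, of "\<lambda>b. ?s b x"] by (simp only: mult_ac minus_mult_left[symmetric] minus_mult_right[symmetric])
  ultimately show ?thesis unfolding weight_def[abs_def] by (simp cong: sum.cong)
qed

text \<open>The logarithmic derivative is \<open>- \<rho>\<close> times a hyperbolic tangent. One
  factor \<rho> per derivative is the whole price of the weight, and it is this factor that turns
  into the propagation speed.\<close>

lemma dweight_bound:
  assumes "\<rho> \<ge> 0" shows "\<bar>dweight \<rho> x0 b x\<bar> \<le> \<rho> * weight \<rho> x0 x"
proof -
  let ?t = "tanh (\<rho> * (x \<bullet> b - x0 \<bullet> b))"
  have "\<bar>?t\<bar> \<le> 1" using tanh_real_bounds[of "\<rho> * (x \<bullet> b - x0 \<bullet> b)"] by (simp add: abs_le_iff)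
  then have "\<rho> * \<bar>?t\<bar> * weight \<rho> x0 x \<le> \<rho> * 1 * weight \<rho> x0 x"
    using assms weight_pos[of \<rho> x0 x] by (intro mult_right_mono mult_left_mono) auto
  then show ?thesis using assms weight_pos[of \<rho> x0 x] by (simp add: dweight_def abs_mult)
qed

lemma has_partials_weight:
  "has_partials (\<lambda>x. complex_of_real (weight \<rho> x0 x)) (\<lambda>b x. complex_of_real (dweight \<rho> x0 b x))"
  unfolding has_partials_def
proof
  fix x show "((\<lambda>x. complex_of_real (weight \<rho> x0 x)) has_derivative
      (\<lambda>h. \<Sum>b\<in>Basis. of_real (h \<bullet> b) * of_real (dweight \<rho> x0 b x))) (at x)"
    using has_derivative_of_real[OF weight_has_derivative] by simp
qed

lemma continuous_weight: "continuous_on UNIV (weight \<rho> x0)"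
  by (meson continuous_at_imp_continuous_on has_derivative_continuous weight_has_derivative)

lemma continuous_dweight: "continuous_on UNIV (dweight \<rho> x0 b)"
  unfolding dweight_def by (intro continuous_intros continuous_weight) (simp add: less_imp_neq[symmetric])

text \<open>This makes the weight an admissible multiplier of \<open>V\<close>.\<close>

lemma Lip_bdd_weight:
  assumes "\<rho> \<ge> 0" shows "Lip_bdd \<Omega> (weight \<rho> x0)"
  unfolding Lip_bdd_def
proof
  show "bounded (weight \<rho> x0 ` \<Omega>)"
    unfolding bounded_iff using weight_pos[of \<rho> x0] weight_le_1[of \<rho> x0]
    by (intro exI[of _ 1]) (simp add: abs_of_pos)
  have "(real DIM('a) * \<rho>)-lipschitz_on UNIV (weight \<rho> x0)"
  proof (rule bounded_derivative_imp_lipschitz)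
    show "(weight \<rho> x0 has_derivative (\<lambda>h. \<Sum>b\<in>Basis. (h \<bullet> b) * dweight \<rho> x0 b x)) (at x)" for x
      by (rule weight_has_derivative)
    show "onorm (\<lambda>h. \<Sum>b\<in>Basis. (h \<bullet> b) * dweight \<rho> x0 b x) \<le> real DIM('a) * \<rho>" for x :: 'a
    proof (rule onorm_le)
      fix h :: 'a
      have d: "\<bar>dweight \<rho> x0 b x\<bar> \<le> \<rho>" for b
        using dweight_bound[OF assms, of x0 b x] mult_left_mono[OF weight_le_1[of \<rho> x0 x] assms] by linarith
      have "norm (\<Sum>b\<in>Basis. (h \<bullet> b) * dweight \<rho> x0 b x) \<le> (\<Sum>b\<in>(Basis::'a set). norm h * \<rho>)"
        by (intro sum_norm_le) (auto simp: abs_mult intro!: mult_mono Basis_le_norm d)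
      then show "norm (\<Sum>b\<in>Basis. (h \<bullet> b) * dweight \<rho> x0 b x) \<le> real DIM('a) * \<rho> * norm h"
        by (simp add: mult_ac)
    qed
  qed (use assms in auto)
  then show "\<exists>C. C-lipschitz_on \<Omega> (weight \<rho> x0)"
    using lipschitz_on_subset by blast
qed

lemma sech_bounds: "exp (- \<bar>y\<bar>) \<le> 1 / cosh y" "1 / cosh y \<le> 2 * exp (- \<bar>y\<bar>)" for y :: real
proof -
  have c: "cosh y = (exp \<bar>y\<bar> + exp (- \<bar>y\<bar>)) / 2"
    by (cases "y \<ge> 0") (auto simp: cosh_field_def)
  have "exp (- \<bar>y\<bar>) \<le> exp \<bar>y\<bar>" by simp
  then have "cosh y \<le> exp \<bar>y\<bar>" unfolding c by (simp only: divide_le_eq) simp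
  then show "exp (- \<bar>y\<bar>) \<le> 1 / cosh y"
    by (simp add: exp_minus field_simps)
  have "exp \<bar>y\<bar> \<le> 2 * cosh y" unfolding c by simp
  then show "1 / cosh y \<le> 2 * exp (- \<bar>y\<bar>)"
    by (simp add: exp_minus field_simps)
qed

text \<open>The product measures distance in the sum norm, which dominates the Euclidean one; the
  rate \<rho> therefore holds in terms of \<open>dist\<close> without a dimensional loss. The factor
  \<open>2 ^ DIM('n)\<close> does not depend on \<rho> and disappears in the limit.\<close>

lemma weight_upper:
  fixes x0 :: "'n::euclidean_space"
  assumes "\<rho> \<ge> 0" "dist x x0 \<ge> r"
  shows "weight \<rho> x0 x \<le> 2 ^ DIM('n) * exp (- \<rho> * r)"
proof -
  have "weight \<rho> x0 x \<le> (\<Prod>b\<in>(Basis::'n set). 2 * exp (- \<bar>\<rho> * (x \<bullet> b - x0 \<bullet> b)\<bar>))"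
    unfolding weight_def by (intro prod_mono) (auto simp: sech_bounds)
  also have "\<dots> = 2 ^ DIM('n) * exp (- \<rho> * (\<Sum>b\<in>Basis. \<bar>(x - x0) \<bullet> b\<bar>))"
    using assms(1) by (simp add: prod.distrib exp_sum sum_distrib_left abs_mult inner_diff_left flip: sum_negf)
  also have "\<dots> \<le> 2 ^ DIM('n) * exp (- \<rho> * r)"
    using assms norm_le_l1[of "x - x0"] by (auto simp: dist_norm intro!: mult_left_mono)
  finally show ?thesis .
qed

text \<open>In this direction the sum norm costs the factor \<open>DIM('n)\<close>. The bound serves
  only on a small ball around \<open>x0\<close>, whose radius is chosen to absorb the loss, so the
  speed is unaffected.\<close>

lemma weight_lower:
  fixes x0 :: "'n::euclidean_space"
  assumes "\<rho> \<ge> 0" "dist x x0 \<le> s"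
  shows "exp (- \<rho> * (real DIM('n) * s)) \<le> weight \<rho> x0 x"
proof -
  have "(\<Sum>b\<in>Basis. \<bar>(x - x0) \<bullet> b\<bar>) \<le> (\<Sum>b\<in>(Basis::'n set). s)"
    using assms(2) by (intro sum_mono) (metis Basis_le_norm dist_norm order_trans)
  then have "exp (- \<rho> * (real DIM('n) * s)) \<le> exp (- \<rho> * (\<Sum>b\<in>Basis. \<bar>(x - x0) \<bullet> b\<bar>))"
    using assms(1) by (auto intro!: mult_left_mono)
  also have "\<dots> = (\<Prod>b\<in>(Basis::'n set). exp (- \<bar>\<rho> * (x \<bullet> b - x0 \<bullet> b)\<bar>))"
    using assms(1) by (simp add: exp_sum sum_distrib_left abs_mult inner_diff_left flip: sum_negf)
  also have "\<dots> \<le> weight \<rho> x0 x"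
    unfolding weight_def by (intro prod_mono) (auto simp: sech_bounds)
  finally show ?thesis .
qed

section \<open>Cosine families\<close>

text \<open>A primitive on the whole line: for negative \<open>x\<close> the first interval is empty
  and the second integral takes over with the sign of an oriented integral. Symmetric differences
  reach negative times.\<close>

definition prim :: "(real \<Rightarrow> 'h::banach) \<Rightarrow> real \<Rightarrow> 'h" where
  "prim f x = integral {0..x} f - integral {x..0} f"

lemma prim_0 [simp]: "prim f 0 = 0"
  by (simp add: prim_def)

lemma has_vector_derivative_prim:
  assumes "continuous_on UNIV f"
  shows "(prim f has_vector_derivative f x) (at x)"
proof -
  define R where "R = \<bar>x\<bar> + 1"
  have cont: "continuous_on {a..b} f" for a b
    using assms continuous_on_subset by blast
  have "((\<lambda>y. integral {-R..y} f) has_vector_derivative f x) (at x within {-R..R})"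
    by (rule integral_has_vector_derivative[OF cont]) (auto simp: R_def)
  moreover have "at x within {-R..R} = at x"
    by (rule at_within_interior) (auto simp: R_def)
  ultimately have "((\<lambda>y. integral {-R..y} f - integral {-R..0} f) has_vector_derivative f x - 0) (at x)"
    by (intro derivative_intros) simp_all
  then have "((\<lambda>y. integral {-R..y} f - integral {-R..0} f) has_vector_derivative f x) (at x)" by simp
  then show ?thesis
  proof (rule has_vector_derivative_transform_within_open)
    show "open {-R<..<R}" "x \<in> {-R<..<R}" by (auto simp: R_def)
    fix y assume y: "y \<in> {-R<..<R}"
    show "integral {-R..y} f - integral {-R..0} f = prim f y"
    proof (cases "y \<ge> 0")
      case True
      have "integral {-R..0} f + integral {0..y} f = integral {-R..y} f"
        by (rule Henstock_Kurzweil_Integration.integral_combine) (use True y R_def in \<open>auto intro: integrable_continuous_interval cont\<close>)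
      then show ?thesis using True by (cases "y = 0") (auto simp: prim_def algebra_simps)
    next
      case False
      have "integral {-R..y} f + integral {y..0} f = integral {-R..0} f"
        by (rule Henstock_Kurzweil_Integration.integral_combine) (use False y R_def in \<open>auto intro: integrable_continuous_interval cont\<close>)
      then show ?thesis using False by (auto simp: prim_def algebra_simps)
    qed
  qed
qed

lemma continuous_on_has_vector_derivative:
  "(\<And>t. (F has_vector_derivative f t) (at t)) \<Longrightarrow> continuous_on UNIV F"
  by (meson continuous_at_imp_continuous_on has_vector_derivative_continuous)

lemma has_vector_derivative_shift:
  assumes "\<And>x. (F has_vector_derivative f x) (at x)"
  shows "((\<lambda>s. F (c * s + a)) has_vector_derivative c *\<^sub>R f (c * t + a)) (at t)"
proof -
  have "((\<lambda>s. c * s + a) has_vector_derivative c) (at t)"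
    by (auto intro!: derivative_eq_intros)
  from vector_diff_chain_at[OF this assms[of "c * t + a"]] show ?thesis by (simp add: o_def)
qed

lemma has_vector_derivative_0_const:
  fixes D :: "real \<Rightarrow> 'h::real_normed_vector"
  assumes "\<And>t. (D has_vector_derivative 0) (at t)"
  shows "D t = D 0"
proof -
  have "\<exists>c. \<forall>x\<in>UNIV. D x = c"
    by (rule has_vector_derivative_zero_constant[of UNIV D]) (use assms in auto)
  then show ?thesis by auto
qed

text \<open>The sum \<open>prim f (- t) + c *\<^sub>R prim f t\<close> has derivative zero and
  vanishes at \<open>0\<close>. With \<open>c = 1\<close> and \<open>c = -1\<close> this says that
  primitives exchange even and odd functions.\<close>

lemma prim_reflect:
  assumes "continuous_on UNIV f" "\<And>t. f (- t) = c *\<^sub>R f t"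
  shows "prim f (- t) = (- c) *\<^sub>R prim f t"
proof -
  note d = has_vector_derivative_prim[OF assms(1)]
  have "((\<lambda>t. prim f (-1 * t + 0) + c *\<^sub>R prim f t) has_vector_derivative ((-1) *\<^sub>R f (-1 * t + 0) + c *\<^sub>R f t)) (at t)" for t
    by (intro has_vector_derivative_add has_vector_derivative_shift[OF d, where c = "-1" and a = 0]
        bounded_linear.has_vector_derivative[OF bounded_linear_scaleR_right] d)
  from has_vector_derivative_0_const[of "\<lambda>t. prim f (-1 * t + 0) + c *\<^sub>R prim f t" t] this
  have "prim f (-1 * t + 0) + c *\<^sub>R prim f t = 0" by (simp add: assms(2))
  then show ?thesis by (simp add: eq_neg_iff_add_eq_0)
qed

text \<open>The mean value inequality is applied twice: \<psi> is the second difference with its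
  expected quadratic part removed, \<phi> is its derivative, and the derivative of \<phi> is small
  near \<open>0\<close> by continuity of \<open>g\<close> at \<open>t\<close>. The factor
  \<open>e / 4\<close> leaves \<open>e / 2\<close> after the two terms \<open>g (t + q)\<close> and
  \<open>g (t - q)\<close> are added.\<close>

lemma second_symmetric_derivative:
  fixes F :: "real \<Rightarrow> 'h::real_inner"
  assumes F: "\<And>t. (F has_vector_derivative f t) (at t)" and f: "\<And>t. (f has_vector_derivative g t) (at t)"
    and g: "isCont g t"
  shows "((\<lambda>s. (1 / s\<^sup>2) *\<^sub>R (F (t + s) + F (t - s) - 2 *\<^sub>R F t)) \<longlongrightarrow> g t) (at 0)"
proof -
  define \<phi> where "\<phi> s = f (1 * s + t) - f (-1 * s + t) - (2 * s) *\<^sub>R g t" for s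
  define \<psi> where "\<psi> s = F (1 * s + t) + F (-1 * s + t) - s\<^sup>2 *\<^sub>R g t" for s
  have \<phi>': "(\<phi> has_vector_derivative (g (1 * s + t) + g (-1 * s + t) - 2 *\<^sub>R g t)) (at s)" for s
    unfolding \<phi>_def
    using has_vector_derivative_shift[where c = 1 and t = s and a = t, OF f] has_vector_derivative_shift[where c = "-1" and t = s and a = t, OF f]
    by (auto intro!: derivative_eq_intros simp del: mult_1)
  have \<psi>': "(\<psi> has_vector_derivative \<phi> s) (at s)" for s
    unfolding \<psi>_def \<phi>_def
    using has_vector_derivative_shift[where c = 1 and t = s and a = t, OF F] has_vector_derivative_shift[where c = "-1" and t = s and a = t, OF F]
    by (auto intro!: derivative_eq_intros simp del: mult_1)
  have mvt: "\<exists>r. \<bar>r\<bar> \<le> \<bar>s\<bar> \<and> norm (D s - D 0) \<le> norm (D' r) * \<bar>s\<bar>"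
    if D: "\<And>s. (D has_vector_derivative D' s) (at s)" for D D' :: "real \<Rightarrow> 'h" and s
  proof (cases "s = 0")
    case False
    have "\<exists>x\<in>{min 0 s<..<max 0 s}. norm (D (max 0 s) - D (min 0 s)) \<le> norm ((max 0 s - min 0 s) *\<^sub>R D' x)"
    proof (rule mvt_general)
      show "min 0 s < max 0 s" using False by auto
      show "continuous_on {min 0 s..max 0 s} D"
        using continuous_on_has_vector_derivative[OF D] continuous_on_subset by blast
    qed (use D in \<open>auto simp: has_vector_derivative_def\<close>)
    then obtain x where x: "x \<in> {min 0 s<..<max 0 s}"
      "norm (D (max 0 s) - D (min 0 s)) \<le> norm ((max 0 s - min 0 s) *\<^sub>R D' x)" by blast
    have "norm (D (max 0 s) - D (min 0 s)) = norm (D s - D 0)"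
      by (cases "s \<ge> 0") (auto simp: max_def min_def norm_minus_commute)
    moreover have "max 0 s - min 0 s = \<bar>s\<bar>" by auto
    moreover have "\<bar>x\<bar> \<le> \<bar>s\<bar>" using x(1) by (cases "s \<ge> 0") auto
    ultimately show ?thesis using x(2) by (intro exI[of _ x]) (simp add: mult.commute)
  qed auto
  show ?thesis
  proof (rule tendstoI)
    fix e :: real assume e: "e > 0"
    then obtain d where d: "d > 0" "\<And>y. dist y t < d \<Longrightarrow> dist (g y) (g t) < e / 4"
      using g by (auto simp: continuous_at_eps_delta dest: spec[of _ "e / 4"])
    have "dist ((1 / s\<^sup>2) *\<^sub>R (F (t + s) + F (t - s) - 2 *\<^sub>R F t)) (g t) < e" if s: "s \<noteq> 0" "\<bar>s\<bar> < d" for s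
    proof -
      have \<phi>_le: "norm (\<phi> r) \<le> e / 2 * \<bar>s\<bar>" if r: "\<bar>r\<bar> \<le> \<bar>s\<bar>" for r
      proof -
        obtain q where q: "\<bar>q\<bar> \<le> \<bar>r\<bar>" "norm (\<phi> r - \<phi> 0) \<le> norm (g (1 * q + t) + g (-1 * q + t) - 2 *\<^sub>R g t) * \<bar>r\<bar>"
          using mvt[OF \<phi>', of r] by auto
        have "norm ((g (1 * q + t) - g t) + (g (-1 * q + t) - g t)) \<le> e / 4 + e / 4"
          using d(2)[of "1 * q + t"] d(2)[of "-1 * q + t"] q r s
          by (intro order_trans[OF norm_triangle_ineq] add_mono) (auto simp: dist_norm intro!: less_imp_le)
        then have "norm (g (1 * q + t) + g (-1 * q + t) - 2 *\<^sub>R g t) \<le> e / 2"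
          by (simp add: algebra_simps scaleR_2)
        then have "norm (g (1 * q + t) + g (-1 * q + t) - 2 *\<^sub>R g t) * \<bar>r\<bar> \<le> e / 2 * \<bar>s\<bar>"
          using r e by (intro mult_mono) auto
        moreover have "\<phi> 0 = 0" by (simp add: \<phi>_def)
        ultimately show ?thesis using q by simp
      qed
      obtain r where r: "\<bar>r\<bar> \<le> \<bar>s\<bar>" "norm (\<psi> s - \<psi> 0) \<le> norm (\<phi> r) * \<bar>s\<bar>"
        using mvt[OF \<psi>', of s] by auto
      have "norm (\<psi> s - \<psi> 0) \<le> e / 2 * \<bar>s\<bar> * \<bar>s\<bar>"
        using r(2) mult_right_mono[OF \<phi>_le[OF r(1)], of "\<bar>s\<bar>"] by linarith
      then have "norm (\<psi> s - \<psi> 0) \<le> e / 2 * s\<^sup>2"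
        by (simp add: power2_eq_square mult.assoc)
      moreover have "(1 / s\<^sup>2) *\<^sub>R (F (t + s) + F (t - s) - 2 *\<^sub>R F t) - g t = (1 / s\<^sup>2) *\<^sub>R (\<psi> s - \<psi> 0)"
        using s by (simp add: \<psi>_def algebra_simps scaleR_2)
      ultimately have "norm ((1 / s\<^sup>2) *\<^sub>R (F (t + s) + F (t - s) - 2 *\<^sub>R F t) - g t) \<le> e / 2"
        using s by (simp only: norm_scaleR) (simp add: field_simps)
      then show ?thesis using e by (simp add: dist_norm)
    qed
    then show "\<forall>\<^sub>F s in at 0. dist ((1 / s\<^sup>2) *\<^sub>R (F (t + s) + F (t - s) - 2 *\<^sub>R F t)) (g t) < e"
      unfolding eventually_at using d(1) by (intro exI[of _ d]) (auto simp: dist_real_def)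
  qed
qed

locale cosine_family =
  fixes T :: "real \<Rightarrow> 'h::{real_inner,banach} \<Rightarrow> 'h"
  assumes bounded_linear_T: "bounded_linear (T t)"
    and T_0: "T 0 \<xi> = \<xi>"
    and T_add: "T (t + s) \<xi> + T (t - s) \<xi> = 2 *\<^sub>R T t (T s \<xi>)"
    and continuous_T: "continuous_on UNIV (\<lambda>t. T t \<xi>)"
begin

text \<open>\<open>S\<close> is the sine function of the family; \<open>P\<close> and
  \<open>Q\<close> are its first and second primitives.\<close>

definition S where "S \<xi> = prim (\<lambda>t. T t \<xi>)"
definition P where "P \<xi> = prim (S \<xi>)"
definition Q where "Q \<xi> = prim (P \<xi>)"

definition gen :: "'h \<Rightarrow> 'h \<Rightarrow> bool" where
  "gen \<xi> \<zeta> \<longleftrightarrow> ((\<lambda>s. (2 / s\<^sup>2) *\<^sub>R (T s \<xi> - \<xi>)) \<longlongrightarrow> \<zeta>) (at 0)"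

lemma S_deriv: "(S \<xi> has_vector_derivative T t \<xi>) (at t)"
  unfolding S_def by (rule has_vector_derivative_prim[OF continuous_T])

lemma P_deriv: "(P \<xi> has_vector_derivative S \<xi> t) (at t)"
  unfolding P_def by (rule has_vector_derivative_prim[OF continuous_on_has_vector_derivative[OF S_deriv]])

lemma Q_deriv: "(Q \<xi> has_vector_derivative P \<xi> t) (at t)"
  unfolding Q_def by (rule has_vector_derivative_prim[OF continuous_on_has_vector_derivative[OF P_deriv]])

lemma T_minus: "T (- t) \<xi> = T t \<xi>"
  using T_add[of 0 t \<xi>] by (simp add: T_0 scaleR_2)

lemma S_minus: "S \<xi> (- t) = - S \<xi> t"
  using prim_reflect[OF continuous_T, of \<xi> 1 t] by (simp add: S_def T_minus)

lemma P_minus: "P \<xi> (- t) = P \<xi> t"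
  using prim_reflect[OF continuous_on_has_vector_derivative[OF S_deriv], of \<xi> "-1" t] by (simp add: P_def S_minus)

lemma Q_minus: "Q \<xi> (- t) = - Q \<xi> t"
  using prim_reflect[OF continuous_on_has_vector_derivative[OF P_deriv], of \<xi> 1 t] by (simp add: Q_def P_minus)

text \<open>d'Alembert's functional equation, as satisfied by the solutions of the wave equation. It
  rewrites \<open>T s (F t)\<close> in terms of \<open>F\<close> alone, so questions about the
  generator become questions about time derivatives of \<open>F\<close>.\<close>

definition dalembert :: "(real \<Rightarrow> 'h) \<Rightarrow> bool" where
  "dalembert F \<longleftrightarrow> (\<forall>s t. 2 *\<^sub>R T s (F t) = F (t + s) + F (t - s))"

text \<open>The defect in the equation for \<open>F\<close> has derivative zero in \<open>t\<close>,
  because \<open>f\<close> satisfies the equation; it equals its value at \<open>t = 0\<close>. That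
  value vanishes when \<open>F\<close> is odd.\<close>

lemma dalembert_prim:
  assumes F: "\<And>t. (F has_vector_derivative f t) (at t)" and f: "dalembert f"
  shows "2 *\<^sub>R T s (F t) = F (t + s) + F (t - s) + (2 *\<^sub>R T s (F 0) - F s - F (- s))"
proof -
  interpret bounded_linear "T s" by (rule bounded_linear_T)
  have "((\<lambda>t. 2 *\<^sub>R T s (F t) - F (1 * t + s) - F (1 * t + (- s))) has_vector_derivative
      2 *\<^sub>R T s (f t) - 1 *\<^sub>R f (1 * t + s) - 1 *\<^sub>R f (1 * t + (- s))) (at t)" for t
    by (intro has_vector_derivative_diff has_vector_derivative_shift[OF F, where c = 1] has_vector_derivative
        bounded_linear.has_vector_derivative[OF bounded_linear_scaleR_right] F)
  moreover have "2 *\<^sub>R T s (f t) - 1 *\<^sub>R f (1 * t + s) - 1 *\<^sub>R f (1 * t + (- s)) = 0" for t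
    using f by (simp add: dalembert_def)
  ultimately have "2 *\<^sub>R T s (F t) - F (1 * t + s) - F (1 * t + (- s)) = 2 *\<^sub>R T s (F 0) - F (1 * 0 + s) - F (1 * 0 + (- s))"
    using has_vector_derivative_0_const[of "\<lambda>t. 2 *\<^sub>R T s (F t) - F (1 * t + s) - F (1 * t + (- s))" t] by simp
  then show ?thesis by (simp add: algebra_simps)
qed

lemma dalembert_T: "dalembert (\<lambda>t. T t \<xi>)"
  unfolding dalembert_def
proof (intro allI)
  fix s t
  show "2 *\<^sub>R T s (T t \<xi>) = T (t + s) \<xi> + T (t - s) \<xi>"
    using T_add[of s t \<xi>] T_minus[of "t - s" \<xi>] by (simp add: add.commute)
qed

lemma dalembert_S: "dalembert (S \<xi>)"
  unfolding dalembert_def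
proof (intro allI)
  fix s t
  have "S \<xi> 0 = 0" by (simp add: S_def)
  then show "2 *\<^sub>R T s (S \<xi> t) = S \<xi> (t + s) + S \<xi> (t - s)"
    using dalembert_prim[OF S_deriv dalembert_T, of s \<xi> t] linear_0[OF bounded_linear.linear[OF bounded_linear_T], of s]
    by (simp add: S_minus)
qed

lemma P_0 [simp]: "P \<xi> 0 = 0"
  by (simp add: P_def)

text \<open>Unlike \<open>T\<close> and \<open>S\<close>, the even function \<open>P\<close> misses
  d'Alembert's equation, by a term that is constant in \<open>t\<close>. A second difference in
  \<open>t\<close> removes it.\<close>

lemma T_P: "2 *\<^sub>R T s (P \<xi> t) = P \<xi> (t + s) + P \<xi> (t - s) - 2 *\<^sub>R P \<xi> s"
  using dalembert_prim[OF P_deriv dalembert_S, of s \<xi> t] linear_0[OF bounded_linear.linear[OF bounded_linear_T]]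
  by (simp add: P_minus scaleR_2)

text \<open>
  The solution with initial data \<open>0\<close> and \<open>P h\<close>, where \<open>2/h\<^sup>2 P h\<close> tends to \<open>\<xi>\<close>.  As a second difference of the
  threefold time integral of \<open>T\<close> it is smooth in time and stays in the domain of the generator; this
  replaces density and uniform boundedness arguments.
\<close>

definition sol where "sol \<xi> h t = (1/2) *\<^sub>R (Q \<xi> (t + h) + Q \<xi> (t - h)) - Q \<xi> t"
definition sol_d1 where "sol_d1 \<xi> h t = (1/2) *\<^sub>R (P \<xi> (t + h) + P \<xi> (t - h)) - P \<xi> t"
definition sol_d2 where "sol_d2 \<xi> h t = (1/2) *\<^sub>R (S \<xi> (t + h) + S \<xi> (t - h)) - S \<xi> t"
definition sol_d3 where "sol_d3 \<xi> h t = (1/2) *\<^sub>R (T (t + h) \<xi> + T (t - h) \<xi>) - T t \<xi>"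

lemma second_difference_deriv:
  fixes F f :: "real \<Rightarrow> 'h"
  assumes "\<And>t. (F has_vector_derivative f t) (at t)"
  shows "((\<lambda>t. (1/2) *\<^sub>R (F (t + h) + F (t - h)) - F t) has_vector_derivative
      (1/2) *\<^sub>R (f (t + h) + f (t - h)) - f t) (at t)"
  using has_vector_derivative_shift[where c = 1 and t = t and a = h, OF assms] has_vector_derivative_shift[where c = 1 and t = t and a = "- h", OF assms] assms[of t]
  by (auto intro!: derivative_eq_intros)

lemma sol_deriv: "(sol \<xi> h has_vector_derivative sol_d1 \<xi> h t) (at t)"
  and sol_d1_deriv: "(sol_d1 \<xi> h has_vector_derivative sol_d2 \<xi> h t) (at t)"
  and sol_d2_deriv: "(sol_d2 \<xi> h has_vector_derivative sol_d3 \<xi> h t) (at t)"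
  unfolding sol_def sol_d1_def sol_d2_def sol_d3_def
  by (rule second_difference_deriv[OF Q_deriv] second_difference_deriv[OF P_deriv] second_difference_deriv[OF S_deriv])+

lemma sol_0: "sol \<xi> h 0 = 0"
  using Q_minus[of \<xi> h] by (simp add: sol_def) (simp add: Q_def)

lemma dalembert_sol_d2: "dalembert (sol_d2 \<xi> h)"
proof -
  have *: "2 *\<^sub>R T s (S \<xi> t) = S \<xi> (t + s) + S \<xi> (t - s)" for s t
    using dalembert_S by (auto simp: dalembert_def)
  show ?thesis
    unfolding dalembert_def
  proof (intro allI)
    fix s t
    interpret bounded_linear "T s" by (rule bounded_linear_T)
    have "2 *\<^sub>R T s (sol_d2 \<xi> h t) = (1/2) *\<^sub>R (2 *\<^sub>R T s (S \<xi> (t + h)) + 2 *\<^sub>R T s (S \<xi> (t - h))) - 2 *\<^sub>R T s (S \<xi> t)"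
      by (simp add: sol_d2_def diff scaleR add algebra_simps)
    also have "\<dots> = sol_d2 \<xi> h (t + s) + sol_d2 \<xi> h (t - s)"
      unfolding * sol_d2_def by (simp add: algebra_simps)
    finally show "2 *\<^sub>R T s (sol_d2 \<xi> h t) = sol_d2 \<xi> h (t + s) + sol_d2 \<xi> h (t - s)" .
  qed
qed

lemma dalembert_sol_d1: "dalembert (sol_d1 \<xi> h)"
proof -
  have v0: "sol_d1 \<xi> h 0 = P \<xi> h"
    using P_minus[of \<xi> h] by (simp add: sol_d1_def scaleR_2[symmetric])
  have *: "2 *\<^sub>R T s (sol_d1 \<xi> h 0) = sol_d1 \<xi> h s + sol_d1 \<xi> h (- s)" for s
  proof -
    have e: "P \<xi> (- s + h) = P \<xi> (s - h)" "P \<xi> (- s - h) = P \<xi> (s + h)" "P \<xi> (h - s) = P \<xi> (s - h)"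
      using P_minus[of \<xi> "s - h"] P_minus[of \<xi> "s + h"] by simp_all
    have "sol_d1 \<xi> h s + sol_d1 \<xi> h (- s)
        = ((1/2) *\<^sub>R (P \<xi> (s + h) + P \<xi> (s - h)) + (1/2) *\<^sub>R (P \<xi> (s + h) + P \<xi> (s - h))) - 2 *\<^sub>R P \<xi> s"
      unfolding sol_d1_def e P_minus by (simp add: algebra_simps scaleR_2)
    also have "\<dots> = P \<xi> (s + h) + P \<xi> (s - h) - 2 *\<^sub>R P \<xi> s"
      by (simp flip: scaleR_add_left)
    finally show ?thesis by (simp add: v0 T_P e add.commute)
  qed
  show ?thesis
    unfolding dalembert_def
  proof (intro allI)
    fix s t
    show "2 *\<^sub>R T s (sol_d1 \<xi> h t) = sol_d1 \<xi> h (t + s) + sol_d1 \<xi> h (t - s)"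
      using dalembert_prim[OF sol_d1_deriv dalembert_sol_d2, of s \<xi> h t] *[of s] by simp
  qed
qed

lemma dalembert_sol: "dalembert (sol \<xi> h)"
proof -
  have "sol \<xi> h (- s) = - sol \<xi> h s" for s
  proof -
    have e: "Q \<xi> (- s + h) = - Q \<xi> (s - h)" "Q \<xi> (- s - h) = - Q \<xi> (s + h)"
      using Q_minus[of \<xi> "s - h"] Q_minus[of \<xi> "s + h"] by simp_all
    show ?thesis unfolding sol_def e Q_minus by (simp add: algebra_simps)
  qed
  moreover have "T s 0 = 0" for s
    by (rule linear_0[OF bounded_linear.linear[OF bounded_linear_T]])
  ultimately have "2 *\<^sub>R T s (sol \<xi> h t) = sol \<xi> h (t + s) + sol \<xi> h (t - s)" for s t
    using dalembert_prim[OF sol_deriv dalembert_sol_d1, of s \<xi> h t]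
    by (simp add: sol_0)
  then show ?thesis by (simp add: dalembert_def)
qed

text \<open>d'Alembert's equation turns the quotient that defines the generator into the symmetric
  second difference quotient of \<open>F\<close> at \<open>t\<close>, whose limit is the second
  derivative.\<close>

lemma gen_dalembert:
  assumes "dalembert F" "\<And>t. (F has_vector_derivative f t) (at t)" "\<And>t. (f has_vector_derivative g t) (at t)"
    and "isCont g t"
  shows "gen (F t) (g t)"
proof -
  have "(2 / s\<^sup>2) *\<^sub>R (T s (F t) - F t) = (1 / s\<^sup>2) *\<^sub>R (F (t + s) + F (t - s) - 2 *\<^sub>R F t)" for s
  proof -
    have "(2 / s\<^sup>2) *\<^sub>R (T s (F t) - F t) = (1 / s\<^sup>2) *\<^sub>R (2 *\<^sub>R T s (F t) - 2 *\<^sub>R F t)"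
      by (simp add: algebra_simps)
    then show ?thesis using assms(1) by (simp add: dalembert_def)
  qed
  then show ?thesis
    unfolding gen_def using second_symmetric_derivative[OF assms(2-4)] by simp
qed

lemma gen_sol: "gen (sol \<xi> h t) (sol_d2 \<xi> h t)"
  using has_vector_derivative_continuous[OF sol_d2_deriv]
  by (intro gen_dalembert[OF dalembert_sol sol_deriv sol_d1_deriv]) auto

text \<open>The velocity lies in the domain of the generator too, hence later in \<open>V\<close>.
  This is what makes the weighted velocity an admissible test function, and it is where the third
  primitive \<open>Q\<close> pays off.\<close>

lemma gen_sol_d1: "gen (sol_d1 \<xi> h t) (sol_d3 \<xi> h t)"
proof (rule gen_dalembert[OF dalembert_sol_d1 sol_d1_deriv sol_d2_deriv])
  have "continuous_on UNIV (\<lambda>t. T (t + a) \<xi>)" for a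
    by (rule continuous_on_compose2[OF continuous_T]) (auto intro!: continuous_intros)
  from this[of h] this[of "- h"] this[of 0] have "continuous_on UNIV (sol_d3 \<xi> h)"
    unfolding sol_d3_def by (auto intro!: continuous_intros)
  then show "isCont (sol_d3 \<xi> h) t" by (simp add: continuous_on_eq_continuous_at)
qed

lemma isCont_T: "isCont (\<lambda>t. T t \<xi>) t"
  using continuous_T by (simp add: continuous_on_eq_continuous_at)

text \<open>\<open>sol\<close> is half a second difference of \<open>Q\<close>, and the second
  derivative of \<open>Q\<close> is \<open>S\<close>. After rescaling, the regular solutions thus
  approximate the sine orbit, and their initial velocities approximate \<xi>.\<close>

lemma sol_limit: "((\<lambda>h. (2 / h\<^sup>2) *\<^sub>R sol \<xi> h t) \<longlongrightarrow> S \<xi> t) (at 0)"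
proof -
  have "(2 / h\<^sup>2) *\<^sub>R sol \<xi> h t = (1 / h\<^sup>2) *\<^sub>R (Q \<xi> (t + h) + Q \<xi> (t - h) - 2 *\<^sub>R Q \<xi> t)" for h
    by (simp add: sol_def algebra_simps)
  then show ?thesis
    using second_symmetric_derivative[OF Q_deriv P_deriv has_vector_derivative_continuous[OF S_deriv]] by simp
qed

lemma sol_d1_limit: "((\<lambda>h. (2 / h\<^sup>2) *\<^sub>R sol_d1 \<xi> h 0) \<longlongrightarrow> \<xi>) (at 0)"
proof -
  have "(2 / h\<^sup>2) *\<^sub>R sol_d1 \<xi> h 0 = (1 / h\<^sup>2) *\<^sub>R (P \<xi> (0 + h) + P \<xi> (0 - h) - 2 *\<^sub>R P \<xi> 0)" for h
    by (simp add: sol_d1_def algebra_simps)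
  then show ?thesis
    using second_symmetric_derivative[OF P_deriv S_deriv isCont_T, of \<xi> 0] by (simp add: T_0)
qed

end

section \<open>Pointwise estimates for the energy density\<close>

lemma inner_of_real_mult: "(complex_of_real c * x) \<bullet> y = c * (x \<bullet> y)" "x \<bullet> (complex_of_real c * y) = c * (x \<bullet> y)"
  by (simp_all add: scaleR_conv_of_real[symmetric])

text \<open>Polarisation: the form evaluated at \<open>q + \<i> * s\<close> has imaginary part zero,
  which compares the two mixed terms. It makes both halves of the time derivative of the gradient
  energy equal.\<close>

lemma hermitian_form_symmetric:
  fixes A :: "'i \<Rightarrow> 'i \<Rightarrow> complex"
  assumes "\<And>\<zeta>. Im (\<Sum>j\<in>I. \<Sum>k\<in>I. A j k * \<zeta> k * cnj (\<zeta> j)) = 0"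
  shows "(\<Sum>j\<in>I. \<Sum>k\<in>I. (A j k * s k) \<bullet> q j) = (\<Sum>j\<in>I. \<Sum>k\<in>I. (A j k * q k) \<bullet> s j)"
proof -
  define F where "F q s = (\<Sum>j\<in>I. \<Sum>k\<in>I. A j k * q k * cnj (s j))" for q s :: "'i \<Rightarrow> complex"
  have Re: "(\<Sum>j\<in>I. \<Sum>k\<in>I. (A j k * q k) \<bullet> s j) = Re (F q s)" for q s
    by (simp add: F_def inner_complex_def)
  have "F (\<lambda>j. q j + \<i> * s j) (\<lambda>j. q j + \<i> * s j) = F q q + \<i> * F s q - \<i> * F q s + F s s"
    unfolding F_def by (simp add: sum.distrib[symmetric] sum_distrib_left sum_subtractf[symmetric] algebra_simps)
  moreover have "Im (F \<zeta> \<zeta>) = 0" for \<zeta> using assms by (simp add: F_def)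
  ultimately have "Im (F q q + \<i> * F s q - \<i> * F q s + F s s) = 0" by metis
  then have "Re (F s q) = Re (F q s)" using \<open>\<And>\<zeta>. Im (F \<zeta> \<zeta>) = 0\<close> by simp
  then show ?thesis by (simp add: Re)
qed

lemma abs_inner_mult_le:
  assumes "cmod m \<le> N" shows "\<bar>(m * x) \<bullet> y\<bar> \<le> N * (cmod x * cmod y)"
proof -
  have "\<bar>(m * x) \<bullet> y\<bar> \<le> cmod (m * x) * cmod y" by (rule Cauchy_Schwarz_ineq2)
  also have "\<dots> = cmod m * (cmod x * cmod y)" by (simp add: norm_mult)
  also have "\<dots> \<le> N * (cmod x * cmod y)" using assms by (intro mult_right_mono) auto
  finally show ?thesis .
qed

lemma young: "\<delta> > 0 \<Longrightarrow> x * y \<le> \<delta> * x\<^sup>2 + y\<^sup>2 / (4 * \<delta>)" for x y \<delta> :: real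
proof -
  assume \<delta>: "\<delta> > 0"
  have "0 \<le> (2 * \<delta> * x - y)\<^sup>2 / (4 * \<delta>)" using \<delta> by simp
  also have "\<dots> = \<delta> * x\<^sup>2 + y\<^sup>2 / (4 * \<delta>) - x * y"
    using \<delta> by (simp add: power2_eq_square field_simps)
  finally show ?thesis by simp
qed

lemma sum_neg_affine: "(\<Sum>j\<in>I. - (k * F j + c)) = - (k * (\<Sum>j\<in>I. F j) + real (card I) * c)" for k c :: real
  by (simp only: sum_negf sum.distrib sum_distrib_left sum_constant)

text \<open>Young's inequality with parameter \<open>lam / 4\<close> in each of \<open>n\<close>
  directions lets the doubled cross term use up half of the ellipticity and
  \<open>2 * n * N\<^sup>2 / lam\<close> times \<open>(cmod p)\<^sup>2\<close>; the summand
  \<open>1\<close> is what remains of the zero order term.\<close>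

definition energy_kappa :: "nat \<Rightarrow> real \<Rightarrow> real \<Rightarrow> real" where
  "energy_kappa n N lam = 2 * real n * N\<^sup>2 / lam + 1"

text \<open>The smallest of the three coefficients left for \<open>r\<close>, \<open>q\<close> and
  \<open>p\<close> once the cross term has been absorbed.\<close>

definition energy_c0 :: "real \<Rightarrow> real \<Rightarrow> real" where
  "energy_c0 N lam = min (1 / N) (min (lam / 2) 1)"

text \<open>The first summand collects the Young terms of \<open>Aj0\<close> and \<open>A0\<close>,
  the second bounds \<open>A00\<close>, the third bounds the factor \<open>1 / ai\<close> of the
  time derivative.\<close>

definition energy_c1 :: "nat \<Rightarrow> real \<Rightarrow> real \<Rightarrow> real" where
  "energy_c1 n N lam = 2 * real n * N\<^sup>2 / lam + N + 1 / lam"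

text \<open>In this order: the terms with \<open>Aj0\<close>, with the zero order weight, and with
  \<open>A00\<close> and \<open>A0\<close> that survive in the energy rate when \<eta> is not
  differentiated.\<close>

definition energy_M :: "nat \<Rightarrow> real \<Rightarrow> real \<Rightarrow> real" where
  "energy_M n N lam = 2 * real n * N + 2 * energy_kappa n N lam + 2 * (N + real n * N)"

text \<open>A derivative falls on the weight in each of \<open>n\<close> directions and meets a flux
  made of \<open>n\<close> terms \<open>A j k * q k\<close> and one term \<open>Aj0 j * p\<close>;
  the factor \<open>2\<close> comes from subtracting twice the weak form.\<close>

definition energy_speed :: "nat \<Rightarrow> real \<Rightarrow> real" where
  "energy_speed n N = 2 * real n * (real n * N + N)"

text \<open>At a point, \<open>r\<close>, \<open>q\<close> and \<open>p\<close> stand for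
  \<open>u'\<close>, the gradient of \<open>u\<close>, and \<open>u\<close>; \<open>ai\<close> is
  the value of \<open>a\<close>.\<close>

definition energy_density ::
  "'i set \<Rightarrow> ('i \<Rightarrow> 'i \<Rightarrow> complex) \<Rightarrow> ('i \<Rightarrow> complex) \<Rightarrow> real \<Rightarrow> real \<Rightarrow> complex \<Rightarrow> ('i \<Rightarrow> complex) \<Rightarrow> complex \<Rightarrow> real" where
  "energy_density I A Aj0 ai \<kappa> r q p = (1 / ai) * (r \<bullet> r) + (\<Sum>j\<in>I. \<Sum>k\<in>I. (A j k * q k) \<bullet> q j)
     + 2 * (\<Sum>j\<in>I. (Aj0 j * p) \<bullet> q j) + \<kappa> * (p \<bullet> p)"

text \<open>The formal time derivative of \<eta> times the density, with \<open>w\<close> for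
  \<open>u''\<close> and \<open>s\<close> for the gradient of \<open>u'\<close>.\<close>

definition energy_rate ::
  "'i set \<Rightarrow> ('i \<Rightarrow> 'i \<Rightarrow> complex) \<Rightarrow> ('i \<Rightarrow> complex) \<Rightarrow> real \<Rightarrow> real \<Rightarrow> real \<Rightarrow> complex \<Rightarrow> ('i \<Rightarrow> complex) \<Rightarrow>
    complex \<Rightarrow> complex \<Rightarrow> ('i \<Rightarrow> complex) \<Rightarrow> real" where
  "energy_rate I A Aj0 ai \<kappa> \<eta> p q w r s = \<eta> * ((1 / ai) * (r \<bullet> w + w \<bullet> r)
     + (\<Sum>j\<in>I. \<Sum>k\<in>I. (A j k * q k) \<bullet> s j + (A j k * s k) \<bullet> q j)
     + 2 * (\<Sum>j\<in>I. (Aj0 j * p) \<bullet> s j + (Aj0 j * r) \<bullet> q j) + \<kappa> * (p \<bullet> r + r \<bullet> p))"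

text \<open>The integrand of the equation \<open>u'' = - L u\<close>, divided by \<open>a\<close>
  and tested with \<eta> times a function \<open>r\<close> of gradient \<open>s\<close>;
  \<open>d\<close> is the gradient of \<eta>, and the product rule is built in.\<close>

definition weak_form ::
  "'i set \<Rightarrow> ('i \<Rightarrow> 'i \<Rightarrow> complex) \<Rightarrow> ('i \<Rightarrow> complex) \<Rightarrow> ('i \<Rightarrow> complex) \<Rightarrow> complex \<Rightarrow> real \<Rightarrow> real \<Rightarrow> ('i \<Rightarrow> real) \<Rightarrow>
    complex \<Rightarrow> ('i \<Rightarrow> complex) \<Rightarrow> complex \<Rightarrow> complex \<Rightarrow> ('i \<Rightarrow> complex) \<Rightarrow> real" where
  "weak_form I A A0 Aj0 A00 ai \<eta> d p q w r s =
     (\<Sum>j\<in>I. ((\<Sum>k\<in>I. A j k * q k) + Aj0 j * p) \<bullet> (of_real \<eta> * s j + of_real (d j) * r))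
     + (A00 * p + (\<Sum>k\<in>I. A0 k * q k) + of_real (1 / ai) * w) \<bullet> (of_real \<eta> * r)"

locale pointwise =
  fixes I :: "'i set" and A :: "'i \<Rightarrow> 'i \<Rightarrow> complex" and A0 Aj0 :: "'i \<Rightarrow> complex" and A00 :: complex
    and ai lam N :: real
  assumes fin: "finite I" and lam: "lam > 0" and ai: "lam \<le> ai" "ai \<le> N" and N: "N \<ge> 1"
    and bA: "\<And>j k. j \<in> I \<Longrightarrow> k \<in> I \<Longrightarrow> cmod (A j k) \<le> N"
    and bA0: "\<And>k. k \<in> I \<Longrightarrow> cmod (A0 k) \<le> N" and bAj0: "\<And>j. j \<in> I \<Longrightarrow> cmod (Aj0 j) \<le> N"
    and bA00: "cmod A00 \<le> N"
    and herm: "\<And>\<zeta>. Im (\<Sum>j\<in>I. \<Sum>k\<in>I. A j k * \<zeta> k * cnj (\<zeta> j)) = 0"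
    and ell: "\<And>\<zeta>. Re (\<Sum>j\<in>I. \<Sum>k\<in>I. A j k * \<zeta> k * cnj (\<zeta> j)) \<ge> lam * (\<Sum>j\<in>I. (cmod (\<zeta> j))\<^sup>2)"
begin

lemma ell': "lam * (\<Sum>j\<in>I. (cmod (q j))\<^sup>2) \<le> (\<Sum>j\<in>I. \<Sum>k\<in>I. (A j k * q k) \<bullet> q j)"
  using ell[of q] by (simp add: inner_complex_def)

abbreviation "\<kappa> \<equiv> energy_kappa (card I) N lam"
abbreviation "c0 \<equiv> energy_c0 N lam"
definition X where "X r q p = (cmod r)\<^sup>2 + (\<Sum>j\<in>I. (cmod (q j))\<^sup>2) + (cmod p)\<^sup>2"

abbreviation "dens \<equiv> energy_density I A Aj0 ai \<kappa>"

lemma c0_pos: "c0 > 0"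
  using lam N by (simp add: energy_c0_def)

lemma dens_lower: "c0 * X r q p \<le> dens r q p"
proof -
  have "(Aj0 j * p) \<bullet> q j \<ge> - (lam / 4 * (cmod (q j))\<^sup>2 + N\<^sup>2 / lam * (cmod p)\<^sup>2)" if "j \<in> I" for j
  proof -
    have "\<bar>(Aj0 j * p) \<bullet> q j\<bar> \<le> cmod (q j) * (N * cmod p)"
      using abs_inner_mult_le[OF bAj0[OF that], of p "q j"] by (simp add: mult_ac)
    also have "\<dots> \<le> lam / 4 * (cmod (q j))\<^sup>2 + (N * cmod p)\<^sup>2 / (4 * (lam / 4))"
      using lam by (intro young) simp
    also have "(N * cmod p)\<^sup>2 / (4 * (lam / 4)) = N\<^sup>2 / lam * (cmod p)\<^sup>2" by (simp add: power_mult_distrib)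
    finally show ?thesis by linarith
  qed
  then have "(\<Sum>j\<in>I. (Aj0 j * p) \<bullet> q j) \<ge> (\<Sum>j\<in>I. - (lam / 4 * (cmod (q j))\<^sup>2 + N\<^sup>2 / lam * (cmod p)\<^sup>2))"
    by (rule sum_mono)
  then have 1: "2 * (\<Sum>j\<in>I. (Aj0 j * p) \<bullet> q j) \<ge> - (lam / 2 * (\<Sum>j\<in>I. (cmod (q j))\<^sup>2)) - (\<kappa> - 1) * (cmod p)\<^sup>2"
    unfolding sum_neg_affine by (simp add: energy_kappa_def algebra_simps)
  have 2: "(1 / N) * (cmod r)\<^sup>2 \<le> (1 / ai) * (r \<bullet> r)"
    using ai lam by (auto simp: power2_norm_eq_inner frac_le intro!: mult_right_mono)
  have c: "c0 \<le> 1 / N" "c0 \<le> lam / 2" "c0 \<le> 1" by (auto simp: energy_c0_def)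
  have 3: "c0 * (cmod r)\<^sup>2 \<le> (1 / N) * (cmod r)\<^sup>2" "c0 * (cmod p)\<^sup>2 \<le> (cmod p)\<^sup>2"
    "c0 * (\<Sum>j\<in>I. (cmod (q j))\<^sup>2) \<le> lam / 2 * (\<Sum>j\<in>I. (cmod (q j))\<^sup>2)"
    using mult_right_mono[OF c(1), of "(cmod r)\<^sup>2"] mult_right_mono[OF c(3), of "(cmod p)\<^sup>2"]
      mult_right_mono[OF c(2), of "\<Sum>j\<in>I. (cmod (q j))\<^sup>2"] by (simp_all add: sum_nonneg)
  have "dens r q p \<ge> (1 / N) * (cmod r)\<^sup>2 + lam * (\<Sum>j\<in>I. (cmod (q j))\<^sup>2)
      - lam / 2 * (\<Sum>j\<in>I. (cmod (q j))\<^sup>2) - (\<kappa> - 1) * (cmod p)\<^sup>2 + \<kappa> * (cmod p)\<^sup>2"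
    unfolding energy_density_def using 1 2 ell'[of q] by (simp only: power2_norm_eq_inner)
  then show ?thesis using 3 unfolding X_def by (simp add: algebra_simps)
qed

lemma X_nonneg: "X r q p \<ge> 0"
  by (simp add: X_def sum_nonneg)

lemma prod_le_X: "cmod r * cmod p \<le> X r q p" "j \<in> I \<Longrightarrow> cmod r * cmod (q j) \<le> X r q p"
proof -
  have s: "0 \<le> (\<Sum>j\<in>I. (cmod (q j))\<^sup>2)" by (simp add: sum_nonneg)
  have le: "x * y \<le> x\<^sup>2 + y\<^sup>2" for x y :: real
  proof -
    have "0 \<le> (x - y)\<^sup>2" "0 \<le> x\<^sup>2" "0 \<le> y\<^sup>2" by auto
    then show ?thesis unfolding power2_diff by linarith
  qed
  show "cmod r * cmod p \<le> X r q p" using le[of "cmod r" "cmod p"] s unfolding X_def by linarith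
  assume j: "j \<in> I"
  have "(cmod (q j))\<^sup>2 \<le> (\<Sum>j\<in>I. (cmod (q j))\<^sup>2)" by (rule member_le_sum[OF j]) (auto simp: fin)
  then show "cmod r * cmod (q j) \<le> X r q p"
    using le[of "cmod r" "cmod (q j)"] zero_le_power2[of "cmod p"] unfolding X_def by linarith
qed

abbreviation "\<Phi> \<equiv> weak_form I A A0 Aj0 A00 ai"
abbreviation "\<Psi> \<equiv> energy_rate I A Aj0 ai \<kappa>"
abbreviation "M \<equiv> energy_M (card I) N lam"
abbreviation "\<alpha> \<equiv> energy_speed (card I) N"

text \<open>All terms with \<open>s\<close> and \<open>w\<close> cancel, and these are exactly the
  quantities that the energy does not control: the principal part by Hermitian symmetry, the terms
  \<open>Aj0 j * p\<close> against the derivative of the cross term, \<open>w\<close> against the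
  kinetic term.\<close>

lemma \<Psi>_\<Phi>_identity:
  "\<Psi> \<eta> p q w r s - 2 * \<Phi> \<eta> d p q w r s =
     2 * \<eta> * (\<Sum>j\<in>I. (Aj0 j * r) \<bullet> q j) + 2 * \<kappa> * \<eta> * (p \<bullet> r)
     - 2 * (\<Sum>j\<in>I. d j * ((\<Sum>k\<in>I. (A j k * q k) \<bullet> r) + (Aj0 j * p) \<bullet> r))
     - 2 * \<eta> * ((A00 * p) \<bullet> r + (\<Sum>k\<in>I. (A0 k * q k) \<bullet> r))"
proof -
  have "(\<Sum>j\<in>I. \<Sum>k\<in>I. (A j k * s k) \<bullet> q j) = (\<Sum>j\<in>I. \<Sum>k\<in>I. (A j k * q k) \<bullet> s j)"
    by (rule hermitian_form_symmetric[OF herm])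
  moreover have "((\<Sum>k\<in>I. A j k * q k) + Aj0 j * p) \<bullet> (of_real \<eta> * s j + of_real (d j) * r) =
      \<eta> * (\<Sum>k\<in>I. (A j k * q k) \<bullet> s j) + \<eta> * ((Aj0 j * p) \<bullet> s j) + d j * ((\<Sum>k\<in>I. (A j k * q k) \<bullet> r) + (Aj0 j * p) \<bullet> r)" for j
    by (simp add: inner_add_left inner_add_right inner_sum_left inner_of_real_mult distrib_left)
  then have "\<Phi> \<eta> d p q w r s = \<eta> * (\<Sum>j\<in>I. \<Sum>k\<in>I. (A j k * q k) \<bullet> s j) + \<eta> * (\<Sum>j\<in>I. (Aj0 j * p) \<bullet> s j)
      + (\<Sum>j\<in>I. d j * ((\<Sum>k\<in>I. (A j k * q k) \<bullet> r) + (Aj0 j * p) \<bullet> r))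
      + \<eta> * ((A00 * p) \<bullet> r + (\<Sum>k\<in>I. (A0 k * q k) \<bullet> r) + (1 / ai) * (w \<bullet> r))"
    unfolding weak_form_def inner_of_real_mult inner_add_left inner_sum_left
    by (simp only: sum.distrib sum_distrib_left)
  ultimately show ?thesis
    unfolding energy_rate_def sum.distrib by (simp add: inner_commute[of r] distrib_left right_diff_distrib)
qed

text \<open>Each surviving term pairs \<open>r\<close> with one of \<open>p\<close>,
  \<open>q\<close>, \<open>r\<close>-free factors up to a coefficient, hence is at most a multiple
  of \<open>X\<close>. The parameter \<rho> enters through \<open>d\<close> alone, so the constant
  is affine in \<rho>; dividing by \<open>c0\<close> exchanges \<open>X\<close> for the
  density.\<close>

lemma \<Psi>_\<Phi>_bound:
  assumes \<eta>: "\<eta> > 0" and \<rho>: "\<rho> \<ge> 0" and d: "\<And>j. j \<in> I \<Longrightarrow> \<bar>d j\<bar> \<le> \<rho> * \<eta>"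
  shows "\<Psi> \<eta> p q w r s - 2 * \<Phi> \<eta> d p q w r s \<le> (M + \<rho> * \<alpha>) / c0 * (\<eta> * dens r q p)"
proof -
  let ?X = "X r q p"
  have N0: "N \<ge> 0" using N by simp
  have k0: "\<kappa> \<ge> 0" using lam by (simp add: energy_kappa_def)
  have NX: "N * ?X \<ge> 0" using N0 X_nonneg by simp
  have t1: "(\<Sum>j\<in>I. (Aj0 j * r) \<bullet> q j) \<le> real (card I) * (N * ?X)"
  proof (rule sum_bounded_above)
    fix j assume j: "j \<in> I"
    show "(Aj0 j * r) \<bullet> q j \<le> N * ?X"
      using abs_inner_mult_le[OF bAj0[OF j], of r "q j"] mult_left_mono[OF prod_le_X(2)[OF j, of r q p] N0] by linarith
  qed
  have t2: "p \<bullet> r \<le> ?X"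
    using Cauchy_Schwarz_ineq2[of p r] prod_le_X(1)[of r p q] by (simp add: mult.commute)
  have t4a: "\<bar>(m * p) \<bullet> r\<bar> \<le> N * ?X" if "cmod m \<le> N" for m
    using abs_inner_mult_le[OF that, of p r] mult_left_mono[OF prod_le_X(1)[of r p q] N0] by (simp add: mult.commute)
  have t4b: "\<bar>(m * q k) \<bullet> r\<bar> \<le> N * ?X" if "cmod m \<le> N" "k \<in> I" for m k
    using abs_inner_mult_le[OF that(1), of "q k" r] mult_left_mono[OF prod_le_X(2)[OF that(2), of r q p] N0] by (simp add: mult.commute)
  have t4c: "\<bar>\<Sum>k\<in>I. (m k * q k) \<bullet> r\<bar> \<le> real (card I) * (N * ?X)" if "\<And>k. k \<in> I \<Longrightarrow> cmod (m k) \<le> N" for m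
    by (rule order_trans[OF sum_abs], rule sum_bounded_above) (use t4b that in auto)
  have t3: "- (\<Sum>j\<in>I. d j * ((\<Sum>k\<in>I. (A j k * q k) \<bullet> r) + (Aj0 j * p) \<bullet> r)) \<le> real (card I) * (\<rho> * \<eta> * (real (card I) * (N * ?X) + N * ?X))"
    unfolding sum_negf[symmetric]
  proof (rule sum_bounded_above)
    fix j assume j: "j \<in> I"
    have "\<bar>(\<Sum>k\<in>I. (A j k * q k) \<bullet> r) + (Aj0 j * p) \<bullet> r\<bar> \<le> real (card I) * (N * ?X) + N * ?X"
      using t4c[of "A j", OF bA[OF j]] t4a[OF bAj0[OF j]] by linarith
    then have "\<bar>d j * ((\<Sum>k\<in>I. (A j k * q k) \<bullet> r) + (Aj0 j * p) \<bullet> r)\<bar> \<le> \<rho> * \<eta> * (real (card I) * (N * ?X) + N * ?X)"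
      unfolding abs_mult using d[OF j] \<rho> \<eta> by (intro mult_mono) auto
    then show "- (d j * ((\<Sum>k\<in>I. (A j k * q k) \<bullet> r) + (Aj0 j * p) \<bullet> r)) \<le> \<rho> * \<eta> * (real (card I) * (N * ?X) + N * ?X)"
      by linarith
  qed
  have t4: "- ((A00 * p) \<bullet> r + (\<Sum>k\<in>I. (A0 k * q k) \<bullet> r)) \<le> N * ?X + real (card I) * (N * ?X)"
    using t4a[OF bA00] t4c[of A0, OF bA0] by linarith
  have "\<Psi> \<eta> p q w r s - 2 * \<Phi> \<eta> d p q w r s \<le> 2 * \<eta> * (real (card I) * (N * ?X)) + 2 * \<kappa> * \<eta> * ?X
      + 2 * (real (card I) * (\<rho> * \<eta> * (real (card I) * (N * ?X) + N * ?X))) + 2 * \<eta> * (N * ?X + real (card I) * (N * ?X))"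
  proof -
    have "2 * \<eta> * (\<Sum>j\<in>I. (Aj0 j * r) \<bullet> q j) \<le> 2 * \<eta> * (real (card I) * (N * ?X))"
      using \<eta> by (intro mult_left_mono t1) simp
    moreover have "2 * \<kappa> * \<eta> * (p \<bullet> r) \<le> 2 * \<kappa> * \<eta> * ?X"
      using \<eta> k0 by (intro mult_left_mono t2) simp
    moreover have "2 * \<eta> * (- ((A00 * p) \<bullet> r + (\<Sum>k\<in>I. (A0 k * q k) \<bullet> r))) \<le> 2 * \<eta> * (N * ?X + real (card I) * (N * ?X))"
      using \<eta> by (intro mult_left_mono t4) simp
    then have "- (2 * \<eta> * ((A00 * p) \<bullet> r + (\<Sum>k\<in>I. (A0 k * q k) \<bullet> r))) \<le> 2 * \<eta> * (N * ?X + real (card I) * (N * ?X))"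
      by (simp only: mult_minus_right)
    ultimately show ?thesis
      unfolding \<Psi>_\<Phi>_identity using t3 by linarith
  qed
  also have "\<dots> = (M + \<rho> * \<alpha>) * (\<eta> * ?X)"
    by (simp add: energy_M_def energy_speed_def algebra_simps)
  also have "\<dots> = (M + \<rho> * \<alpha>) / c0 * (\<eta> * (c0 * ?X))"
    using c0_pos by simp
  also have "\<dots> \<le> (M + \<rho> * \<alpha>) / c0 * (\<eta> * dens r q p)"
    using \<eta> \<rho> N0 k0 c0_pos dens_lower[of r q p]
    by (intro mult_left_mono) (auto simp: energy_M_def energy_speed_def)
  finally show ?thesis .
qed

abbreviation "c1 \<equiv> energy_c1 (card I) N lam"

text \<open>A pointwise Garding inequality: the solution itself is the test function and the weight
  is constant. Of the ellipticity, one quarter each is spent on the terms with \<open>Aj0\<close>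
  and \<open>A0\<close>.\<close>

lemma \<Phi>_coercive:
  "\<Phi> 1 (\<lambda>_. 0) p q w p q \<ge> lam / 2 * (\<Sum>j\<in>I. (cmod (q j))\<^sup>2) - c1 * ((cmod p)\<^sup>2 + (cmod w)\<^sup>2)"
proof -
  have y: "N * (cmod (q j) * cmod p) \<le> lam / 4 * (cmod (q j))\<^sup>2 + N\<^sup>2 / lam * (cmod p)\<^sup>2" for j
    using young[of "lam / 4" "cmod (q j)" "N * cmod p"] lam by (simp add: power_mult_distrib mult_ac)
  have sum_lower: "(\<Sum>j\<in>I. F j) \<ge> - (lam / 4 * (\<Sum>j\<in>I. (cmod (q j))\<^sup>2) + real (card I) * (N\<^sup>2 / lam * (cmod p)\<^sup>2))"
    if F: "\<And>j. j \<in> I \<Longrightarrow> \<bar>F j\<bar> \<le> N * (cmod (q j) * cmod p)" for F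
  proof -
    have "(\<Sum>j\<in>I. F j) \<ge> (\<Sum>j\<in>I. - (lam / 4 * (cmod (q j))\<^sup>2 + N\<^sup>2 / lam * (cmod p)\<^sup>2))"
    proof (rule sum_mono)
      fix j assume "j \<in> I"
      from F[OF this] y[of j] show "- (lam / 4 * (cmod (q j))\<^sup>2 + N\<^sup>2 / lam * (cmod p)\<^sup>2) \<le> F j" by linarith
    qed
    then show ?thesis unfolding sum_neg_affine .
  qed
  have 1: "(\<Sum>j\<in>I. (Aj0 j * p) \<bullet> q j) \<ge> - (lam / 4 * (\<Sum>j\<in>I. (cmod (q j))\<^sup>2) + real (card I) * (N\<^sup>2 / lam * (cmod p)\<^sup>2))"
  proof (rule sum_lower)
    fix j assume "j \<in> I"
    from abs_inner_mult_le[OF bAj0[OF this], of p "q j"]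
    show "\<bar>(Aj0 j * p) \<bullet> q j\<bar> \<le> N * (cmod (q j) * cmod p)" by (simp only: mult.commute[of "cmod p"])
  qed
  have 2: "(\<Sum>j\<in>I. (A0 j * q j) \<bullet> p) \<ge> - (lam / 4 * (\<Sum>j\<in>I. (cmod (q j))\<^sup>2) + real (card I) * (N\<^sup>2 / lam * (cmod p)\<^sup>2))"
    by (rule sum_lower) (use abs_inner_mult_le[OF bA0] in simp)
  have 3: "(A00 * p) \<bullet> p \<ge> - (N * (cmod p)\<^sup>2)"
    using abs_inner_mult_le[OF bA00, of p p] by (simp add: power2_eq_square)
  have "\<bar>(of_real (1 / ai) * w) \<bullet> p\<bar> \<le> (1 / lam) * (cmod w * cmod p)"
    using ai lam by (intro abs_inner_mult_le) (simp add: norm_divide frac_le)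
  also have "\<dots> \<le> (1 / lam) * ((cmod p)\<^sup>2 + (cmod w)\<^sup>2)"
  proof (intro mult_left_mono)
    have "0 \<le> (cmod w - cmod p)\<^sup>2" "0 \<le> (cmod p)\<^sup>2" "0 \<le> (cmod w)\<^sup>2" by auto
    then show "cmod w * cmod p \<le> (cmod p)\<^sup>2 + (cmod w)\<^sup>2" unfolding power2_diff by linarith
  qed (use lam in auto)
  finally have 4: "(of_real (1 / ai) * w) \<bullet> p \<ge> - ((1 / lam) * ((cmod p)\<^sup>2 + (cmod w)\<^sup>2))" by linarith
  have eq: "\<Phi> 1 (\<lambda>_. 0) p q w p q = (\<Sum>j\<in>I. \<Sum>k\<in>I. (A j k * q k) \<bullet> q j) + (\<Sum>j\<in>I. (Aj0 j * p) \<bullet> q j)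
      + (A00 * p) \<bullet> p + (\<Sum>j\<in>I. (A0 j * q j) \<bullet> p) + (of_real (1 / ai) * w) \<bullet> p"
    unfolding weak_form_def by (simp add: inner_add_left inner_sum_left sum.distrib)
  have "c1 * ((cmod p)\<^sup>2 + (cmod w)\<^sup>2) \<ge> 2 * (real (card I) * (N\<^sup>2 / lam * (cmod p)\<^sup>2)) + N * (cmod p)\<^sup>2 + (1 / lam) * ((cmod p)\<^sup>2 + (cmod w)\<^sup>2)"
  proof -
    have "c1 * ((cmod p)\<^sup>2 + (cmod w)\<^sup>2) = 2 * (real (card I) * (N\<^sup>2 / lam * (cmod p)\<^sup>2)) + N * (cmod p)\<^sup>2 + (1 / lam) * ((cmod p)\<^sup>2 + (cmod w)\<^sup>2)
        + (2 * (real (card I) * (N\<^sup>2 / lam * (cmod w)\<^sup>2)) + N * (cmod w)\<^sup>2)"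
      by (simp add: energy_c1_def algebra_simps add_divide_distrib)
    moreover have "2 * (real (card I) * (N\<^sup>2 / lam * (cmod w)\<^sup>2)) + N * (cmod w)\<^sup>2 \<ge> 0"
      using lam N by simp
    ultimately show ?thesis by linarith
  qed
  then show ?thesis using 1 2 3 4 ell'[of q] unfolding eq by linarith
qed

end

section \<open>The wave equation\<close>

lemma V_W12: "admissible_V \<Omega> V \<Longrightarrow> f \<in> V \<Longrightarrow> W12 \<Omega> f"
  unfolding admissible_V_def by blast

locale wave =
  fixes \<Omega> :: "'n::euclidean_space set"
    and V :: "('n \<Rightarrow> complex) set"
    and a :: "'n \<Rightarrow> real"
    and A00 :: "'n \<Rightarrow> complex" and A0 :: "'n \<Rightarrow> 'n \<Rightarrow> complex"
    and Aj0 :: "'n \<Rightarrow> 'n \<Rightarrow> complex" and A :: "'n \<Rightarrow> 'n \<Rightarrow> 'n \<Rightarrow> complex"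
    and lam :: real
    and C :: "real \<Rightarrow> ('n \<Rightarrow> complex) \<Rightarrow> ('n \<Rightarrow> complex)"
  assumes open_\<Omega>: "open \<Omega>"
    and V: "admissible_V \<Omega> V"
    and a: "Linfty \<Omega> a" and A00: "Linfty \<Omega> A00"
    and A0: "\<forall>k\<in>Basis. Linfty \<Omega> (A0 k)" and Aj0: "\<forall>j\<in>Basis. Linfty \<Omega> (Aj0 j)"
    and A: "\<forall>j\<in>Basis. \<forall>k\<in>Basis. Linfty \<Omega> (A j k)"
    and lam: "lam > 0"
    and a_lam: "AE x in lebesgue_on \<Omega>. a x \<ge> lam"
    and ell: "AE x in lebesgue_on \<Omega>. \<forall>\<zeta> :: 'n \<Rightarrow> complex.
           Im (\<Sum>j\<in>Basis. \<Sum>k\<in>Basis. A j k x * \<zeta> k * cnj (\<zeta> j)) = 0 \<and>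
           Re (\<Sum>j\<in>Basis. \<Sum>k\<in>Basis. A j k x * \<zeta> k * cnj (\<zeta> j))
             \<ge> lam * (\<Sum>j\<in>Basis. (cmod (\<zeta> j))\<^sup>2)"
    and C: "cosine_family_gen \<Omega> C (\<lambda>u w. L_op \<Omega> V a A00 A0 Aj0 A u (\<lambda>x. - w x))"
begin

abbreviation "\<mu> \<equiv> lebesgue_on \<Omega>"

lemma \<Omega> [measurable, simp]: "\<Omega> \<in> sets lebesgue"
  using open_\<Omega> by simp

lemma
  shows C_L2: "L2 \<mu> f \<Longrightarrow> L2 \<mu> (C t f)"
    and C_cong: "L2 \<mu> f \<Longrightarrow> L2 \<mu> g \<Longrightarrow> AE x in \<mu>. f x = g x \<Longrightarrow>
      AE x in \<mu>. C t f x = C t g x"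
    and C_lin: "L2 \<mu> f \<Longrightarrow> L2 \<mu> g \<Longrightarrow>
      AE x in \<mu>. C t (\<lambda>x. c * f x + g x) x = c * C t f x + C t g x"
    and C_bound: "\<exists>M. \<forall>f. L2 \<mu> f \<longrightarrow> l2norm \<Omega> (C t f) \<le> M * l2norm \<Omega> f"
    and C_0: "L2 \<mu> f \<Longrightarrow> AE x in \<mu>. C 0 f x = f x"
    and C_add: "L2 \<mu> f \<Longrightarrow> AE x in \<mu>. C (t + s) f x + C (t - s) f x = 2 * C t (C s f) x"
    and C_cont: "L2 \<mu> f \<Longrightarrow> ((\<lambda>s. l2norm \<Omega> (\<lambda>x. C s f x - C t f x)) \<longlongrightarrow> 0) (at t)"
    and C_gen: "L2 \<mu> u \<Longrightarrow> L2 \<mu> w \<Longrightarrow>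
      ((\<lambda>s. l2norm \<Omega> (\<lambda>x. of_real (2 / s\<^sup>2) * (C s u x - u x) - w x)) \<longlongrightarrow> 0) (at 0) \<Longrightarrow>
      L_op \<Omega> V a A00 A0 Aj0 A u (\<lambda>x. - w x)"
  using C[unfolded cosine_family_gen_def sq_int_L2 aeeq_def] by (elim conjE, blast)+

section \<open>Transport of the cosine family to the Hilbert space\<close>

definition lift :: "(('n \<Rightarrow> complex) \<Rightarrow> ('n \<Rightarrow> complex)) \<Rightarrow> 'n l2 \<Rightarrow> 'n l2" where
  "lift F \<xi> = cls_on \<Omega> (F (rep \<xi>))"

definition liftable :: "(('n \<Rightarrow> complex) \<Rightarrow> ('n \<Rightarrow> complex)) \<Rightarrow> bool" where
  "liftable F \<longleftrightarrow> (\<forall>f. L2 \<mu> f \<longrightarrow> L2 \<mu> (F f)) \<and>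
     (\<forall>f g. L2 \<mu> f \<and> L2 \<mu> g \<and> (AE x in \<mu>. f x = g x) \<longrightarrow>
       (AE x in \<mu>. F f x = F g x)) \<and>
     (\<forall>f g c. L2 \<mu> f \<and> L2 \<mu> g \<longrightarrow>
       (AE x in \<mu>. F (\<lambda>x. c * f x + g x) x = c * F f x + F g x)) \<and>
     (\<exists>M. \<forall>f. L2 \<mu> f \<longrightarrow> l2norm \<Omega> (F f) \<le> M * l2norm \<Omega> f)"

lemma liftable_C: "liftable (C t)"
  unfolding liftable_def using C_L2 C_cong C_lin C_bound by blast

lemma liftable_id: "liftable (\<lambda>f. f)"
  unfolding liftable_def by (auto intro: exI[of _ 1])

lemma rep_lift: "liftable F \<Longrightarrow> AE x in \<mu>. rep (lift F \<xi>) x = F (rep \<xi>) x"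
  unfolding lift_def liftable_def by (intro rep_cls_on) auto

lemma lift_cong:
  assumes "liftable F" "AE x in \<mu>. rep \<xi> x = f x" "L2 \<mu> f"
  shows "lift F \<xi> = cls_on \<Omega> (F f)"
  unfolding lift_def
  by (rule cls_on_cong) (use assms in \<open>auto simp: liftable_def\<close>)

lemma bounded_linear_lift:
  assumes F: "liftable F" shows "bounded_linear (lift F)"
proof -
  have FL: "L2 \<mu> (F f)" if "L2 \<mu> f" for f
    using F that by (auto simp: liftable_def)
  obtain M where M: "\<And>f. L2 \<mu> f \<Longrightarrow> l2norm \<Omega> (F f) \<le> M * l2norm \<Omega> f"
    using F by (auto simp: liftable_def)
  have lin: "lift F (c *\<^sub>R \<xi> + \<zeta>) = c *\<^sub>R lift F \<xi> + lift F \<zeta>" for c \<xi> \<zeta>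
  proof -
    have L: "L2 \<mu> (\<lambda>x. of_real c * rep \<xi> x + rep \<zeta> x)"
      by (intro L2_add L2_cmult L2_lebesgue_on_rep \<Omega>)
    have "AE x in lebesgue. rep (c *\<^sub>R \<xi> + \<zeta>) x = of_real c * rep \<xi> x + rep \<zeta> x"
      using rep_plus[of "c *\<^sub>R \<xi>" \<zeta>] rep_scaleR[of c \<xi>] by eventually_elim (simp add: scaleR_conv_of_real)
    from lift_cong[OF F AE_lebesgue_on[OF \<Omega> this] L]
    have "lift F (c *\<^sub>R \<xi> + \<zeta>) = cls_on \<Omega> (F (\<lambda>x. of_real c * rep \<xi> x + rep \<zeta> x))" .
    also have "\<dots> = cls_on \<Omega> (\<lambda>x. c *\<^sub>R F (rep \<xi>) x + F (rep \<zeta>) x)"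
    proof (rule cls_on_cong[OF \<Omega> _ FL[OF L]])
      have "AE x in \<mu>. F (\<lambda>x. of_real c * rep \<xi> x + rep \<zeta> x) x = of_real c * F (rep \<xi>) x + F (rep \<zeta>) x"
        using F L2_lebesgue_on_rep[OF \<Omega>] unfolding liftable_def by blast
      then show "AE x in \<mu>. F (\<lambda>x. of_real c * rep \<xi> x + rep \<zeta> x) x = c *\<^sub>R F (rep \<xi>) x + F (rep \<zeta>) x"
        by (simp add: scaleR_conv_of_real)
    qed (intro L2_add L2_scaleR FL L2_lebesgue_on_rep \<Omega>)
    also have "\<dots> = c *\<^sub>R lift F \<xi> + lift F \<zeta>"
      unfolding lift_def by (intro cls_on_lincomb \<Omega> FL L2_lebesgue_on_rep)
    finally show ?thesis .
  qed
  have zero: "lift F 0 = 0" using lin[of "-1" 0 0] by simp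
  show ?thesis
  proof (rule bounded_linear_intro)
    show "lift F (\<xi> + \<zeta>) = lift F \<xi> + lift F \<zeta>" for \<xi> \<zeta> using lin[of 1 \<xi> \<zeta>] by simp
    show "lift F (r *\<^sub>R \<xi>) = r *\<^sub>R lift F \<xi>" for r \<xi> using lin[of r \<xi> 0] zero by simp
    show "norm (lift F \<xi>) \<le> norm \<xi> * \<bar>M\<bar>" for \<xi>
    proof -
      have "norm (lift F \<xi>) = l2norm \<Omega> (F (rep \<xi>))"
        unfolding lift_def by (intro norm_cls_on \<Omega> FL L2_lebesgue_on_rep)
      also have "\<dots> \<le> M * l2norm \<Omega> (rep \<xi>)" by (intro M L2_lebesgue_on_rep \<Omega>)
      also have "\<dots> \<le> \<bar>M\<bar> * l2norm \<Omega> (rep \<xi>)"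
        by (intro mult_right_mono) (auto simp: l2norm_def)
      also have "\<dots> \<le> \<bar>M\<bar> * norm \<xi>" by (intro mult_left_mono l2norm_rep_le \<Omega>) auto
      finally show ?thesis by (simp add: mult.commute)
    qed
  qed
qed

text \<open>The projection onto the classes that vanish outside \<Omega>.\<close>

definition R :: "'n l2 \<Rightarrow> 'n l2" where "R = lift (\<lambda>f. f)"
text \<open>Outside \<open>\<Omega>\<close> the family is the identity, which makes it a cosine family on all of \<open>L\<^sup>2(\<real>\<^sup>n)\<close>.\<close>

definition T :: "real \<Rightarrow> 'n l2 \<Rightarrow> 'n l2" where "T t \<xi> = lift (C t) \<xi> + \<xi> - R \<xi>"

lemma lift_lift:
  assumes "liftable F" "liftable G"
  shows "lift F (lift G \<xi>) = cls_on \<Omega> (F (G (rep \<xi>)))"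
  using assms L2_lebesgue_on_rep[OF \<Omega>] by (intro lift_cong rep_lift) (auto simp: liftable_def)

lemma R_lift: "liftable F \<Longrightarrow> R (lift F \<xi>) = lift F \<xi>" and lift_R: "liftable F \<Longrightarrow> lift F (R \<xi>) = lift F \<xi>"
  unfolding R_def by (simp_all add: lift_lift liftable_id) (simp_all add: lift_def)

lemma R_R: "R (R \<xi>) = R \<xi>"
  using R_lift[OF liftable_id] by (simp add: R_def)

lemma cls_on_diff:
  assumes "L2 \<mu> f" "L2 \<mu> g"
  shows "cls_on \<Omega> f - cls_on \<Omega> g = cls_on \<Omega> (\<lambda>x. f x - g x)"
  using cls_on_lincomb[OF \<Omega> assms(2,1), of "-1"] by simp

lemma cosine_family_T: "cosine_family T"
proof (rule cosine_family.intro)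
  have blR: "bounded_linear R" unfolding R_def by (rule bounded_linear_lift[OF liftable_id])
  note blC = bounded_linear_lift[OF liftable_C]
  interpret R: bounded_linear R by (rule blR)
  fix t s :: real and \<xi> :: "'n l2"
  show "bounded_linear (T t)"
    unfolding T_def by (intro bounded_linear_sub bounded_linear_add blC blR bounded_linear_ident)
  note Lr = L2_lebesgue_on_rep[OF \<Omega>]
  have "lift (C 0) \<xi> = R \<xi>"
    unfolding lift_def R_def using C_0[OF Lr] by (intro cls_on_cong \<Omega> C_L2 Lr) auto
  then show "T 0 \<xi> = \<xi>" by (simp add: T_def)
  interpret K: bounded_linear "lift (C t)" by (rule blC)
  have "lift (C (t + s)) \<xi> + lift (C (t - s)) \<xi> = cls_on \<Omega> (\<lambda>x. 1 *\<^sub>R C (t + s) (rep \<xi>) x + C (t - s) (rep \<xi>) x)"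
    unfolding lift_def by (subst cls_on_lincomb) (auto intro: C_L2)
  also have "\<dots> = cls_on \<Omega> (\<lambda>x. 2 *\<^sub>R C t (C s (rep \<xi>)) x + 0)"
    using C_add[OF Lr, of t s \<xi>]
    by (intro cls_on_cong \<Omega> L2_add L2_scaleR C_L2 Lr L2_zero) (auto elim!: eventually_mono simp: scaleR_conv_of_real)
  also have "\<dots> = 2 *\<^sub>R lift (C t) (lift (C s) \<xi>)"
  proof -
    have "cls_on \<Omega> (\<lambda>x. 0) = 0" by (simp add: cls_on_def zero_l2_def)
    then show ?thesis
      using cls_on_lincomb[OF \<Omega> C_L2[OF C_L2[OF Lr]] L2_zero, of 2 t s \<xi>] by (simp add: lift_lift liftable_C)
  qed
  finally have add: "lift (C (t + s)) \<xi> + lift (C (t - s)) \<xi> = 2 *\<^sub>R lift (C t) (lift (C s) \<xi>)" .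
  \<comment> \<open>\<open>lift\<close> takes values in the range of \<open>R\<close> and
    annihilates what \<open>R\<close> removes, so the family on \<Omega> and the identity outside do
    not interact.\<close>
  have "T t (T s \<xi>) = lift (C t) (lift (C s) \<xi>) + \<xi> - R \<xi>"
    unfolding T_def by (simp add: K.add K.diff R.add R.diff lift_R R_lift R_R liftable_C)
  then have "2 *\<^sub>R T t (T s \<xi>) = (lift (C (t + s)) \<xi> + lift (C (t - s)) \<xi>) + 2 *\<^sub>R \<xi> - 2 *\<^sub>R R \<xi>"
    unfolding add by (simp add: scaleR_right_diff_distrib scaleR_add_right)
  also have "\<dots> = T (t + s) \<xi> + T (t - s) \<xi>" by (simp add: T_def scaleR_2)
  finally show "T (t + s) \<xi> + T (t - s) \<xi> = 2 *\<^sub>R T t (T s \<xi>)" by simp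
  show "continuous_on UNIV (\<lambda>t. T t \<xi>)"
  proof (rule continuous_at_imp_continuous_on, rule ballI)
    fix t
    have "norm (T s \<xi> - T t \<xi>) = l2norm \<Omega> (\<lambda>x. C s (rep \<xi>) x - C t (rep \<xi>) x)" for s
    proof -
      have "T s \<xi> - T t \<xi> = cls_on \<Omega> (\<lambda>x. C s (rep \<xi>) x - C t (rep \<xi>) x)"
        unfolding T_def lift_def by (simp add: cls_on_diff C_L2)
      then show ?thesis by (simp add: norm_cls_on L2_diff C_L2)
    qed
    then have "((\<lambda>s. norm (T s \<xi> - T t \<xi>)) \<longlongrightarrow> 0) (at t)" using C_cont[OF Lr] by simp
    then show "isCont (\<lambda>t. T t \<xi>) t"
      unfolding isCont_def by (simp add: LIM_zero_iff tendsto_norm_zero_iff)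
  qed
qed

sublocale cosine_family T by (rule cosine_family_T)

text \<open>Applying the bounded projection \<open>R\<close> to the convergent quotient discards the
  part outside \<Omega>; what remains is the quotient in the hypothesis on \<open>C\<close>,
  measured in \<open>l2norm\<close>.\<close>

lemma gen_imp_L_op:
  assumes "gen \<xi> \<zeta>"
  shows "L_op \<Omega> V a A00 A0 Aj0 A (rep \<xi>) (\<lambda>x. - rep \<zeta> x)"
proof (rule C_gen)
  note Lr = L2_lebesgue_on_rep[OF \<Omega>]
  show "L2 \<mu> (rep \<xi>)" "L2 \<mu> (rep \<zeta>)" by (rule Lr)+
  interpret R: bounded_linear R unfolding R_def by (rule bounded_linear_lift[OF liftable_id])
  have "((\<lambda>s. R ((2 / s\<^sup>2) *\<^sub>R (T s \<xi> - \<xi>)) - R \<zeta>) \<longlongrightarrow> 0) (at 0)"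
    using R.tendsto[OF assms[unfolded gen_def]] by (simp add: LIM_zero_iff)
  then have "((\<lambda>s. norm (R ((2 / s\<^sup>2) *\<^sub>R (T s \<xi> - \<xi>)) - R \<zeta>)) \<longlongrightarrow> 0) (at 0)"
    by (rule tendsto_norm_zero)
  moreover have "norm (R ((2 / s\<^sup>2) *\<^sub>R (T s \<xi> - \<xi>)) - R \<zeta>)
      = l2norm \<Omega> (\<lambda>x. of_real (2 / s\<^sup>2) * (C s (rep \<xi>) x - rep \<xi> x) - rep \<zeta> x)" for s
  proof -
    have "R ((2 / s\<^sup>2) *\<^sub>R (T s \<xi> - \<xi>)) - R \<zeta> = (2 / s\<^sup>2) *\<^sub>R (lift (C s) \<xi> - R \<xi>) - R \<zeta>"
      by (simp add: R.scaleR R.diff R.add T_def R_lift R_R liftable_C)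
    also have "\<dots> = (2 / s\<^sup>2) *\<^sub>R cls_on \<Omega> (\<lambda>x. C s (rep \<xi>) x - rep \<xi> x) + - cls_on \<Omega> (rep \<zeta>)"
      by (simp add: R_def lift_def cls_on_diff C_L2)
    also have "- cls_on \<Omega> (rep \<zeta>) = cls_on \<Omega> (\<lambda>x. - rep \<zeta> x)"
    proof -
      have "cls_on \<Omega> (\<lambda>x. 0) = 0" by (simp add: cls_on_def zero_l2_def)
      then show ?thesis using cls_on_diff[of "\<lambda>x. 0" "rep \<zeta>"] by (simp add: L2_zero)
    qed
    also have "(2 / s\<^sup>2) *\<^sub>R cls_on \<Omega> (\<lambda>x. C s (rep \<xi>) x - rep \<xi> x) + cls_on \<Omega> (\<lambda>x. - rep \<zeta> x)
        = cls_on \<Omega> (\<lambda>x. (2 / s\<^sup>2) *\<^sub>R (C s (rep \<xi>) x - rep \<xi> x) + - rep \<zeta> x)"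
      by (intro cls_on_lincomb[symmetric] \<Omega> L2_diff L2_uminus C_L2 Lr)
    finally show ?thesis
      by (simp only: norm_cls_on[OF \<Omega> L2_add[OF L2_scaleR[OF L2_diff[OF C_L2[OF Lr] Lr]] L2_uminus[OF Lr]]])
        (simp add: scaleR_conv_of_real)
  qed
  ultimately show "((\<lambda>s. l2norm \<Omega> (\<lambda>x. of_real (2 / s\<^sup>2) * (C s (rep \<xi>) x - rep \<xi> x) - rep \<zeta> x)) \<longlongrightarrow> 0) (at 0)"
    by simp
qed

end

section \<open>The gradient on classes and the weak form of the equation\<close>

lemma has_bochner_integral_mono_AE:
  fixes f g :: "'a \<Rightarrow> real"
  assumes "has_bochner_integral M f x" "has_bochner_integral M g y" "AE z in M. f z \<le> g z"
  shows "x \<le> y"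
  using integral_mono_AE[of M f g] assms by (simp add: has_bochner_integral_iff)

lemma L2_sum: "finite I \<Longrightarrow> (\<And>i. i \<in> I \<Longrightarrow> L2 M (f i)) \<Longrightarrow> L2 M (\<lambda>x. \<Sum>i\<in>I. f i x)"
  by (induction I rule: finite_induct) (auto intro: L2_zero L2_add)

lemma Linfty_mult:
  assumes "Linfty \<Omega> f" "Linfty \<Omega> g"
  shows "Linfty \<Omega> (\<lambda>x. f x * g x :: complex)"
proof -
  obtain B B' where B: "AE x in lebesgue_on \<Omega>. cmod (f x) \<le> B" "AE x in lebesgue_on \<Omega>. cmod (g x) \<le> B'"
    using assms by (auto simp: Linfty_def)
  have "AE x in lebesgue_on \<Omega>. cmod (f x * g x) \<le> \<bar>B\<bar> * \<bar>B'\<bar>"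
    using B by eventually_elim (auto simp: norm_mult intro!: mult_mono)
  then show ?thesis using assms unfolding Linfty_def by (auto intro: borel_measurable_times)
qed

lemma Linfty_bounded_continuous:
  fixes \<eta> :: "'n::euclidean_space \<Rightarrow> real"
  assumes "continuous_on UNIV \<eta>" "\<And>x. \<bar>\<eta> x\<bar> \<le> B"
  shows "Linfty \<Omega> (\<lambda>x. complex_of_real (\<eta> x))"
proof -
  have "\<eta> \<in> borel_measurable lebesgue"
    using borel_measurable_continuous_onI[OF assms(1)] by (intro measurable_completion) simp
  then have "\<eta> \<in> borel_measurable (lebesgue_on \<Omega>)" by (rule measurable_restrict_space1)
  then show ?thesis
    unfolding Linfty_def using assms(2) by (auto intro!: exI[of _ B] borel_measurable_of_real)
qed

lemma Linfty_weight: "Linfty \<Omega> (\<lambda>x. complex_of_real (weight \<rho> x0 x))"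
  using weight_pos[of \<rho> x0] weight_le_1[of \<rho> x0]
  by (intro Linfty_bounded_continuous[OF continuous_weight, where B = 1]) (simp add: abs_of_pos)

lemma dweight_le: "\<rho> \<ge> 0 \<Longrightarrow> \<bar>dweight \<rho> x0 b x\<bar> \<le> \<rho>"
  using dweight_bound[of \<rho> x0 b x] mult_left_mono[OF weight_le_1[of \<rho> x0 x], of \<rho>] by linarith

lemma Linfty_dweight: "\<rho> \<ge> 0 \<Longrightarrow> Linfty \<Omega> (\<lambda>x. complex_of_real (dweight \<rho> x0 b x))"
  by (intro Linfty_bounded_continuous[OF continuous_dweight, where B = \<rho>] dweight_le)

lemma Linfty_common_bound:
  fixes f :: "'i \<Rightarrow> 'n::euclidean_space \<Rightarrow> complex"
  assumes "finite I" "\<And>i. i \<in> I \<Longrightarrow> Linfty \<Omega> (f i)"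
  shows "\<exists>B. AE x in lebesgue_on \<Omega>. \<forall>i\<in>I. cmod (f i x) \<le> B"
proof -
  obtain B where B: "\<And>i. i \<in> I \<Longrightarrow> AE x in lebesgue_on \<Omega>. cmod (f i x) \<le> B i"
    using assms(2) unfolding Linfty_def by metis
  have "AE x in lebesgue_on \<Omega>. \<forall>i\<in>I. cmod (f i x) \<le> (\<Sum>i\<in>I. \<bar>B i\<bar>)"
  proof (rule AE_finite_allI[OF assms(1)])
    fix i assume i: "i \<in> I"
    have "\<bar>B i\<bar> \<le> (\<Sum>i\<in>I. \<bar>B i\<bar>)" using i assms(1) by (intro member_le_sum) auto
    then show "AE x in lebesgue_on \<Omega>. cmod (f i x) \<le> (\<Sum>i\<in>I. \<bar>B i\<bar>)"
      using B[OF i] by (auto elim!: eventually_mono)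
  qed
  then show ?thesis by blast
qed

context wave
begin

lemma V_lin: "f \<in> V \<Longrightarrow> g \<in> V \<Longrightarrow> (\<lambda>x. c * f x + g x) \<in> V"
  and V_cong_W12: "f \<in> V \<Longrightarrow> W12 \<Omega> g \<Longrightarrow> AE x in \<mu>. f x = g x \<Longrightarrow> g \<in> V"
  and V_mult: "f \<in> V \<Longrightarrow> Lip_bdd \<Omega> \<eta> \<Longrightarrow> (\<lambda>x. of_real (\<eta> x) * f x) \<in> V"
  using V unfolding admissible_V_def aeeq_def by blast+

lemma V_L2: "f \<in> V \<Longrightarrow> L2 \<mu> f"
  using V_W12[OF V] by (auto simp: W12_def sq_int_L2)

text \<open>Admissibility gives invariance under almost everywhere equality only within
  \<open>W12\<close>. Weak derivatives see a function through integrals alone, so membership in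
  \<open>W12\<close> transfers first.\<close>

lemma V_cong:
  assumes f: "f \<in> V" and g: "L2 \<mu> g" and eq: "AE x in \<mu>. f x = g x"
  shows "g \<in> V"
proof (rule V_cong_W12[OF f _ eq])
  have "\<exists>h. sq_int \<Omega> h \<and> weak_partial \<Omega> g b h" if b: "b \<in> Basis" for b
    using wgrad_props[OF V_W12[OF V f] b] weak_partial_cong[OF eq V_L2[OF f] g \<Omega> b] by (auto simp: sq_int_L2)
  then show "W12 \<Omega> g" using g by (auto simp: W12_def sq_int_L2)
qed

definition grad :: "'n \<Rightarrow> 'n l2 \<Rightarrow> 'n l2" where "grad b \<xi> = cls_on \<Omega> (wgrad \<Omega> (rep \<xi>) b)"

lemma wgrad_L2: "f \<in> V \<Longrightarrow> b \<in> Basis \<Longrightarrow> L2 \<mu> (wgrad \<Omega> f b)"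
  by (rule wgrad_props(1)[OF V_W12[OF V]])

lemma rep_grad: "rep \<xi> \<in> V \<Longrightarrow> b \<in> Basis \<Longrightarrow> AE x in \<mu>. rep (grad b \<xi>) x = wgrad \<Omega> (rep \<xi>) b x"
  unfolding grad_def by (intro rep_cls_on \<Omega> wgrad_L2)

lemma
  assumes \<xi>: "rep \<xi> \<in> V" and \<zeta>: "rep \<zeta> \<in> V"
  shows V_lincomb: "rep (c *\<^sub>R \<xi> + \<zeta>) \<in> V"
    and grad_lincomb: "b \<in> Basis \<Longrightarrow> grad b (c *\<^sub>R \<xi> + \<zeta>) = c *\<^sub>R grad b \<xi> + grad b \<zeta>"
proof -
  let ?f = "\<lambda>x. of_real c * rep \<xi> x + rep \<zeta> x"
  have f: "?f \<in> V" by (rule V_lin[OF \<xi> \<zeta>])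
  have "AE x in lebesgue. ?f x = rep (c *\<^sub>R \<xi> + \<zeta>) x"
    using rep_plus[of "c *\<^sub>R \<xi>" \<zeta>] rep_scaleR[of c \<xi>] by eventually_elim (simp add: scaleR_conv_of_real)
  then have eq: "AE x in \<mu>. ?f x = rep (c *\<^sub>R \<xi> + \<zeta>) x" by (rule AE_lebesgue_on[OF \<Omega>])
  show in_V: "rep (c *\<^sub>R \<xi> + \<zeta>) \<in> V"
    by (rule V_cong[OF f _ eq]) (simp add: L2_lebesgue_on_rep)
  assume b: "b \<in> Basis"
  note w\<xi> = wgrad_props[OF V_W12[OF V \<xi>] b] and w\<zeta> = wgrad_props[OF V_W12[OF V \<zeta>] b]
  have "weak_partial \<Omega> ?f b (\<lambda>x. of_real c * wgrad \<Omega> (rep \<xi>) b x + wgrad \<Omega> (rep \<zeta>) b x)"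
    by (rule weak_partial_lincomb[OF \<Omega> b V_L2[OF \<xi>] w\<xi> V_L2[OF \<zeta>] w\<zeta>])
  then have wp: "weak_partial \<Omega> (rep (c *\<^sub>R \<xi> + \<zeta>)) b (\<lambda>x. of_real c * wgrad \<Omega> (rep \<xi>) b x + wgrad \<Omega> (rep \<zeta>) b x)"
    by (rule weak_partial_cong[OF eq V_L2[OF f] V_L2[OF in_V] \<Omega> b])
  have L: "L2 \<mu> (\<lambda>x. of_real c * wgrad \<Omega> (rep \<xi>) b x + wgrad \<Omega> (rep \<zeta>) b x)"
    by (intro L2_add L2_cmult w\<xi> w\<zeta>)
  have "grad b (c *\<^sub>R \<xi> + \<zeta>) = cls_on \<Omega> (\<lambda>x. of_real c * wgrad \<Omega> (rep \<xi>) b x + wgrad \<Omega> (rep \<zeta>) b x)"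
    unfolding grad_def
    by (rule cls_on_cong[OF \<Omega> wgrad_eqI[OF open_\<Omega> V_W12[OF V in_V] b L wp] wgrad_L2[OF in_V b] L])
  also have "\<dots> = c *\<^sub>R grad b \<xi> + grad b \<zeta>"
    using cls_on_lincomb[OF \<Omega> w\<xi>(1) w\<zeta>(1), of c] by (simp add: grad_def scaleR_conv_of_real)
  finally show "grad b (c *\<^sub>R \<xi> + \<zeta>) = c *\<^sub>R grad b \<xi> + grad b \<zeta>" .
qed

lemma gen_lincomb:
  assumes "gen \<xi> \<zeta>" "gen \<xi>' \<zeta>'" shows "gen (c *\<^sub>R \<xi> + \<xi>') (c *\<^sub>R \<zeta> + \<zeta>')"
proof -
  have "(2 / s\<^sup>2) *\<^sub>R (T s (c *\<^sub>R \<xi> + \<xi>') - (c *\<^sub>R \<xi> + \<xi>')) =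
      c *\<^sub>R ((2 / s\<^sup>2) *\<^sub>R (T s \<xi> - \<xi>)) + (2 / s\<^sup>2) *\<^sub>R (T s \<xi>' - \<xi>')" for s
  proof -
    interpret Ts: bounded_linear "T s" by (rule bounded_linear_T)
    show ?thesis by (simp add: Ts.add Ts.scaleR algebra_simps)
  qed
  then show ?thesis
    using tendsto_add[OF tendsto_scaleR[OF tendsto_const assms(1)[unfolded gen_def]] assms(2)[unfolded gen_def]]
    unfolding gen_def by (simp only:)
qed

lemma gen_V: "gen \<xi> \<zeta> \<Longrightarrow> rep \<xi> \<in> V"
  using gen_imp_L_op[of \<xi> \<zeta>] by (simp add: L_op_def)

abbreviation "pointwise_at x \<equiv> pointwise Basis (\<lambda>j k. A j k x) (\<lambda>k. A0 k x) (\<lambda>j. Aj0 j x) (A00 x) (a x) lam"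

lemma coefficient_bound:
  "\<exists>B\<ge>1. AE x in \<mu>. pointwise_at x B"
proof -
  obtain B1 where B1: "AE x in \<mu>. \<forall>i\<in>Basis \<times> Basis. cmod (A (fst i) (snd i) x) \<le> B1"
    using Linfty_common_bound[of "Basis \<times> Basis" \<Omega> "\<lambda>i. A (fst i) (snd i)"] A by auto
  obtain B2 where B2: "AE x in \<mu>. \<forall>k\<in>Basis. cmod (A0 k x) \<le> B2"
    using Linfty_common_bound[of Basis \<Omega> A0] A0 by auto
  obtain B3 where B3: "AE x in \<mu>. \<forall>j\<in>Basis. cmod (Aj0 j x) \<le> B3"
    using Linfty_common_bound[of Basis \<Omega> Aj0] Aj0 by auto
  obtain B4 where B4: "AE x in \<mu>. cmod (A00 x) \<le> B4" using A00 by (auto simp: Linfty_def)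
  obtain B5 where B5: "AE x in \<mu>. norm (a x) \<le> B5" using a by (auto simp: Linfty_def)
  define B where "B = Max {1, B1, B2, B3, B4, B5}"
  have B: "1 \<le> B" "B1 \<le> B" "B2 \<le> B" "B3 \<le> B" "B4 \<le> B" "B5 \<le> B" by (auto simp: B_def)
  have "AE x in \<mu>. pointwise_at x B"
    using B1 B2 B3 B4 B5 a_lam ell
  proof eventually_elim
    case (elim x)
    show ?case
    proof (rule pointwise.intro)
      show "cmod (A j k x) \<le> B" if "j \<in> Basis" "k \<in> Basis" for j k
        using elim(1) that B(2) by fastforce
      show "cmod (A0 k x) \<le> B" if "k \<in> Basis" for k using elim(2) that B(3) by fastforce
      show "cmod (Aj0 j x) \<le> B" if "j \<in> Basis" for j using elim(3) that B(4) by fastforce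
    qed (use elim B lam in auto)
  qed
  then show ?thesis using B(1) by blast
qed

text \<open>One bound for all coefficients, fixed once by choice, so that the speed built from it is
  the same for all data, sets and times.\<close>

definition coeff_bound where "coeff_bound = (SOME B. B \<ge> 1 \<and> (AE x in \<mu>.
  pointwise_at x B))"

lemma coeff_bound_ge_1: "coeff_bound \<ge> 1"
  and pointwise_AE: "AE x in \<mu>.
  pointwise_at x coeff_bound"
  using someI_ex[OF coefficient_bound] unfolding coeff_bound_def by auto

lemma Linfty_inverse_a: "Linfty \<Omega> (\<lambda>x. complex_of_real (1 / a x))"
  unfolding Linfty_def
proof
  have "a \<in> borel_measurable \<mu>" using a by (simp add: Linfty_def)
  then show "(\<lambda>x. complex_of_real (1 / a x)) \<in> borel_measurable \<mu>" by measurable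
  have "AE x in \<mu>. cmod (complex_of_real (1 / a x)) \<le> 1 / lam"
    using a_lam by eventually_elim (use lam in \<open>auto simp: norm_divide frac_le\<close>)
  then show "\<exists>M. AE x in \<mu>. cmod (complex_of_real (1 / a x)) \<le> M" by blast
qed

abbreviation "weak_form_at \<rho> x0 \<xi> \<zeta> \<omega> x \<equiv>
  weak_form Basis (\<lambda>j k. A j k x) (\<lambda>k. A0 k x) (\<lambda>j. Aj0 j x) (A00 x) (a x) (weight \<rho> x0 x) (\<lambda>b. dweight \<rho> x0 b x)
    (rep \<xi> x) (\<lambda>k. rep (grad k \<xi>) x) (rep \<zeta> x) (rep \<omega> x) (\<lambda>j. rep (grad j \<omega>) x)"

text \<open>The definition of \<open>div_V\<close> is tested with the weight times \<omega>, an
  element of \<open>V\<close>, and real parts are taken. The weak product rule computes the gradient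
  of this test function, and \<open>gen\<close> expresses the divergence of the flux by lower order
  terms and \<zeta>.\<close>

lemma weak_identity:
  assumes gen: "gen \<xi> \<zeta>" and \<omega>: "rep \<omega> \<in> V" and \<rho>: "\<rho> \<ge> 0"
  shows "has_bochner_integral \<mu>
    (\<lambda>x. weak_form_at \<rho> x0 \<xi> \<zeta> \<omega> x) 0"
proof -
  note Lr [intro] = L2_lebesgue_on_rep[OF \<Omega>]
  let ?u = "rep \<xi>"
  let ?flux = "\<lambda>j x. (\<Sum>k\<in>Basis. A j k x * wgrad \<Omega> ?u k x) + Aj0 j x * ?u x"
  obtain d where u: "?u \<in> V" and dv: "div_V \<Omega> V ?flux d"
    and d: "AE x in \<mu>. - rep \<zeta> x = of_real (a x) * (A00 x * ?u x + (\<Sum>k\<in>Basis. A0 k x * wgrad \<Omega> ?u k x) - d x)"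
    using gen_imp_L_op[OF gen] unfolding L_op_def aeeq_def by blast
  define p where "p x = of_real (weight \<rho> x0 x) * rep \<omega> x" for x
  have p: "p \<in> V" unfolding p_def by (rule V_mult[OF \<omega> Lip_bdd_weight[OF \<rho>]])
  have wp: "AE x in \<mu>. wgrad \<Omega> p b x = of_real (weight \<rho> x0 x) * wgrad \<Omega> (rep \<omega>) b x + of_real (dweight \<rho> x0 b x) * rep \<omega> x"
    if b: "b \<in> Basis" for b
  proof (rule wgrad_eqI[OF open_\<Omega> V_W12[OF V p] b])
    show "L2 \<mu> (\<lambda>x. of_real (weight \<rho> x0 x) * wgrad \<Omega> (rep \<omega>) b x + of_real (dweight \<rho> x0 b x) * rep \<omega> x)"
      by (intro L2_add Linfty_mult_L2 \<Omega> Linfty_weight Linfty_dweight \<rho> wgrad_L2 \<omega> b Lr)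
    show "weak_partial \<Omega> p b (\<lambda>x. of_real (weight \<rho> x0 x) * wgrad \<Omega> (rep \<omega>) b x + of_real (dweight \<rho> x0 b x) * rep \<omega> x)"
      unfolding p_def
      by (rule weak_partial_mult[OF \<Omega> b V_L2[OF \<omega>] wgrad_props[OF V_W12[OF V \<omega>] b] smooth_fun_weight has_partials_weight])
        (intro continuous_intros continuous_dweight)
  qed
  have Lflux: "L2 \<mu> (?flux b)" if "b \<in> Basis" for b
    using dv that by (auto simp: div_V_def sq_int_L2)
  have Ld: "L2 \<mu> d" using dv by (auto simp: div_V_def sq_int_L2)
  have Re_l2inner: "Re (l2inner \<Omega> f g) = (\<integral>x. g x \<bullet> f x \<partial>\<mu>)"
    if "L2 \<mu> f" "L2 \<mu> g" for f g
  proof -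
    have "(\<lambda>x. g x \<bullet> f x) = (\<lambda>x. Re (f x * cnj (g x)))"
      by (simp add: inner_complex_def mult.commute)
    then show ?thesis
      unfolding l2inner_def using integral_Re[OF L2_mult_integrable[OF that(1) L2_cnj[OF that(2)]]] by simp
  qed
  have "- (\<Sum>b\<in>Basis. l2inner \<Omega> (wgrad \<Omega> p b) (?flux b)) = l2inner \<Omega> p d"
    using dv p by (auto simp: div_V_def)
  then have "Re (- (\<Sum>b\<in>Basis. l2inner \<Omega> (wgrad \<Omega> p b) (?flux b))) = Re (l2inner \<Omega> p d)" by simp
  then have sum0: "(\<Sum>b\<in>Basis. \<integral>x. ?flux b x \<bullet> wgrad \<Omega> p b x \<partial>\<mu>) + (\<integral>x. d x \<bullet> p x \<partial>\<mu>) = 0"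
    using Lflux wgrad_L2[OF p] Ld V_L2[OF p] by (simp add: Re_l2inner)
  have "has_bochner_integral \<mu> (\<lambda>x. (\<Sum>b\<in>Basis. ?flux b x \<bullet> wgrad \<Omega> p b x) + d x \<bullet> p x)
      ((\<Sum>b\<in>Basis. \<integral>x. ?flux b x \<bullet> wgrad \<Omega> p b x \<partial>\<mu>) + (\<integral>x. d x \<bullet> p x \<partial>\<mu>))"
    by (intro has_bochner_integral_add has_bochner_integral_sum has_bochner_integral_integrable L2_inner_integrable
        Lflux wgrad_L2[OF p] Ld V_L2[OF p])
  then have hbi: "has_bochner_integral \<mu> (\<lambda>x. (\<Sum>b\<in>Basis. ?flux b x \<bullet> wgrad \<Omega> p b x) + d x \<bullet> p x) 0"
    unfolding sum0 .
  let ?W = "\<lambda>x. weak_form_at \<rho> x0 \<xi> \<zeta> \<omega> x"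
  have W_int: "integrable \<mu> ?W"
    unfolding weak_form_def
  proof (intro Bochner_Integration.integrable_add Bochner_Integration.integrable_sum L2_inner_integrable)
    show "L2 \<mu> (\<lambda>x. (\<Sum>k\<in>Basis. A j k x * rep (grad k \<xi>) x) + Aj0 j x * rep \<xi> x)" if "j \<in> Basis" for j
      using A Aj0 that by (intro L2_add L2_sum Linfty_mult_L2 \<Omega> Lr) auto
    show "L2 \<mu> (\<lambda>x. of_real (weight \<rho> x0 x) * rep (grad j \<omega>) x + of_real (dweight \<rho> x0 j x) * rep \<omega> x)" for j
      by (intro L2_add Linfty_mult_L2 \<Omega> Linfty_weight Linfty_dweight \<rho> Lr)
    show "L2 \<mu> (\<lambda>x. A00 x * rep \<xi> x + (\<Sum>k\<in>Basis. A0 k x * rep (grad k \<xi>) x) + of_real (1 / a x) * rep \<zeta> x)"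
      using A0 A00 by (intro L2_add L2_sum Linfty_mult_L2 \<Omega> Linfty_inverse_a Lr) auto
    show "L2 \<mu> (\<lambda>x. of_real (weight \<rho> x0 x) * rep \<omega> x)"
      by (intro Linfty_mult_L2 \<Omega> Linfty_weight Lr)
  qed
  have N\<xi>: "AE x in \<mu>. \<forall>b\<in>Basis. rep (grad b \<xi>) x = wgrad \<Omega> ?u b x"
    by (intro AE_finite_allI finite_Basis rep_grad u)
  have N\<omega>: "AE x in \<mu>. \<forall>b\<in>Basis. rep (grad b \<omega>) x = wgrad \<Omega> (rep \<omega>) b x"
    by (intro AE_finite_allI finite_Basis rep_grad \<omega>)
  have wp': "AE x in \<mu>. \<forall>b\<in>Basis. wgrad \<Omega> p b x = of_real (weight \<rho> x0 x) * wgrad \<Omega> (rep \<omega>) b x + of_real (dweight \<rho> x0 b x) * rep \<omega> x"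
    by (intro AE_finite_allI finite_Basis wp)
  have eq: "AE x in \<mu>. ?W x = (\<Sum>b\<in>Basis. ?flux b x \<bullet> wgrad \<Omega> p b x) + d x \<bullet> p x"
    using N\<xi> N\<omega> wp' d a_lam
  proof eventually_elim
    case (elim x)
    then have "a x \<noteq> 0" using lam by auto
    \<comment> \<open>Dividing by \<open>a\<close> frees the divergence from its coefficient; this
      is the origin of the factor \<open>1 / ai\<close> in the weak form and in the energy.\<close>
    then have dx: "A00 x * ?u x + (\<Sum>k\<in>Basis. A0 k x * wgrad \<Omega> ?u k x) + of_real (1 / a x) * rep \<zeta> x = d x"
      using elim(4) by (simp add: field_simps)
    show ?case
      unfolding weak_form_def dx[symmetric] using elim(1,2,3) by (simp add: p_def[of x])
  qed
  have "integral\<^sup>L \<mu> ?W = (\<integral>x. (\<Sum>b\<in>Basis. ?flux b x \<bullet> wgrad \<Omega> p b x) + d x \<bullet> p x \<partial>\<mu>)"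
    by (rule integral_cong_AE[OF borel_measurable_integrable[OF W_int] borel_measurable_has_bochner_integral[OF hbi] eq])
  also have "\<dots> = 0" using hbi by (rule has_bochner_integral_integral_eq)
  finally show ?thesis using W_int by (simp add: has_bochner_integral_iff)
qed

end

section \<open>The weighted energy\<close>

context wave
begin

abbreviation "\<kappa> \<equiv> energy_kappa DIM('n) coeff_bound lam"
abbreviation "c0 \<equiv> energy_c0 coeff_bound lam"
abbreviation "growth \<rho> \<equiv> (energy_M DIM('n) coeff_bound lam + \<rho> * energy_speed DIM('n) coeff_bound) / c0"

lemma c0_pos: "c0 > 0"
  using coeff_bound_ge_1 lam by (simp add: energy_c0_def)

definition sq_on :: "'n l2 \<Rightarrow> real" where "sq_on \<xi> = (\<integral>x. (cmod (rep \<xi> x))\<^sup>2 \<partial>\<mu>)"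

lemma sq_on_hbi: "has_bochner_integral \<mu> (\<lambda>x. (cmod (rep \<xi> x))\<^sup>2) (sq_on \<xi>)"
  unfolding sq_on_def by (intro has_bochner_integral_integrable L2_integrable L2_lebesgue_on_rep \<Omega>)

lemma sq_on_le: "sq_on \<xi> \<le> (norm \<xi>)\<^sup>2"
proof -
  have "(l2norm \<Omega> (rep \<xi>))\<^sup>2 \<le> (norm \<xi>)\<^sup>2"
    by (intro power_mono l2norm_rep_le \<Omega>) (simp add: l2norm_def)
  then show ?thesis by (simp add: l2norm_def sq_on_def)
qed

lemma sq_on_grad:
  assumes "rep \<xi> \<in> V" "b \<in> Basis" shows "sq_on (grad b \<xi>) = (norm (grad b \<xi>))\<^sup>2"
proof -
  note L = wgrad_L2[OF assms]
  have "(norm (grad b \<xi>))\<^sup>2 = (\<integral>x. (cmod (wgrad \<Omega> (rep \<xi>) b x))\<^sup>2 \<partial>\<mu>)"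
    unfolding grad_def norm_cls_on[OF \<Omega> L] by (simp add: l2norm_def)
  also have "\<dots> = sq_on (grad b \<xi>)"
    unfolding sq_on_def
  proof (rule integral_cong_AE)
    show "AE x in \<mu>. (cmod (wgrad \<Omega> (rep \<xi>) b x))\<^sup>2 = (cmod (rep (grad b \<xi>) x))\<^sup>2"
      using rep_grad[OF assms] by eventually_elim simp
  qed (use L2_integrable[OF L] L2_integrable[OF L2_lebesgue_on_rep[OF \<Omega>]] in auto)
  finally show ?thesis by simp
qed

lemma weight_0: "weight 0 x0 x = 1" "dweight 0 x0 b x = 0"
  by (simp_all add: weight_def dweight_def)

text \<open>With \<rho> equal to \<open>0\<close> the weight is constant, and the weak identity
  tested with \<xi> itself combines with the Garding inequality. The gradient is thus bounded in the
  graph norm of the generator.\<close>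

lemma grad_bound:
  assumes gen: "gen \<xi> \<zeta>" and b: "b \<in> Basis"
  shows "norm (grad b \<xi>) \<le> sqrt (2 * energy_c1 DIM('n) coeff_bound lam / lam) * (norm \<xi> + norm \<zeta>)"
proof -
  let ?c1 = "energy_c1 DIM('n) coeff_bound lam"
  have c1: "?c1 \<ge> 0" using coeff_bound_ge_1 lam by (simp add: energy_c1_def)
  note \<xi> = gen_V[OF gen]
  let ?W = "\<lambda>x. weak_form_at 0 0 \<xi> \<zeta> \<xi> x"
  have W: "has_bochner_integral \<mu> ?W 0" by (rule weak_identity[OF gen \<xi>]) simp
  let ?g = "\<lambda>x. lam / 2 * (\<Sum>j\<in>Basis. (cmod (rep (grad j \<xi>) x))\<^sup>2) - ?c1 * ((cmod (rep \<xi> x))\<^sup>2 + (cmod (rep \<zeta> x))\<^sup>2)"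
  have g: "has_bochner_integral \<mu> ?g (lam / 2 * (\<Sum>j\<in>Basis. sq_on (grad j \<xi>)) - ?c1 * (sq_on \<xi> + sq_on \<zeta>))"
    by (intro has_bochner_integral_diff has_bochner_integral_mult_right has_bochner_integral_sum has_bochner_integral_add sq_on_hbi)
  have "AE x in \<mu>. ?g x \<le> ?W x"
    using pointwise_AE
  proof eventually_elim
    case (elim x)
    from pointwise.\<Phi>_coercive[OF elim, of "\<lambda>k. rep (grad k \<xi>) x" "rep \<xi> x" "rep \<zeta> x"]
    show ?case unfolding weight_0 .
  qed
  from has_bochner_integral_mono_AE[OF g W this]
  have "lam / 2 * (\<Sum>j\<in>Basis. sq_on (grad j \<xi>)) \<le> ?c1 * (sq_on \<xi> + sq_on \<zeta>)" by simp
  also have "\<dots> \<le> ?c1 * ((norm \<xi>)\<^sup>2 + (norm \<zeta>)\<^sup>2)"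
    using c1 by (intro mult_left_mono add_mono sq_on_le)
  also have "\<dots> \<le> ?c1 * (norm \<xi> + norm \<zeta>)\<^sup>2"
    using c1 by (intro mult_left_mono) (auto simp: power2_sum)
  finally have le: "lam / 2 * (\<Sum>j\<in>Basis. sq_on (grad j \<xi>)) \<le> ?c1 * (norm \<xi> + norm \<zeta>)\<^sup>2" .
  have "sq_on (grad b \<xi>) \<le> (\<Sum>j\<in>Basis. sq_on (grad j \<xi>))"
    by (rule member_le_sum[OF b]) (auto simp: sq_on_def)
  then have "lam / 2 * sq_on (grad b \<xi>) \<le> lam / 2 * (\<Sum>j\<in>Basis. sq_on (grad j \<xi>))"
    using lam by (intro mult_left_mono) auto
  with le have "lam / 2 * (norm (grad b \<xi>))\<^sup>2 \<le> ?c1 * (norm \<xi> + norm \<zeta>)\<^sup>2"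
    unfolding sq_on_grad[OF \<xi> b] by linarith
  then have "(norm (grad b \<xi>))\<^sup>2 \<le> 2 * ?c1 / lam * (norm \<xi> + norm \<zeta>)\<^sup>2"
    using lam by (simp add: field_simps)
  then have "sqrt ((norm (grad b \<xi>))\<^sup>2) \<le> sqrt (2 * ?c1 / lam * (norm \<xi> + norm \<zeta>)\<^sup>2)"
    by (rule real_sqrt_le_mono)
  then show ?thesis unfolding real_sqrt_mult by simp
qed

text \<open>The gradient is controlled only in the graph norm, so the Taylor remainder has to be
  small together with its image under the generator. That image is the Taylor remainder of
  \<open>sol_d2\<close>, which is differentiable as well.\<close>

lemma grad_sol_deriv:
  assumes b: "b \<in> Basis"
  shows "((\<lambda>t. grad b (sol \<xi> h t)) has_vector_derivative grad b (sol_d1 \<xi> h t)) (at t)"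
proof -
  let ?u = "sol \<xi> h" and ?v = "sol_d1 \<xi> h" and ?w = "sol_d2 \<xi> h" and ?z = "sol_d3 \<xi> h"
  let ?K = "sqrt (2 * energy_c1 DIM('n) coeff_bound lam / lam)"
  have u': "((\<lambda>s. norm (?u (t + s) - ?u t - s *\<^sub>R ?v t) / norm s) \<longlongrightarrow> 0) (at 0)"
    using sol_deriv[of \<xi> h t] by (simp add: has_vector_derivative_def has_derivative_at)
  have w': "((\<lambda>s. norm (?w (t + s) - ?w t - s *\<^sub>R ?z t) / norm s) \<longlongrightarrow> 0) (at 0)"
    using sol_d2_deriv[of \<xi> h t] by (simp add: has_vector_derivative_def has_derivative_at)
  have bound: "norm (grad b (?u (t + s)) - grad b (?u t) - s *\<^sub>R grad b (?v t))
      \<le> ?K * (norm (?u (t + s) - ?u t - s *\<^sub>R ?v t) + norm (?w (t + s) - ?w t - s *\<^sub>R ?z t))" for s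
  proof -
    have g1: "gen (- 1 *\<^sub>R ?u t + ?u (t + s)) (- 1 *\<^sub>R ?w t + ?w (t + s))" by (intro gen_lincomb gen_sol)
    have g2: "gen ((- s) *\<^sub>R ?v t + (- 1 *\<^sub>R ?u t + ?u (t + s))) ((- s) *\<^sub>R ?z t + (- 1 *\<^sub>R ?w t + ?w (t + s)))"
      by (rule gen_lincomb[OF gen_sol_d1 g1])
    have eq: "grad b ((- s) *\<^sub>R ?v t + (- 1 *\<^sub>R ?u t + ?u (t + s))) = (- s) *\<^sub>R grad b (?v t) + (- 1 *\<^sub>R grad b (?u t) + grad b (?u (t + s)))"
      unfolding grad_lincomb[OF gen_V[OF gen_sol_d1] gen_V[OF g1] b] grad_lincomb[OF gen_V[OF gen_sol] gen_V[OF gen_sol] b] ..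
    have "norm (grad b (?u (t + s)) - grad b (?u t) - s *\<^sub>R grad b (?v t)) = norm (grad b ((- s) *\<^sub>R ?v t + (- 1 *\<^sub>R ?u t + ?u (t + s))))"
      unfolding eq by (simp add: algebra_simps)
    also have "\<dots> \<le> ?K * (norm ((- s) *\<^sub>R ?v t + (- 1 *\<^sub>R ?u t + ?u (t + s))) + norm ((- s) *\<^sub>R ?z t + (- 1 *\<^sub>R ?w t + ?w (t + s))))"
      by (rule grad_bound[OF g2 b])
    finally show ?thesis by (simp add: algebra_simps)
  qed
  have lim: "((\<lambda>s. ?K * (norm (?u (t + s) - ?u t - s *\<^sub>R ?v t) / norm s + norm (?w (t + s) - ?w t - s *\<^sub>R ?z t) / norm s)) \<longlongrightarrow> 0) (at 0)"
    using tendsto_mult[OF tendsto_const tendsto_add[OF u' w'], of ?K] by simp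
  have "((\<lambda>s. norm (grad b (?u (t + s)) - grad b (?u t) - s *\<^sub>R grad b (?v t)) / norm s) \<longlongrightarrow> 0) (at 0)"
  proof (rule tendsto_sandwich[OF _ _ tendsto_const lim])
    show "\<forall>\<^sub>F s in at 0. norm (grad b (?u (t + s)) - grad b (?u t) - s *\<^sub>R grad b (?v t)) / norm s
        \<le> ?K * (norm (?u (t + s) - ?u t - s *\<^sub>R ?v t) / norm s + norm (?w (t + s) - ?w t - s *\<^sub>R ?z t) / norm s)"
    proof (intro always_eventually allI)
      fix s :: real
      from divide_right_mono[OF bound[of s], of "norm s"]
      show "norm (grad b (?u (t + s)) - grad b (?u t) - s *\<^sub>R grad b (?v t)) / norm s
        \<le> ?K * (norm (?u (t + s) - ?u t - s *\<^sub>R ?v t) / norm s + norm (?w (t + s) - ?w t - s *\<^sub>R ?z t) / norm s)"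
        by (simp add: add_divide_distrib[symmetric])
    qed
  qed simp
  then show ?thesis
    by (simp add: has_vector_derivative_def has_derivative_at bounded_linear_scaleR_left)
qed

definition wpair :: "real \<Rightarrow> 'n \<Rightarrow> ('n \<Rightarrow> complex) \<Rightarrow> 'n l2 \<Rightarrow> 'n l2 \<Rightarrow> real" where
  "wpair \<rho> x0 m = pair \<Omega> (\<lambda>x. of_real (weight \<rho> x0 x) * m x)"

lemma bounded_bilinear_wpair: "Linfty \<Omega> m \<Longrightarrow> bounded_bilinear (wpair \<rho> x0 m)"
  unfolding wpair_def by (intro bounded_bilinear_pair \<Omega> Linfty_mult Linfty_weight)

lemma wpair_hbi:
  assumes "Linfty \<Omega> m"
  shows "has_bochner_integral \<mu> (\<lambda>x. weight \<rho> x0 x * ((m x * rep \<xi> x) \<bullet> rep \<zeta> x)) (wpair \<rho> x0 m \<xi> \<zeta>)"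
proof -
  have "weight \<rho> x0 x * ((m x * rep \<xi> x) \<bullet> rep \<zeta> x) = (of_real (weight \<rho> x0 x) * m x * rep \<xi> x) \<bullet> rep \<zeta> x" for x
    by (simp add: mult.assoc inner_of_real_mult)
  then show ?thesis
    unfolding wpair_def pair_def
    using pair_integrable[OF \<Omega> Linfty_mult[OF Linfty_weight assms]] by (simp add: has_bochner_integral_integrable)
qed

lemma Linfty_1: "Linfty \<Omega> (\<lambda>x. 1 :: complex)"
  by (auto simp: Linfty_def intro: exI[of _ 1])

definition energy :: "real \<Rightarrow> 'n \<Rightarrow> 'n l2 \<Rightarrow> 'n l2 \<Rightarrow> real" where
  "energy \<rho> x0 r p = wpair \<rho> x0 (\<lambda>x. of_real (1 / a x)) r r
     + (\<Sum>j\<in>Basis. \<Sum>k\<in>Basis. wpair \<rho> x0 (A j k) (grad k p) (grad j p))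
     + 2 * (\<Sum>j\<in>Basis. wpair \<rho> x0 (Aj0 j) p (grad j p)) + \<kappa> * wpair \<rho> x0 (\<lambda>x. 1) p p"

definition rate :: "real \<Rightarrow> 'n \<Rightarrow> 'n l2 \<Rightarrow> 'n l2 \<Rightarrow> 'n l2 \<Rightarrow> real" where
  "rate \<rho> x0 \<zeta> r p = (wpair \<rho> x0 (\<lambda>x. of_real (1 / a x)) r \<zeta> + wpair \<rho> x0 (\<lambda>x. of_real (1 / a x)) \<zeta> r)
     + (\<Sum>j\<in>Basis. \<Sum>k\<in>Basis. wpair \<rho> x0 (A j k) (grad k p) (grad j r) + wpair \<rho> x0 (A j k) (grad k r) (grad j p))
     + 2 * (\<Sum>j\<in>Basis. wpair \<rho> x0 (Aj0 j) p (grad j r) + wpair \<rho> x0 (Aj0 j) r (grad j p))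
     + \<kappa> * (wpair \<rho> x0 (\<lambda>x. 1) p r + wpair \<rho> x0 (\<lambda>x. 1) r p)"

abbreviation "density_at r p x \<equiv>
  energy_density Basis (\<lambda>j k. A j k x) (\<lambda>j. Aj0 j x) (a x) \<kappa> (rep r x) (\<lambda>k. rep (grad k p) x) (rep p x)"

abbreviation "rate_at \<rho> x0 \<zeta> r p x \<equiv>
  energy_rate Basis (\<lambda>j k. A j k x) (\<lambda>j. Aj0 j x) (a x) \<kappa> (weight \<rho> x0 x)
    (rep p x) (\<lambda>k. rep (grad k p) x) (rep \<zeta> x) (rep r x) (\<lambda>k. rep (grad k r) x)"

text \<open>Connects the sum of bounded bilinear forms, which can be differentiated in time, with
  the density, to which the pointwise estimates apply.\<close>

lemma energy_hbi:
  "has_bochner_integral \<mu> (\<lambda>x. weight \<rho> x0 x * density_at r p x) (energy \<rho> x0 r p)"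
proof -
  let ?e = "weight \<rho> x0"
  have "has_bochner_integral \<mu> (\<lambda>x. ?e x * ((of_real (1 / a x) * rep r x) \<bullet> rep r x)
     + (\<Sum>j\<in>Basis. \<Sum>k\<in>Basis. ?e x * ((A j k x * rep (grad k p) x) \<bullet> rep (grad j p) x))
     + 2 * (\<Sum>j\<in>Basis. ?e x * ((Aj0 j x * rep p x) \<bullet> rep (grad j p) x)) + \<kappa> * (?e x * ((1 * rep p x) \<bullet> rep p x))) (energy \<rho> x0 r p)"
    unfolding energy_def using A Aj0
    by (intro has_bochner_integral_add has_bochner_integral_mult_right has_bochner_integral_sum wpair_hbi Linfty_inverse_a Linfty_1) auto
  then show ?thesis
    by (simp add: energy_density_def inner_of_real_mult[of "1 / a _"] distrib_left sum_distrib_left[symmetric] mult.left_commute[of "weight _ _ _"] del: of_real_divide)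
qed

lemma rate_hbi:
  "has_bochner_integral \<mu> (\<lambda>x. rate_at \<rho> x0 \<zeta> r p x) (rate \<rho> x0 \<zeta> r p)"
proof -
  let ?e = "weight \<rho> x0"
  have "has_bochner_integral \<mu> (\<lambda>x. (?e x * ((of_real (1 / a x) * rep r x) \<bullet> rep \<zeta> x) + ?e x * ((of_real (1 / a x) * rep \<zeta> x) \<bullet> rep r x))
     + (\<Sum>j\<in>Basis. \<Sum>k\<in>Basis. ?e x * ((A j k x * rep (grad k p) x) \<bullet> rep (grad j r) x) + ?e x * ((A j k x * rep (grad k r) x) \<bullet> rep (grad j p) x))
     + 2 * (\<Sum>j\<in>Basis. ?e x * ((Aj0 j x * rep p x) \<bullet> rep (grad j r) x) + ?e x * ((Aj0 j x * rep r x) \<bullet> rep (grad j p) x))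
     + \<kappa> * (?e x * ((1 * rep p x) \<bullet> rep r x) + ?e x * ((1 * rep r x) \<bullet> rep p x))) (rate \<rho> x0 \<zeta> r p)"
    unfolding rate_def using A Aj0
    by (intro has_bochner_integral_add has_bochner_integral_mult_right has_bochner_integral_sum wpair_hbi Linfty_inverse_a Linfty_1) auto
  then show ?thesis
    by (simp add: energy_rate_def inner_of_real_mult[of "1 / a _"] distrib_left sum_distrib_left[symmetric] sum.distrib mult.left_commute[of "weight _ _ _"] del: of_real_divide)
qed

lemma energy_deriv:
  "((\<lambda>t. energy \<rho> x0 (sol_d1 \<xi> h t) (sol \<xi> h t)) has_real_derivative rate \<rho> x0 (sol_d2 \<xi> h t) (sol_d1 \<xi> h t) (sol \<xi> h t)) (at t)"
proof -
  note bb = bounded_bilinear.has_vector_derivative[OF bounded_bilinear_wpair]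
  have "((\<lambda>t. energy \<rho> x0 (sol_d1 \<xi> h t) (sol \<xi> h t)) has_vector_derivative rate \<rho> x0 (sol_d2 \<xi> h t) (sol_d1 \<xi> h t) (sol \<xi> h t)) (at t)"
    unfolding energy_def rate_def using A Aj0
    by (intro has_vector_derivative_add has_vector_derivative_mult_right has_vector_derivative_sum bb Linfty_inverse_a Linfty_1
        sol_deriv sol_d1_deriv grad_sol_deriv) auto
  then show ?thesis by (simp add: has_real_derivative_iff_has_vector_derivative)
qed

text \<open>The weak identity integrates to zero, so twice its integrand may be subtracted from the
  rate without changing the integral; the pointwise bound applies to the difference.\<close>

lemma rate_le:
  assumes gen: "gen p \<zeta>" and r: "rep r \<in> V" and \<rho>: "\<rho> \<ge> 0"
  shows "rate \<rho> x0 \<zeta> r p \<le> growth \<rho> * energy \<rho> x0 r p"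
proof -
  let ?W = "\<lambda>x. weak_form_at \<rho> x0 p \<zeta> r x"
  let ?\<Psi> = "\<lambda>x. rate_at \<rho> x0 \<zeta> r p x"
  let ?e = "\<lambda>x. weight \<rho> x0 x * density_at r p x"
  have 1: "has_bochner_integral \<mu> (\<lambda>x. ?\<Psi> x - 2 * ?W x) (rate \<rho> x0 \<zeta> r p - 2 * 0)"
    by (intro has_bochner_integral_diff has_bochner_integral_mult_right rate_hbi weak_identity gen r \<rho>)
  have 2: "has_bochner_integral \<mu> (\<lambda>x. growth \<rho> * ?e x) (growth \<rho> * energy \<rho> x0 r p)"
    by (intro has_bochner_integral_mult_right energy_hbi)
  have "AE x in \<mu>. ?\<Psi> x - 2 * ?W x \<le> growth \<rho> * ?e x"
    using pointwise_AE
  proof eventually_elim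
    case (elim x)
    show ?case
      by (rule pointwise.\<Psi>_\<Phi>_bound[OF elim]) (use weight_pos dweight_bound \<rho> in auto)
  qed
  from has_bochner_integral_mono_AE[OF 1 2 this] show ?thesis by simp
qed

lemma energy_lower: "c0 * wpair \<rho> x0 (\<lambda>x. 1) p p \<le> energy \<rho> x0 r p"
proof -
  let ?e = "\<lambda>x. weight \<rho> x0 x * density_at r p x"
  note 1 = has_bochner_integral_mult_right[OF wpair_hbi[OF Linfty_1, of \<rho> x0 p p], of c0]
  note 2 = energy_hbi[of \<rho> x0 r p]
  have "AE x in \<mu>. c0 * (weight \<rho> x0 x * ((1 * rep p x) \<bullet> rep p x)) \<le> ?e x"
    using pointwise_AE
  proof eventually_elim
    case (elim x)
    have "(1 * rep p x) \<bullet> rep p x \<le> pointwise.X Basis (rep r x) (\<lambda>k. rep (grad k p) x) (rep p x)"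
      unfolding pointwise.X_def[OF elim] by (simp add: sum_nonneg power2_norm_eq_inner)
    then have "c0 * ((1 * rep p x) \<bullet> rep p x) \<le> c0 * pointwise.X Basis (rep r x) (\<lambda>k. rep (grad k p) x) (rep p x)"
      using c0_pos by (intro mult_left_mono) auto
    also have "\<dots> \<le> density_at r p x"
      by (rule pointwise.dens_lower[OF elim])
    finally have "c0 * ((1 * rep p x) \<bullet> rep p x) \<le> density_at r p x" .
    then have "weight \<rho> x0 x * (c0 * ((1 * rep p x) \<bullet> rep p x)) \<le> ?e x"
      using weight_pos[of \<rho> x0 x] by (intro mult_left_mono) auto
    then show ?case by (simp only: mult.left_commute)
  qed
  from has_bochner_integral_mono_AE[OF 1 2 this] show ?thesis .
qed

lemma wpair_inverse_a_le: "wpair \<rho> x0 (\<lambda>x. of_real (1 / a x)) r r \<le> 1 / lam * wpair \<rho> x0 (\<lambda>x. 1) r r"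
proof -
  note 1 = has_bochner_integral_mult_right[OF wpair_hbi[OF Linfty_1, of \<rho> x0 r r], of "1 / lam"]
  note 2 = wpair_hbi[OF Linfty_inverse_a, of \<rho> x0 r r]
  have "AE x in \<mu>. weight \<rho> x0 x * ((of_real (1 / a x) * rep r x) \<bullet> rep r x) \<le> 1 / lam * (weight \<rho> x0 x * ((1 * rep r x) \<bullet> rep r x))"
    using a_lam
  proof eventually_elim
    case (elim x)
    have "weight \<rho> x0 x * (1 / a x * (rep r x \<bullet> rep r x)) \<le> weight \<rho> x0 x * (1 / lam * (rep r x \<bullet> rep r x))"
      using weight_pos[of \<rho> x0 x] lam elim by (intro mult_left_mono mult_right_mono) (auto simp: frac_le)
    then show ?case by (simp only: inner_of_real_mult mult_1 mult.left_commute)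
  qed
  from has_bochner_integral_mono_AE[OF 2 1 this] show ?thesis .
qed

lemma gronwall:
  fixes E E' :: "real \<Rightarrow> real"
  assumes E: "\<And>t. (E has_real_derivative E' t) (at t)" and le: "\<And>t. E' t \<le> c * E t" and t: "t \<ge> 0"
  shows "E t \<le> exp (c * t) * E 0"
proof -
  have "exp (- c * t) * E t \<le> exp (- c * 0) * E 0"
  proof (rule DERIV_nonpos_imp_nonincreasing[OF t])
    fix s
    have "((\<lambda>s. exp (- c * s) * E s) has_real_derivative exp (- c * s) * (E' s - c * E s)) (at s)"
      by (auto intro!: derivative_eq_intros E simp: algebra_simps)
    moreover have "exp (- c * s) * (E' s - c * E s) \<le> 0"
      using le[of s] by (intro mult_nonneg_nonpos) auto
    ultimately show "\<exists>y. ((\<lambda>s. exp (- c * s) * E s) has_real_derivative y) (at s) \<and> y \<le> 0" by blast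
  qed
  then have le: "exp (c * t) * (exp (- c * t) * E t) \<le> exp (c * t) * E 0" by (simp add: mult_left_mono)
  have "exp (c * t) * (exp (- c * t) * E t) = E t" by (simp add: exp_minus)
  then show ?thesis using le by (simp only:)
qed

lemma grad_0: "b \<in> Basis \<Longrightarrow> grad b 0 = 0"
  \<comment> \<open>The zero class is the value of any \<open>sol\<close> at time \<open>0\<close>,
    which places it in \<open>V\<close>; linearity with coefficient \<open>-1\<close> then gives
    zero.\<close>
  using grad_lincomb[OF gen_V[OF gen_sol] gen_V[OF gen_sol], of b "-1" undefined undefined 0 undefined undefined 0] by (simp add: sol_0)

text \<open>At time \<open>0\<close> the regular solution vanishes, so the initial energy is purely
  kinetic and is bounded by means of \<open>a \<ge> lam\<close>.\<close>

lemma energy_estimate_sol: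
  assumes \<rho>: "\<rho> \<ge> 0" and t: "t \<ge> 0"
  shows "c0 * wpair \<rho> x0 (\<lambda>x. 1) (sol \<xi> h t) (sol \<xi> h t)
    \<le> exp (growth \<rho> * t) * (1 / lam * wpair \<rho> x0 (\<lambda>x. 1) (sol_d1 \<xi> h 0) (sol_d1 \<xi> h 0))"
proof -
  let ?E = "\<lambda>t. energy \<rho> x0 (sol_d1 \<xi> h t) (sol \<xi> h t)"
  have "c0 * wpair \<rho> x0 (\<lambda>x. 1) (sol \<xi> h t) (sol \<xi> h t) \<le> ?E t" by (rule energy_lower)
  also have "\<dots> \<le> exp (growth \<rho> * t) * ?E 0"
    by (rule gronwall[OF energy_deriv rate_le[OF gen_sol gen_V[OF gen_sol_d1] \<rho>] t])
  also have "?E 0 = wpair \<rho> x0 (\<lambda>x. of_real (1 / a x)) (sol_d1 \<xi> h 0) (sol_d1 \<xi> h 0)"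
    using A Aj0 by (simp add: energy_def sol_0 grad_0 bounded_bilinear.zero_left[OF bounded_bilinear_wpair] Linfty_1)
  also have "exp (growth \<rho> * t) * \<dots> \<le> exp (growth \<rho> * t) * (1 / lam * wpair \<rho> x0 (\<lambda>x. 1) (sol_d1 \<xi> h 0) (sol_d1 \<xi> h 0))"
    by (intro mult_left_mono wpair_inverse_a_le) simp
  finally show ?thesis .
qed

text \<open>The estimate for \<open>sol\<close> is homogeneous of degree two with constants
  independent of \<open>h\<close>. Both arguments can be scaled by \<open>2 / h\<^sup>2\<close>
  before \<open>h\<close> tends to \<open>0\<close>.\<close>

lemma energy_estimate_S:
  assumes \<rho>: "\<rho> \<ge> 0" and t: "t \<ge> 0"
  shows "c0 * wpair \<rho> x0 (\<lambda>x. 1) (S \<xi> t) (S \<xi> t) \<le> exp (growth \<rho> * t) * (1 / lam * wpair \<rho> x0 (\<lambda>x. 1) \<xi> \<xi>)"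
proof (rule tendsto_le)
  note bb = bounded_bilinear.tendsto[OF bounded_bilinear_wpair[OF Linfty_1]]
  interpret bb: bounded_bilinear "wpair \<rho> x0 (\<lambda>x. 1)" by (rule bounded_bilinear_wpair[OF Linfty_1])
  show "((\<lambda>h. exp (growth \<rho> * t) * (1 / lam * wpair \<rho> x0 (\<lambda>x. 1) ((2 / h\<^sup>2) *\<^sub>R sol_d1 \<xi> h 0) ((2 / h\<^sup>2) *\<^sub>R sol_d1 \<xi> h 0)))
      \<longlongrightarrow> exp (growth \<rho> * t) * (1 / lam * wpair \<rho> x0 (\<lambda>x. 1) \<xi> \<xi>)) (at 0)"
    by (intro tendsto_mult tendsto_const bb sol_d1_limit)
  show "((\<lambda>h. c0 * wpair \<rho> x0 (\<lambda>x. 1) ((2 / h\<^sup>2) *\<^sub>R sol \<xi> h t) ((2 / h\<^sup>2) *\<^sub>R sol \<xi> h t))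
      \<longlongrightarrow> c0 * wpair \<rho> x0 (\<lambda>x. 1) (S \<xi> t) (S \<xi> t)) (at 0)"
    by (intro tendsto_mult tendsto_const bb sol_limit)
  show "\<forall>\<^sub>F h in at 0. c0 * wpair \<rho> x0 (\<lambda>x. 1) ((2 / h\<^sup>2) *\<^sub>R sol \<xi> h t) ((2 / h\<^sup>2) *\<^sub>R sol \<xi> h t)
      \<le> exp (growth \<rho> * t) * (1 / lam * wpair \<rho> x0 (\<lambda>x. 1) ((2 / h\<^sup>2) *\<^sub>R sol_d1 \<xi> h 0) ((2 / h\<^sup>2) *\<^sub>R sol_d1 \<xi> h 0))"
  proof (intro always_eventually allI)
    fix h :: real
    show "c0 * wpair \<rho> x0 (\<lambda>x. 1) ((2 / h\<^sup>2) *\<^sub>R sol \<xi> h t) ((2 / h\<^sup>2) *\<^sub>R sol \<xi> h t)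
      \<le> exp (growth \<rho> * t) * (1 / lam * wpair \<rho> x0 (\<lambda>x. 1) ((2 / h\<^sup>2) *\<^sub>R sol_d1 \<xi> h 0) ((2 / h\<^sup>2) *\<^sub>R sol_d1 \<xi> h 0))"
      using mult_left_mono[OF energy_estimate_sol[OF \<rho> t, of x0 \<xi> h], of "(2 / h\<^sup>2) * (2 / h\<^sup>2)"]
      by (simp only: bb.scaleR_left bb.scaleR_right real_scaleR_def) (simp add: mult_ac)
  qed
qed simp

end

section \<open>Finite propagation speed\<close>

text \<open>Outside the essential support every point of \<Omega> has a neighbourhood where
  \<open>f\<close> vanishes almost everywhere; by Lindelof countably many of them suffice, so the
  exceptional null sets add up to a null set.\<close>

lemma AE_esssupp_disjoint:
  fixes \<Omega> :: "'n::euclidean_space set"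
  assumes \<Omega>: "\<Omega> \<in> sets lebesgue" and disj: "esssupp \<Omega> f \<inter> U = {}"
  shows "AE x in lebesgue_on \<Omega>. x \<in> U \<longrightarrow> f x = 0"
proof -
  define \<F> where "\<F> = {W. open W \<and> (AE y in lebesgue_on (\<Omega> \<inter> W). f y = 0)}"
  obtain \<F>' where \<F>': "\<F>' \<subseteq> \<F>" "countable \<F>'" "\<Union>\<F>' = \<Union>\<F>"
    using Lindelof[of \<F>] by (auto simp: \<F>_def)
  have "AE x in lebesgue. x \<in> \<Omega> \<inter> W \<longrightarrow> f x = 0" if "W \<in> \<F>'" for W
  proof -
    have "open W" "AE y in lebesgue_on (\<Omega> \<inter> W). f y = 0" using that \<F>'(1) by (auto simp: \<F>_def)
    moreover have "\<Omega> \<inter> W \<in> sets lebesgue" using \<Omega> \<open>open W\<close> by auto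
    ultimately show ?thesis by (simp add: AE_restrict_space_iff)
  qed
  then have "AE x in lebesgue. \<forall>W\<in>\<F>'. x \<in> \<Omega> \<inter> W \<longrightarrow> f x = 0"
    unfolding AE_ball_countable[OF \<F>'(2)] by blast
  then have "AE x in lebesgue. x \<in> \<Omega> \<longrightarrow> x \<in> U \<longrightarrow> f x = 0"
  proof eventually_elim
    case (elim x)
    show ?case
    proof (intro impI)
      assume x: "x \<in> \<Omega>" "x \<in> U"
      then have "x \<notin> esssupp \<Omega> f" using disj by blast
      then have "x \<in> \<Union>\<F>" using x(1) by (auto simp: esssupp_def \<F>_def)
      then show "f x = 0" using elim x(1) \<F>'(3) by blast
    qed
  qed
  then show ?thesis using \<Omega> by (simp add: AE_restrict_space_iff)
qed

context wave
begin

abbreviation "speed \<equiv> energy_speed DIM('n) coeff_bound / c0"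

lemma speed_nonneg: "speed \<ge> 0"
  using coeff_bound_ge_1 c0_pos by (simp add: energy_speed_def)

lemma Linfty_indicator:
  assumes "W \<in> sets lebesgue" shows "Linfty \<Omega> (indicator W :: 'n \<Rightarrow> complex)"
proof -
  have "(indicator W :: 'n \<Rightarrow> complex) \<in> borel_measurable \<mu>"
    by (rule measurable_restrict_space1[OF borel_measurable_indicator[OF assms]])
  moreover have "AE x in \<mu>. cmod (indicator W x) \<le> 1"
    by (simp add: indicator_def)
  ultimately show ?thesis unfolding Linfty_def by blast
qed

lemma wpair_upper:
  assumes \<rho>: "\<rho> \<ge> 0" and van: "AE x in \<mu>. x \<in> ball x0 r \<longrightarrow> rep \<xi> x = 0"
  shows "wpair \<rho> x0 (\<lambda>x. 1) \<xi> \<xi> \<le> 2 ^ DIM('n) * exp (- \<rho> * r) * sq_on \<xi>"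
proof -
  note 1 = wpair_hbi[OF Linfty_1, of \<rho> x0 \<xi> \<xi>]
  note 2 = has_bochner_integral_mult_right[OF sq_on_hbi[of \<xi>], of "2 ^ DIM('n) * exp (- \<rho> * r)"]
  have "AE x in \<mu>. weight \<rho> x0 x * ((1 * rep \<xi> x) \<bullet> rep \<xi> x) \<le> 2 ^ DIM('n) * exp (- \<rho> * r) * (cmod (rep \<xi> x))\<^sup>2"
    using van
  proof eventually_elim
    case (elim x)
    show ?case
    proof (cases "x \<in> ball x0 r")
      case False
      then have "weight \<rho> x0 x \<le> 2 ^ DIM('n) * exp (- \<rho> * r)"
        by (intro weight_upper \<rho>) (simp add: dist_commute not_less)
      then show ?thesis by (simp add: power2_norm_eq_inner mult_right_mono)
    qed (use elim in simp)
  qed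
  from has_bochner_integral_mono_AE[OF 1 2 this] show ?thesis .
qed

lemma pair_indicator_hbi:
  assumes "W \<in> sets lebesgue"
  shows "has_bochner_integral \<mu> (\<lambda>x. (indicator W x * rep \<xi> x) \<bullet> rep \<xi> x) (pair \<Omega> (indicator W) \<xi> \<xi>)"
  unfolding pair_def by (intro has_bochner_integral_integrable pair_integrable \<Omega> Linfty_indicator assms)

lemma indicator_inner: "(indicator W x * y) \<bullet> y = indicator W x * (cmod y)\<^sup>2" for y :: complex
  by (auto simp: indicator_def power2_norm_eq_inner)

lemma wpair_lower:
  assumes \<rho>: "\<rho> \<ge> 0"
  shows "exp (- \<rho> * (real DIM('n) * s)) * pair \<Omega> (indicator (ball x0 s)) \<xi> \<xi> \<le> wpair \<rho> x0 (\<lambda>x. 1) \<xi> \<xi>"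
proof -
  have W: "ball x0 s \<in> sets lebesgue" by simp
  note 1 = wpair_hbi[OF Linfty_1, of \<rho> x0 \<xi> \<xi>]
  note 2 = has_bochner_integral_mult_right[OF pair_indicator_hbi[OF W, of \<xi>], of "exp (- \<rho> * (real DIM('n) * s))"]
  have "exp (- \<rho> * (real DIM('n) * s)) * ((indicator (ball x0 s) x * rep \<xi> x) \<bullet> rep \<xi> x) \<le> weight \<rho> x0 x * ((1 * rep \<xi> x) \<bullet> rep \<xi> x)" for x
  proof (cases "x \<in> ball x0 s")
    case True
    then have "exp (- \<rho> * (real DIM('n) * s)) \<le> weight \<rho> x0 x"
      by (intro weight_lower \<rho>) (simp add: dist_commute)
    then show ?thesis using True by (simp add: mult_right_mono)
  qed (use weight_pos[of \<rho> x0 x] in simp)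
  then show ?thesis by (intro has_bochner_integral_mono_AE[OF 2 1]) simp
qed

text \<open>Local vanishing becomes the vanishing of a bounded bilinear form, which can be reached
  by a limit in \<rho> and by differentiation in time.\<close>

lemma vanish_iff_pair_indicator:
  assumes W: "W \<in> sets lebesgue"
  shows "(AE x in \<mu>. x \<in> W \<longrightarrow> rep \<xi> x = 0) \<longleftrightarrow> pair \<Omega> (indicator W) \<xi> \<xi> = 0"
proof -
  have "pair \<Omega> (indicator W) \<xi> \<xi> = 0 \<longleftrightarrow> (AE x in \<mu>. (indicator W x * rep \<xi> x) \<bullet> rep \<xi> x = 0)"
    unfolding pair_def using pair_indicator_hbi[OF W, of \<xi>]
    by (intro integral_nonneg_eq_0_iff_AE) (auto simp: has_bochner_integral_iff indicator_inner)
  also have "\<dots> \<longleftrightarrow> (AE x in \<mu>. x \<in> W \<longrightarrow> rep \<xi> x = 0)"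
    unfolding indicator_inner by (intro AE_cong) (auto simp: indicator_def)
  finally show ?thesis by simp
qed

lemma S_vanishes:
  assumes van: "AE x in \<mu>. x \<in> ball x0 r \<longrightarrow> rep \<xi> x = 0"
    and t: "t \<ge> 0" and s: "real DIM('n) * s + speed * t < r"
  shows "pair \<Omega> (indicator (ball x0 s)) (S \<xi> t) (S \<xi> t) = 0"
proof -
  define I where "I = pair \<Omega> (indicator (ball x0 s)) (S \<xi> t) (S \<xi> t)"
  define \<delta> where "\<delta> = r - real DIM('n) * s - speed * t"
  \<comment> \<open>\<open>K\<close> collects the factors free of \<rho>, among them the part of
    \<open>growth\<close> that comes from \<open>energy_M\<close>. The remaining exponents, from the
    two weight bounds and the speed, add up to \<open>- \<rho> * \<delta>\<close>.\<close>
  define K where "K = exp (energy_M DIM('n) coeff_bound lam / c0 * t) * 2 ^ DIM('n) * sq_on \<xi> / (c0 * lam)"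
  have \<delta>: "\<delta> > 0" using s by (simp add: \<delta>_def)
  have I_le: "I \<le> K * exp (- \<rho> * \<delta>)" if \<rho>: "\<rho> \<ge> 0" for \<rho>
  proof -
    have "c0 * (exp (- \<rho> * (real DIM('n) * s)) * I) \<le> c0 * wpair \<rho> x0 (\<lambda>x. 1) (S \<xi> t) (S \<xi> t)"
      unfolding I_def using c0_pos by (intro mult_left_mono wpair_lower \<rho>) auto
    also have "\<dots> \<le> exp (growth \<rho> * t) * (1 / lam * wpair \<rho> x0 (\<lambda>x. 1) \<xi> \<xi>)"
      by (rule energy_estimate_S[OF \<rho> t])
    also have "\<dots> \<le> exp (growth \<rho> * t) * (1 / lam * (2 ^ DIM('n) * exp (- \<rho> * r) * sq_on \<xi>))"
      using lam by (intro mult_left_mono wpair_upper \<rho> van) auto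
    finally have "exp (\<rho> * (real DIM('n) * s)) * (c0 * (exp (- \<rho> * (real DIM('n) * s)) * I)) / c0
        \<le> exp (\<rho> * (real DIM('n) * s)) * (exp (growth \<rho> * t) * (1 / lam * (2 ^ DIM('n) * exp (- \<rho> * r) * sq_on \<xi>))) / c0"
      using c0_pos by (intro divide_right_mono mult_left_mono) auto
    also have "exp (\<rho> * (real DIM('n) * s)) * (c0 * (exp (- \<rho> * (real DIM('n) * s)) * I)) / c0 = I"
      using c0_pos by (simp add: exp_minus)
    also have "exp (\<rho> * (real DIM('n) * s)) * (exp (growth \<rho> * t) * (1 / lam * (2 ^ DIM('n) * exp (- \<rho> * r) * sq_on \<xi>))) / c0
        = (exp (\<rho> * (real DIM('n) * s)) * exp (growth \<rho> * t) * exp (- \<rho> * r)) * (2 ^ DIM('n) * sq_on \<xi> / (c0 * lam))"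
      by (simp add: mult_ac)
    also have "exp (\<rho> * (real DIM('n) * s)) * exp (growth \<rho> * t) * exp (- \<rho> * r) = exp (energy_M DIM('n) coeff_bound lam / c0 * t) * exp (- \<rho> * \<delta>)"
      unfolding exp_add[symmetric] by (simp add: \<delta>_def algebra_simps add_divide_distrib)
    finally show ?thesis by (simp add: K_def mult_ac)
  qed
  have "((\<lambda>\<rho>. K * exp (- \<rho> * \<delta>)) \<longlongrightarrow> K * 0) at_top"
  proof (intro tendsto_mult tendsto_const)
    have "filterlim (\<lambda>\<rho>. \<rho> * \<delta>) at_top at_top"
      using filterlim_tendsto_pos_mult_at_top[OF tendsto_const \<delta> filterlim_ident] by (simp add: mult.commute)
    then have "filterlim (\<lambda>\<rho>. - (\<rho> * \<delta>)) at_bot at_top"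
      by (simp add: filterlim_uminus_at_bot)
    from filterlim_compose[OF exp_at_bot this] show "((\<lambda>\<rho>. exp (- \<rho> * \<delta>)) \<longlongrightarrow> 0) at_top" by simp
  qed
  moreover have "\<forall>\<^sub>F \<rho> in at_top. I \<le> K * exp (- \<rho> * \<delta>)"
    using eventually_ge_at_top[of 0] by eventually_elim (rule I_le)
  ultimately have "I \<le> 0"
    using tendsto_lowerbound[of "\<lambda>\<rho>. K * exp (- \<rho> * \<delta>)" "K * 0" at_top I] by simp
  moreover have "I \<ge> 0"
    unfolding I_def pair_def by (intro integral_nonneg_AE always_eventually allI) (simp add: indicator_inner)
  ultimately show ?thesis by (simp add: I_def)
qed

text \<open>The function \<phi> tests the sine orbit against the fixed vector
  \<open>T t \<xi>\<close>, so its derivative at \<open>t\<close> is the quantity in question. The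
  hypothesis on \<open>s\<close> covers all times in \<open>cbox 0 t\<close>, and at the end point
  of this interval the one-sided derivative is unique because \<open>t > 0\<close>.\<close>

lemma T_vanishes:
  assumes van: "AE x in \<mu>. x \<in> ball x0 r \<longrightarrow> rep \<xi> x = 0"
    and t: "t > 0" and s: "real DIM('n) * s + speed * t < r"
  shows "pair \<Omega> (indicator (ball x0 s)) (T t \<xi>) (T t \<xi>) = 0"
proof -
  have W: "ball x0 s \<in> sets lebesgue" by simp
  note lin = bounded_bilinear_pair[OF \<Omega> Linfty_indicator[OF W]]
  define \<phi> where "\<phi> \<tau> = pair \<Omega> (indicator (ball x0 s)) (S \<xi> \<tau>) (T t \<xi>)" for \<tau>
  have \<phi>_0: "\<phi> \<tau> = 0" if "\<tau> \<in> cbox 0 t" for \<tau>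
  proof -
    have "speed * \<tau> \<le> speed * t" using that speed_nonneg by (intro mult_left_mono) auto
    then have "pair \<Omega> (indicator (ball x0 s)) (S \<xi> \<tau>) (S \<xi> \<tau>) = 0"
      using that s by (intro S_vanishes[OF van]) auto
    then have "AE x in \<mu>. x \<in> ball x0 s \<longrightarrow> rep (S \<xi> \<tau>) x = 0"
      using vanish_iff_pair_indicator[OF W] by simp
    then have "AE x in \<mu>. (indicator (ball x0 s) x * rep (S \<xi> \<tau>) x) \<bullet> rep (T t \<xi>) x = 0"
      by eventually_elim (auto simp: indicator_def)
    then show ?thesis unfolding \<phi>_def pair_def by (rule integral_eq_zero_AE)
  qed
  have "(\<phi> has_vector_derivative pair \<Omega> (indicator (ball x0 s)) (T t \<xi>) (T t \<xi>)) (at t)"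
    unfolding \<phi>_def
    by (rule bounded_linear.has_vector_derivative[OF bounded_bilinear.bounded_linear_left[OF lin] S_deriv])
  then have d: "(\<phi> has_vector_derivative pair \<Omega> (indicator (ball x0 s)) (T t \<xi>) (T t \<xi>)) (at t within cbox 0 t)"
    by (rule has_vector_derivative_at_within)
  have d0: "(\<phi> has_vector_derivative 0) (at t within cbox 0 t)"
    by (rule has_vector_derivative_transform[where f = "\<lambda>_. 0"]) (use \<phi>_0 t in auto)
  have "t \<in> cbox 0 t" using t by simp
  from vector_derivative_unique_within_closed_interval[OF t this d d0] show ?thesis .
qed

lemma R_cls_on: "L2 \<mu> f \<Longrightarrow> R (cls_on \<Omega> f) = cls_on \<Omega> f"
  unfolding R_def using lift_cong[OF liftable_id rep_cls_on[OF \<Omega>]] by simp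

lemma T_cls_on: "L2 \<mu> f \<Longrightarrow> T t (cls_on \<Omega> f) = cls_on \<Omega> (C t f)"
  unfolding T_def using lift_cong[OF liftable_C rep_cls_on[OF \<Omega>]] by (simp add: R_cls_on)

lemma inner_cls_on_l2inner:
  assumes "L2 \<mu> f"
  shows "cls_on \<Omega> f \<bullet> \<omega> = Re (l2inner \<Omega> f (rep \<omega>))"
  unfolding inner_cls_on[OF \<Omega> assms] l2inner_def inner_complex_Re
  by (intro integral_Re L2_mult_integrable L2_cnj assms L2_lebesgue_on_rep \<Omega>)

text \<open>Both sides are compared through their inner products with an arbitrary \<omega>: bounded
  functionals commute with the vector-valued integral on one side, and the other side is the
  defining property of \<open>h\<close>.\<close>

lemma time_integral_cls_on:
  assumes g: "L2 \<mu> g" and t: "t > 0" and h: "time_integral \<Omega> C g t h"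
  shows "cls_on \<Omega> h = S (cls_on \<Omega> g) t"
proof -
  let ?\<xi> = "cls_on \<Omega> g"
  have hL: "L2 \<mu> h" using h by (simp add: time_integral_def sq_int_L2)
  have cont: "continuous_on {0..t} (\<lambda>s. T s ?\<xi>)" using continuous_T continuous_on_subset by blast
  have S_eq: "S ?\<xi> t = integral {0..t} (\<lambda>s. T s ?\<xi>)"
    using t by (simp add: S_def prim_def)
  have "cls_on \<Omega> h \<bullet> \<omega> = S ?\<xi> t \<bullet> \<omega>" for \<omega>
  proof -
    define F where "F s = l2inner \<Omega> (C s g) (rep \<omega>)" for s
    have Re_F: "Re (F s) = T s ?\<xi> \<bullet> \<omega>" for s
      unfolding F_def T_cls_on[OF g] by (rule inner_cls_on_l2inner[symmetric, OF C_L2[OF g]])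
    \<comment> \<open>The complex product consists of two real ones, with \<omega> and with \<i>
      times \<omega>. The second supplies continuity of \<open>Im (F s)\<close>, so that the
      complex-valued \<open>F\<close> is integrable and \<open>Re\<close> may be moved inside the
      integral.\<close>
    have i\<omega>: "L2 lebesgue (\<lambda>x. \<i> * rep \<omega> x)" by (intro L2_cmult L2_rep)
    have Im_F: "Im (F s) = T s ?\<xi> \<bullet> cls (\<lambda>x. \<i> * rep \<omega> x)" for s
    proof -
      have "T s ?\<xi> \<bullet> cls (\<lambda>x. \<i> * rep \<omega> x) = Re (l2inner \<Omega> (C s g) (rep (cls (\<lambda>x. \<i> * rep \<omega> x))))"
        unfolding T_cls_on[OF g] by (rule inner_cls_on_l2inner[OF C_L2[OF g]])
      also have "l2inner \<Omega> (C s g) (rep (cls (\<lambda>x. \<i> * rep \<omega> x))) = (\<integral>x. - \<i> * (C s g x * cnj (rep \<omega> x)) \<partial>\<mu>)"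
        unfolding l2inner_def
      proof (rule integral_cong_AE)
        have [measurable]: "C s g \<in> borel_measurable \<mu>" by (rule L2_measurable[OF C_L2[OF g]])
        have [measurable]: "rep \<omega>' \<in> borel_measurable \<mu>" for \<omega>' by (rule L2_measurable[OF L2_lebesgue_on_rep[OF \<Omega>]])
        show "(\<lambda>x. C s g x * cnj (rep (cls (\<lambda>x. \<i> * rep \<omega> x)) x)) \<in> borel_measurable \<mu>"
          "(\<lambda>x. - \<i> * (C s g x * cnj (rep \<omega> x))) \<in> borel_measurable \<mu>" by measurable
        show "AE x in \<mu>. C s g x * cnj (rep (cls (\<lambda>x. \<i> * rep \<omega> x)) x) = - \<i> * (C s g x * cnj (rep \<omega> x))"
          using AE_lebesgue_on[OF \<Omega> rep_cls[OF i\<omega>]] by eventually_elim simp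
      qed
      also have "\<dots> = - \<i> * F s" by (simp only: integral_mult_right_zero F_def l2inner_def)
      finally show ?thesis by simp
    qed
    have "continuous_on {0..t} (\<lambda>s. Complex (Re (F s)) (Im (F s)))"
      unfolding Complex_eq Re_F Im_F by (intro continuous_intros cont)
    then have F_int: "F integrable_on {0..t}" by (simp add: integrable_continuous_interval)
    have "cls_on \<Omega> h \<bullet> \<omega> = Re (integral {0..t} F)"
      unfolding inner_cls_on_l2inner[OF hL] F_def
      using h L2_lebesgue_on_rep[OF \<Omega>] by (simp add: time_integral_def sq_int_L2)
    also have "\<dots> = integral {0..t} (\<lambda>s. Re (F s))"
      using integral_linear[OF F_int bounded_linear_Re] by (simp add: o_def)
    also have "\<dots> = S ?\<xi> t \<bullet> \<omega>"
      unfolding Re_F S_eq using integral_linear[OF integrable_continuous_interval[OF cont] bounded_linear_inner_left[of \<omega>]]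
      by (simp add: o_def)
    finally show ?thesis .
  qed
  then have "(cls_on \<Omega> h - S ?\<xi> t) \<bullet> (cls_on \<Omega> h - S ?\<xi> t) = 0"
    by (simp add: inner_diff_left)
  then show ?thesis by simp
qed

lemma propagation:
  assumes f: "L2 \<mu> f" and g: "L2 \<mu> g"
    and supp: "esssupp \<Omega> f \<union> esssupp \<Omega> g \<subseteq> K" and t: "t > 0" and h: "time_integral \<Omega> C g t h"
  shows "esssupp \<Omega> (\<lambda>x. C t f x + h x) \<subseteq> nbhd \<Omega> K (speed * t)"
proof
  fix x0 assume x0: "x0 \<in> esssupp \<Omega> (\<lambda>x. C t f x + h x)"
  show "x0 \<in> nbhd \<Omega> K (speed * t)"
  proof (rule ccontr)
    assume not: "x0 \<notin> nbhd \<Omega> K (speed * t)"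
    have x0\<Omega>: "x0 \<in> \<Omega>" using x0 by (simp add: esssupp_def)
    obtain r where r: "speed * t < r" "ball x0 r \<inter> K = {}"
    proof (cases "K = {}")
      case True
      then show ?thesis using that[of "speed * t + 1"] by simp
    next
      case False
      then have "speed * t < infdist x0 K" using not x0\<Omega> by (auto simp: nbhd_def)
      moreover have "ball x0 (infdist x0 K) \<inter> K = {}" using infdist_le[of _ K x0] by force
      ultimately show ?thesis using that by blast
    qed
    \<comment> \<open>The ball uses up half of the gap \<open>r - speed * t\<close>; dividing by
      \<open>DIM('n)\<close> compensates the loss in \<open>weight_lower\<close>.\<close>
    define s where "s = (r - speed * t) / (2 * real DIM('n))"
    have n: "real DIM('n) > 0" by simp
    have s_pos: "s > 0" using r(1) n unfolding s_def by (intro divide_pos_pos) auto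
    have "real DIM('n) * s = (r - speed * t) / 2" using n by (simp add: s_def)
    then have s: "real DIM('n) * s + speed * t < r" using r(1) by (simp add: field_simps)
    have W: "ball x0 s \<in> sets lebesgue" by simp
    have van: "AE x in \<mu>. x \<in> ball x0 r \<longrightarrow> rep (cls_on \<Omega> e) x = 0"
      if e: "L2 \<mu> e" "esssupp \<Omega> e \<subseteq> K" for e
    proof -
      have "AE x in \<mu>. x \<in> ball x0 r \<longrightarrow> e x = 0"
        by (rule AE_esssupp_disjoint[OF \<Omega>]) (use e(2) r(2) in blast)
      then show ?thesis using rep_cls_on[OF \<Omega> e(1)] by eventually_elim simp
    qed
    have "AE x in \<mu>. x \<in> ball x0 s \<longrightarrow> rep (T t (cls_on \<Omega> f)) x = 0"
      using T_vanishes[OF van[OF f] t s] supp vanish_iff_pair_indicator[OF W] by auto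
    moreover have "AE x in \<mu>. rep (T t (cls_on \<Omega> f)) x = C t f x"
      unfolding T_cls_on[OF f] by (rule rep_cls_on[OF \<Omega> C_L2[OF f]])
    moreover have "AE x in \<mu>. x \<in> ball x0 s \<longrightarrow> rep (S (cls_on \<Omega> g) t) x = 0"
      using S_vanishes[OF van[OF g] less_imp_le[OF t] s] supp vanish_iff_pair_indicator[OF W] by auto
    moreover have "AE x in \<mu>. rep (S (cls_on \<Omega> g) t) x = h x"
      unfolding time_integral_cls_on[OF g t h, symmetric]
      using h by (intro rep_cls_on \<Omega>) (simp add: time_integral_def sq_int_L2)
    ultimately have "AE x in \<mu>. x \<in> ball x0 s \<longrightarrow> C t f x + h x = 0"
      by eventually_elim simp
    then have "AE x in lebesgue. x \<in> \<Omega> \<inter> ball x0 s \<longrightarrow> C t f x + h x = 0"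
      using \<Omega> by (simp add: AE_restrict_space_iff imp_conjL)
    then have "AE x in lebesgue_on (\<Omega> \<inter> ball x0 s). C t f x + h x = 0"
      using sets.Int[OF \<Omega> W] by (simp add: AE_restrict_space_iff)
    then have "x0 \<notin> esssupp \<Omega> (\<lambda>x. C t f x + h x)"
      using s_pos by (auto simp: esssupp_def intro!: exI[of _ "ball x0 s"])
    then show False using x0 by blast
  qed
qed

end

theorem theorem5p6:
  fixes \<Omega> :: "'n::euclidean_space set"
    and V :: "('n \<Rightarrow> complex) set"
    and a :: "'n \<Rightarrow> real"
    and A00 :: "'n \<Rightarrow> complex" and A0 :: "'n \<Rightarrow> 'n \<Rightarrow> complex"
    and Aj0 :: "'n \<Rightarrow> 'n \<Rightarrow> complex" and A :: "'n \<Rightarrow> 'n \<Rightarrow> 'n \<Rightarrow> complex"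
    and lam :: real
    and C :: "real \<Rightarrow> ('n \<Rightarrow> complex) \<Rightarrow> ('n \<Rightarrow> complex)"
  assumes "open \<Omega>"
    and "admissible_V \<Omega> V"
    and "Linfty \<Omega> a" and "Linfty \<Omega> A00"
    and "\<forall>k\<in>Basis. Linfty \<Omega> (A0 k)" and "\<forall>j\<in>Basis. Linfty \<Omega> (Aj0 j)"
    and "\<forall>j\<in>Basis. \<forall>k\<in>Basis. Linfty \<Omega> (A j k)"
    and "lam > 0"
    and "AE x in lebesgue_on \<Omega>. a x \<ge> lam"
    and "AE x in lebesgue_on \<Omega>. \<forall>\<zeta> :: 'n \<Rightarrow> complex.
           Im (\<Sum>j\<in>Basis. \<Sum>k\<in>Basis. A j k x * \<zeta> k * cnj (\<zeta> j)) = 0 \<and>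
           Re (\<Sum>j\<in>Basis. \<Sum>k\<in>Basis. A j k x * \<zeta> k * cnj (\<zeta> j))
             \<ge> lam * (\<Sum>j\<in>Basis. (cmod (\<zeta> j))\<^sup>2)"
    and "cosine_family_gen \<Omega> C (\<lambda>u w. L_op \<Omega> V a A00 A0 Aj0 A u (\<lambda>x. - w x))"
  shows "\<exists>\<alpha>::real. \<forall>f g K t h.
           K \<subseteq> \<Omega> \<and> f \<in> V \<and> sq_int \<Omega> g \<and>
           esssupp \<Omega> f \<union> esssupp \<Omega> g \<subseteq> K \<and> t > 0 \<and> time_integral \<Omega> C g t h \<longrightarrow>
           esssupp \<Omega> (\<lambda>x. C t f x + h x) \<subseteq> nbhd \<Omega> K (\<alpha> * t)"
proof -
  interpret wave \<Omega> V a A00 A0 Aj0 A lam C by (rule wave.intro) fact+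
  show ?thesis
  proof (intro exI allI impI)
    fix f g K t h
    assume "K \<subseteq> \<Omega> \<and> f \<in> V \<and> sq_int \<Omega> g \<and> esssupp \<Omega> f \<union> esssupp \<Omega> g \<subseteq> K \<and> t > 0 \<and> time_integral \<Omega> C g t h"
    then show "esssupp \<Omega> (\<lambda>x. C t f x + h x) \<subseteq> nbhd \<Omega> K (speed * t)"
      by (elim conjE) (rule propagation[OF V_L2], simp_all only: sq_int_L2)
  qed
qed

end
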